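(* Let $J\ge3$, let $G$ be a subgroup of $D_J$, and let $(S,\{f_s\}_{s\in S},G)$ be a $(J,G)$-s.s. system. Put $M_J=J-2$ if $J$ is even and $M_J=2J-2$ if $J$ is odd. Let $\gamma$ be a path of $(T_{n+m},E_{n+m}^* )$ and suppose that $[\gamma]_n(l_n(\gamma))\notin\Gamma_{M_J}([\gamma]_n(1))$. Then there exists $$A\subseteq\bigcup_{g\in G,\ j=2,\dots,l_n(\gamma)-1}g(\sigma_n(\gamma)_j)$$ such that $A$ is $(T_m,E_m^* )$-connected and either $\#(\partial A)\ge3$, or $J$ is even and $\partial A=\{i,i+J/2\}\subseteq(\mathbb{Z}_J)^e$ for some $i$. In particular, suppose that $[\gamma]_n=(w(1),\dots,w(l_n(\gamma)))$ is a path of $(T_n,E_n^\ell)$ and define $$\widehat\gamma=w(2)\sigma_n(\gamma)_2\vee\dots\vee w(l_n(\gamma)-1)\sigma_n(\gamma)_{l_n(\gamma)-1}.$$ Then either $\#((\partial\sigma_n^F(\widehat\gamma))^e)\ge3$, or $J$ is even and $(\partial\sigma_n^F(\widehat\gamma))^e=\{i,i+J/2\}\subseteq(\mathbb{Z}_J)^e$ for some $i$.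
   Context: Polygon: $J\ge3$ is an integer, $\mathbb{Z}_J=\mathbb{Z}/J\mathbb{Z}$, $p_i=\frac1{\cos(\pi/J)}(\cos\theta_i,\sin\theta_i)$ with $\theta_i=\frac{\pi}{J}+\frac{2\pi}{J}i-\frac{\pi}{2}$, $b_i$ is the segment joining $p_{i-1}$ and $p_i$, and $Q_*\subset\mathbb{R}^2$ is the closed filled regular $J$-gon with vertices $p_0,\dots,p_{J-1}$. $R_\theta$ is the reflection in the line through $0$ with direction $(\cos\theta,\sin\theta)$; $D_J=\{g\in O(2): g(Q_* )=Q_*\}$; $\rho(i)=2\pi i/J$; $D_J^*$ is the subgroup of $O(2)$ generated by $D_J$ and all $R_{\rho(i)}$. Each $g\in D_J$ acts on $\mathbb{Z}_J$ by $g(b_i)=b_{g(i)}$. System: For a subgroup $G$ of $D_J$, a finite set $S$ and contractions $\{f_s\}_{s\in S}$ of $\mathbb{R}^2$, $(S,\{f_s\}_{s\in S},G)$ is a $G$-symmetric $J$-gon-based self-similar system ($(J,G)$-s.s. system) if: (A1) there are $r\in(0,1)$ and $(\varphi_s,c_s)\in D_J^*\times\mathbb{R}^2$ with $f_s(x)=r\varphi_s(x)+c_s$ for all $x$, and $f_s(Q_* )\subseteq Q_*$ for all $s\in S$; (A2) for every $i\in\mathbb{Z}_J$ there is $(s,j)\in S\times\mathbb{Z}_J$ with $f_s(b_j)\subseteq b_i$; (A3) for every $g\in G$ there is $g_*:S\to S$ with $(f_{g_*(s)})^{-1}\circ g\circ f_s\in G$ for all $s\in S$; (A4) if $s\neq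 s'$ and $f_s(Q_* )\cap f_{s'}(Q_* )\neq\emptyset$, then either (a) $f_s(Q_* )\cap f_{s'}(Q_* )=f_s(b_i)=f_{s'}(b_j)$ for some $i,j$ and $(\varphi_{s'})^{-1}\circ\varphi_s\circ R_{\rho(i)}\in G$, or (b) $f_s(Q_* )\cap f_{s'}(Q_* )=\{f_s(p_i)\}=\{f_{s'}(p_j)\}$ for some $i,j$; (A5) the graph $(S,E_1^\ell)$, $E_1^\ell=\{(s,s'): \text{(A4)(a) holds}\}$, is connected. Words and $K$: $K$ is the unique nonempty compact set with $K=\bigcup_{s\in S}f_s(K)$. $T_m=S^m$, $T=\bigcup_{m\ge0}T_m$ ($T_0=\{\phi\}$, empty word), $f_{w_1\dots w_m}=f_{w_1}\circ\dots\circ f_{w_m}$, $K_w=f_w(K)$, $Q_w=f_w(Q_* )$, $b_i(w)=f_w(b_i)$. For $w=w_1\dots w_k$ and $n\le k$: $[w]_n=w_1\dots w_n$, $\sigma_n(w)=w_{n+1}\dots w_k$. For $g\in G$, $w\in T$, $g(w)$ is the unique word of the same length with $g(Q_w)=Q_{g(w)}$ (it exists); $g$ is applied to a path or set of words elementwise. Graphs: $E_n^*=\{(w,v): w\neq v\in T_n, K_w\cap K_v\neq\emptyset\}$; $E_n^\ell$ is the set of $(w,v)$, $w\neq v\in T_n$, with $Q_w\cap Q_v=b_i(w)=b_j(v)$ for some $i,j$; for such $(w,v)$, $R_{w,v}$ is the reflection in the line containing $Q_w\cap Q_v$ and $g_{w,v}=(f_w)^{-1}\circ R_{w,v}\circ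 f_v$ (which lies in $G$). A path of a graph is a finite sequence of vertices, consecutive ones joined by an edge; a set $A$ of vertices is connected in the graph if any two of its elements are joined by a path inside $A$. A path is also regarded as the set of its vertices. For $w\in T_n$, $\Gamma_M(w)$ is the set of $v\in T_n$ at graph distance at most $M$ from $w$ in $(T_n,E_n^* )$. Decomposition of paths: let $\gamma=(\gamma(1),\dots,\gamma(l))$ be a path of $(T_N,E_N^* )$ and $0\le k\le N$. Let $0=j_0<j_1<\dots<j_{l_k(\gamma)}=l$ be the indices such that $[\gamma(\cdot)]_k$ is constant on $\{j_{i-1}+1,\dots,j_i\}$ for each $i$ and $[\gamma(j_i)]_k\neq[\gamma(j_i+1)]_k$. Then $[\gamma]_k=([\gamma(j_1)]_k,\dots,[\gamma(j_{l_k(\gamma)})]_k)$, with $i$-th entry $[\gamma]_k(i)$, and $\sigma_k(\gamma)_i=(\sigma_k(\gamma(j_{i-1}+1)),\dots,\sigma_k(\gamma(j_i)))$. $\vee$ is concatenation of paths, where if the last vertex of the first equals the first vertex of the second it is written only once; $w\gamma$ is the path obtained by prefixing the word $w$ to each entry. If $[\gamma]_k$ is a path of $(T_k,E_k^\ell)$, the $k$-folding of $\gamma$ is $\sigma_k^F(\gamma)=\sigma_k(\gamma)_1\vee g_2(\sigma_k(\gamma)_2)\vee\dots\vee g_{l_*}(\sigma_k(\gamma)_{l_*})$, where $l_*=l_k(\gamma)$ and $g_j=g_{[\gamma]_k(1),[\gamma]_k(2)}\circ\dots\circ g_{[\gamma]_k(j-1),[\gamma]_k(j)}$; it is a path of $(T_{N-k},E_{N-k}^*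 )$. Boundaries: for $A\subseteq T$, $\partial A=\{s\in\mathbb{Z}_J: b_s\cap\bigcup_{w\in A}K_w\neq\emptyset\}$. $(\mathbb{Z}_J)^e=\{g(i): g\in G, i\in\mathbb{Z}_J,$ there exist $n\in\mathbb{N}$, $w\ne v\in T_n$ with $Q_w\cap Q_v=b_i(w)\}$, and $(B)^e=B\cap(\mathbb{Z}_J)^e$ for $B\subseteq\mathbb{Z}_J$. *)

theory Defs
  imports "HOL-Analysis.Analysis" "HOL-Algebra.Generated_Groups"
begin

text \<open>
  Elements of the cyclic group of order \<open>J\<close> are represented by their residues in
  \<open>{0..<J}\<close>.  Vertices and edges are defined for every integer index and are
  \<open>J\<close>-periodic in it.
\<close>

definition ZJ :: "nat \<Rightarrow> int set" where
  "ZJ J = {0..<int J}"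

definition vert :: "nat \<Rightarrow> int \<Rightarrow> real ^ 2" where
  "vert J i = (let \<theta> = pi / J + 2 * pi / J * i - pi / 2
               in (1 / cos (pi / J)) *\<^sub>R vector [cos \<theta>, sin \<theta>])"

definition edge :: "nat \<Rightarrow> int \<Rightarrow> (real ^ 2) set" where
  "edge J i = closed_segment (vert J (i - 1)) (vert J i)"

definition Qpoly :: "nat \<Rightarrow> (real ^ 2) set" where
  "Qpoly J = convex hull (vert J ` ZJ J)"

definition reflect_in :: "(real ^ 2) set \<Rightarrow> real ^ 2 \<Rightarrow> real ^ 2" where
  "reflect_in L x = 2 *\<^sub>R closest_point L x - x"  \<comment> \<open>meant for an affine line \<open>L\<close>\<close>

definition R_refl :: "real \<Rightarrow> real ^ 2 \<Rightarrow> real ^ 2" where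
  "R_refl \<theta> = reflect_in (span {vector [cos \<theta>, sin \<theta>]})"

text \<open>The edge \<open>edge J i\<close> has direction \<open>(cos (rho J i), sin (rho J i))\<close>.\<close>

definition rho :: "nat \<Rightarrow> int \<Rightarrow> real" where
  "rho J i = 2 * pi * i / J"

definition O2 :: "(real ^ 2 \<Rightarrow> real ^ 2) monoid" where
  "O2 = \<lparr>carrier = {g. orthogonal_transformation g}, mult = (\<circ>), one = id\<rparr>"

definition D_grp :: "nat \<Rightarrow> (real ^ 2 \<Rightarrow> real ^ 2) set" where
  "D_grp J = {g. orthogonal_transformation g \<and> g ` Qpoly J = Qpoly J}"

definition D_star :: "nat \<Rightarrow> (real ^ 2 \<Rightarrow> real ^ 2) set" where
  "D_star J = generate O2 (D_grp J \<union> {R_refl (rho J i) | i. i \<in> ZJ J})"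

definition act_index :: "nat \<Rightarrow> (real ^ 2 \<Rightarrow> real ^ 2) \<Rightarrow> int \<Rightarrow> int" where
  "act_index J g i = (THE j. j \<in> ZJ J \<and> g ` edge J i = edge J j)"

text \<open>A graph is given by a vertex set \<open>V\<close> and a set \<open>E\<close> of (ordered) pairs of adjacent vertices.\<close>

definition is_path :: "'v set \<Rightarrow> ('v \<times> 'v) set \<Rightarrow> 'v list \<Rightarrow> bool" where
  "is_path V E xs \<longleftrightarrow> xs \<noteq> [] \<and> set xs \<subseteq> V \<and> successively (\<lambda>x y. (x, y) \<in> E) xs"

definition graph_connected :: "'v set \<Rightarrow> ('v \<times> 'v) set \<Rightarrow> 'v set \<Rightarrow> bool" where
  "graph_connected V E A \<longleftrightarrow> A \<subseteq> V \<and>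
     (\<forall>x\<in>A. \<forall>y\<in>A. \<exists>xs. is_path V E xs \<and> set xs \<subseteq> A \<and> hd xs = x \<and> last xs = y)"

definition graph_ball :: "'v set \<Rightarrow> ('v \<times> 'v) set \<Rightarrow> nat \<Rightarrow> 'v \<Rightarrow> 'v set" where
  "graph_ball V E M w =
     {v. \<exists>xs. is_path V E xs \<and> hd xs = w \<and> last xs = v \<and> length xs \<le> M + 1}"

definition share_edge ::
  "nat \<Rightarrow> (real ^ 2 \<Rightarrow> real ^ 2) set \<Rightarrow> ('s \<Rightarrow> real ^ 2 \<Rightarrow> real ^ 2) \<Rightarrow>
   ('s \<Rightarrow> real ^ 2 \<Rightarrow> real ^ 2) \<Rightarrow> 's \<Rightarrow> 's \<Rightarrow> bool" where
  "share_edge J G f \<phi> s s' \<longleftrightarrow>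
     (\<exists>i\<in>ZJ J. \<exists>j\<in>ZJ J.
        f s ` Qpoly J \<inter> f s' ` Qpoly J = f s ` edge J i \<and>
        f s ` edge J i = f s' ` edge J j \<and>
        inv_into UNIV (\<phi> s') \<circ> \<phi> s \<circ> R_refl (rho J i) \<in> G)"

definition share_vertex :: "nat \<Rightarrow> ('s \<Rightarrow> real ^ 2 \<Rightarrow> real ^ 2) \<Rightarrow> 's \<Rightarrow> 's \<Rightarrow> bool" where
  "share_vertex J f s s' \<longleftrightarrow>
     (\<exists>i\<in>ZJ J. \<exists>j\<in>ZJ J.
        f s ` Qpoly J \<inter> f s' ` Qpoly J = {f s (vert J i)} \<and>
        f s (vert J i) = f s' (vert J j))"

text \<open>
  The ratio \<open>r\<close> is common to all maps.  As every \<open>\<phi> s\<close> is orthogonal, \<open>f\<close> determines \<open>r\<close> as well as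
  \<open>\<phi>\<close> and \<open>c\<close> on \<open>S\<close>, so binding them existentially over all the conditions is unambiguous.
\<close>

definition JG_ss_system ::
  "nat \<Rightarrow> (real ^ 2 \<Rightarrow> real ^ 2) set \<Rightarrow> 's set \<Rightarrow> ('s \<Rightarrow> real ^ 2 \<Rightarrow> real ^ 2) \<Rightarrow> bool" where
  "JG_ss_system J G S f \<longleftrightarrow>
     finite S \<and> (\<forall>s\<in>S. \<exists>L<1. L-lipschitz_on UNIV (f s)) \<and>
     (\<exists>r \<phi> c.
        (0 < r \<and> r < 1 \<and>
           (\<forall>s\<in>S. \<phi> s \<in> D_star J \<and> (\<forall>x. f s x = r *\<^sub>R \<phi> s x + c s) \<and>
                   f s ` Qpoly J \<subseteq> Qpoly J)) \<and>
        (\<forall>i\<in>ZJ J. \<exists>s\<in>S. \<exists>j\<in>ZJ J. f s ` edge J j \<subseteq> edge J i) \<and>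
        (\<forall>g\<in>G. \<exists>h. \<forall>s\<in>S. h s \<in> S \<and> inv_into UNIV (f (h s)) \<circ> g \<circ> f s \<in> G) \<and>
        (\<forall>s\<in>S. \<forall>s'\<in>S. s \<noteq> s' \<and> f s ` Qpoly J \<inter> f s' ` Qpoly J \<noteq> {} \<longrightarrow>
           share_edge J G f \<phi> s s' \<or> share_vertex J f s s') \<and>
        graph_connected S {(s, s'). s \<in> S \<and> s' \<in> S \<and> s \<noteq> s' \<and> share_edge J G f \<phi> s s'} S)"

definition Kset :: "'s set \<Rightarrow> ('s \<Rightarrow> real ^ 2 \<Rightarrow> real ^ 2) \<Rightarrow> (real ^ 2) set" where
  "Kset S f = (THE K. K \<noteq> {} \<and> compact K \<and> K = (\<Union>s\<in>S. f s ` K))"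

definition words :: "'s set \<Rightarrow> nat \<Rightarrow> 's list set" where
  "words S n = {w. set w \<subseteq> S \<and> length w = n}"

definition fword :: "('s \<Rightarrow> real ^ 2 \<Rightarrow> real ^ 2) \<Rightarrow> 's list \<Rightarrow> real ^ 2 \<Rightarrow> real ^ 2" where
  "fword f w = foldr (\<lambda>s h. f s \<circ> h) w id"

definition Kcell :: "'s set \<Rightarrow> ('s \<Rightarrow> real ^ 2 \<Rightarrow> real ^ 2) \<Rightarrow> 's list \<Rightarrow> (real ^ 2) set" where
  "Kcell S f w = fword f w ` Kset S f"

definition Qcell :: "nat \<Rightarrow> ('s \<Rightarrow> real ^ 2 \<Rightarrow> real ^ 2) \<Rightarrow> 's list \<Rightarrow> (real ^ 2) set" where
  "Qcell J f w = fword f w ` Qpoly J"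

definition edge_cell ::
  "nat \<Rightarrow> ('s \<Rightarrow> real ^ 2 \<Rightarrow> real ^ 2) \<Rightarrow> int \<Rightarrow> 's list \<Rightarrow> (real ^ 2) set" where
  "edge_cell J f i w = fword f w ` edge J i"

definition act_word ::
  "nat \<Rightarrow> 's set \<Rightarrow> ('s \<Rightarrow> real ^ 2 \<Rightarrow> real ^ 2) \<Rightarrow> (real ^ 2 \<Rightarrow> real ^ 2) \<Rightarrow> 's list \<Rightarrow> 's list" where
  "act_word J S f g w = (THE v. v \<in> words S (length w) \<and> g ` Qcell J f w = Qcell J f v)"

definition E_star ::
  "'s set \<Rightarrow> ('s \<Rightarrow> real ^ 2 \<Rightarrow> real ^ 2) \<Rightarrow> nat \<Rightarrow> ('s list \<times> 's list) set" where
  "E_star S f n = {(w, v). w \<in> words S n \<and> v \<in> words S n \<and> w \<noteq> v \<and>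
                           Kcell S f w \<inter> Kcell S f v \<noteq> {}}"

definition E_line ::
  "nat \<Rightarrow> 's set \<Rightarrow> ('s \<Rightarrow> real ^ 2 \<Rightarrow> real ^ 2) \<Rightarrow> nat \<Rightarrow> ('s list \<times> 's list) set" where
  "E_line J S f n = {(w, v). w \<in> words S n \<and> v \<in> words S n \<and> w \<noteq> v \<and>
     (\<exists>i\<in>ZJ J. \<exists>j\<in>ZJ J. Qcell J f w \<inter> Qcell J f v = edge_cell J f i w \<and>
                          edge_cell J f i w = edge_cell J f j v)}"

text \<open>The affine hull of a common edge is the line containing it.\<close>

definition g_cross ::
  "nat \<Rightarrow> ('s \<Rightarrow> real ^ 2 \<Rightarrow> real ^ 2) \<Rightarrow> 's list \<Rightarrow> 's list \<Rightarrow> real ^ 2 \<Rightarrow> real ^ 2" where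
  "g_cross J f w v =
     inv_into UNIV (fword f w) \<circ> reflect_in (affine hull (Qcell J f w \<inter> Qcell J f v)) \<circ> fword f v"

definition Gam ::
  "'s set \<Rightarrow> ('s \<Rightarrow> real ^ 2 \<Rightarrow> real ^ 2) \<Rightarrow> nat \<Rightarrow> nat \<Rightarrow> 's list \<Rightarrow> 's list set" where
  "Gam S f n M w = graph_ball (words S n) (E_star S f n) M w"

text \<open>\<open>runs h xs\<close> cuts \<open>xs\<close> into its maximal consecutive blocks on which \<open>h\<close> is constant.\<close>

function runs :: "('a \<Rightarrow> 'b) \<Rightarrow> 'a list \<Rightarrow> 'a list list" where
  "runs h [] = []"
| "runs h (x # xs) =
     (x # takeWhile (\<lambda>y. h y = h x) xs) # runs h (dropWhile (\<lambda>y. h y = h x) xs)"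
  by pat_completeness auto
termination
  by (relation "Wellfounded.measure (\<lambda>(h, xs). length xs)")
     (auto simp: less_Suc_eq_le length_dropWhile_le)

definition num_runs :: "nat \<Rightarrow> 's list list \<Rightarrow> nat" where
  "num_runs k \<gamma> = length (runs (take k) \<gamma>)"

definition trunc_path :: "nat \<Rightarrow> 's list list \<Rightarrow> 's list list" where
  "trunc_path k \<gamma> = map (\<lambda>b. take k (last b)) (runs (take k) \<gamma>)"

text \<open>
  The block index \<open>i\<close> is counted from 1; so is the vertex index in \<open>trunc_at\<close>.
  Both are only meaningful for \<open>1 \<le> i \<le> num_runs k \<gamma>\<close>.
\<close>

definition trunc_at :: "nat \<Rightarrow> 's list list \<Rightarrow> nat \<Rightarrow> 's list" where
  "trunc_at k \<gamma> i = trunc_path k \<gamma> ! (i - 1)"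

definition sigma_path :: "nat \<Rightarrow> 's list list \<Rightarrow> nat \<Rightarrow> 's list list" where
  "sigma_path k \<gamma> i = map (drop k) (runs (take k) \<gamma> ! (i - 1))"

definition path_join :: "'a list \<Rightarrow> 'a list \<Rightarrow> 'a list" where
  "path_join xs ys = (if xs \<noteq> [] \<and> ys \<noteq> [] \<and> last xs = hd ys then xs @ tl ys else xs @ ys)"

definition path_join_list :: "'a list list \<Rightarrow> 'a list" where
  "path_join_list xss = foldr path_join xss []"

definition g_fold ::
  "nat \<Rightarrow> ('s \<Rightarrow> real ^ 2 \<Rightarrow> real ^ 2) \<Rightarrow> nat \<Rightarrow> 's list list \<Rightarrow> nat \<Rightarrow> real ^ 2 \<Rightarrow> real ^ 2" where
  "g_fold J f k \<gamma> j =
     foldr (\<circ>) (map (\<lambda>i. g_cross J f (trunc_at k \<gamma> i) (trunc_at k \<gamma> (i + 1))) [1..<j]) id"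

definition path_folding ::
  "nat \<Rightarrow> 's set \<Rightarrow> ('s \<Rightarrow> real ^ 2 \<Rightarrow> real ^ 2) \<Rightarrow> nat \<Rightarrow> 's list list \<Rightarrow> 's list list" where
  "path_folding J S f k \<gamma> =
     path_join (sigma_path k \<gamma> 1)
       (path_join_list (map (\<lambda>j. map (act_word J S f (g_fold J f k \<gamma> j)) (sigma_path k \<gamma> j))
                       [2..<num_runs k \<gamma> + 1]))"

definition interior_path :: "nat \<Rightarrow> 's list list \<Rightarrow> 's list list" where
  "interior_path n \<gamma> =
     path_join_list (map (\<lambda>j. map ((@) (trunc_at n \<gamma> j)) (sigma_path n \<gamma> j)) [2..<num_runs n \<gamma>])"

definition bdry :: "nat \<Rightarrow> 's set \<Rightarrow> ('s \<Rightarrow> real ^ 2 \<Rightarrow> real ^ 2) \<Rightarrow> 's list set \<Rightarrow> int set" where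
  "bdry J S f A = {i \<in> ZJ J. edge J i \<inter> (\<Union>w\<in>A. Kcell S f w) \<noteq> {}}"

definition ZJe ::
  "nat \<Rightarrow> (real ^ 2 \<Rightarrow> real ^ 2) set \<Rightarrow> 's set \<Rightarrow> ('s \<Rightarrow> real ^ 2 \<Rightarrow> real ^ 2) \<Rightarrow> int set" where
  "ZJe J G S f = {act_index J g i | g i. g \<in> G \<and> i \<in> ZJ J \<and>
     (\<exists>n. \<exists>w\<in>words S n. \<exists>v\<in>words S n. w \<noteq> v \<and> Qcell J f w \<inter> Qcell J f v = edge_cell J f i w)}"

definition opposite :: "nat \<Rightarrow> int \<Rightarrow> int" where
  "opposite J i = (i + int J div 2) mod int J"

definition M_const :: "nat \<Rightarrow> nat" where
  "M_const J = (if even J then J - 2 else 2 * J - 2)"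

end

theory Submission
  imports Defs
begin

text \<open>
  A path of small cells is cut into blocks: block \<open>j\<close> is the set \<open>X\<^sub>j\<close> of words of length \<open>m\<close> that
  the path visits inside the \<open>j\<close>-th large cell \<open>w(j)\<close>.  Two cells of the same level that meet have
  a common side or only a common vertex (\<open>cells_meet\<close>).  Suppose that no connected union of
  \<open>G\<close>-images of inner blocks has a boundary as large as claimed.  It is shown that the two ends of
  the chain of large cells are then at distance at most \<open>M_const J\<close>.

  Suppose first that two consecutive large cells meet only in a vertex.  The blocks on both sides
  of that crossing touch the two sides at this vertex, and by assumption no third one.  If the path
  leaves the next cell through a side, that side is one of the two, so the next cell contains
  the same point of the plane, and the reflected block extends the connected set found so far; if it
  leaves through a vertex, that vertex is again the same point.  Hence all large cells of
  the chain contain one point of the self-similar set and the two ends are neighbours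
  (\<open>pinned_step\<close>, \<open>vertex_chain_ends_meet\<close>).

  Suppose now that consecutive large cells always share a side.  The reflection between two such
  cells induces an element of \<open>G\<close> (\<open>shared_edge_in_G\<close>), so the inner blocks can be folded
  into the first of their cells; the folded set \<open>F\<close> is connected because a point of a common side is fixed by
  the reflection in that side.  Read in the coordinates of that cell, the chain of large cells is
  \<open>Q\<close>, \<open>\<tau>\<^sub>a Q\<close>, \<open>\<tau>\<^sub>a \<tau>\<^sub>b Q\<close> and so on, with \<open>\<tau>\<^sub>i\<close> the reflection in side \<open>i\<close> of \<open>Q\<close>, and all
  labels \<open>a\<close>, \<open>b\<close>, \<dots> belong to the boundary of \<open>F\<close> and to \<open>ZJe\<close>
  (\<open>chain_is_reflection_word\<close>).  If these labels do not produce the claimed boundary, they are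
  contained in a set \<open>{a, b}\<close> of two sides on intersecting lines.  Two such reflections generate a
  finite dihedral group in which the alternating word of length \<open>M_const J + 2\<close> is trivial
  (\<open>alternating_period\<close>).  Therefore the word can be shortened to length at most \<open>M_const J\<close>
  through cells that the chain already visits (\<open>shorten_reflection_word\<close>).  The constant arises
  because the cells lie on a closed ring of \<open>N = M_const J + 2\<close> positions: two of them are at most \<open>N - 2\<close> steps apart
  along the visited stretch, or they are neighbours across its gap.
\<close>

section \<open>Directions in the plane\<close>

definition dir :: "real \<Rightarrow> real ^ 2" where
  "dir t = vector [cos t, sin t]"

lemma dir_nth [simp]: "dir t $ 1 = cos t" "dir t $ 2 = sin t"
  by (simp_all add: dir_def)

lemma inner2: "x \<bullet> y = x $ 1 * y $ 1 + x $ 2 * y $ 2" for x y :: "real ^ 2"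
  by (simp add: inner_vec_def sum_2)

lemma vec2_eqI: "x $ 1 = y $ 1 \<Longrightarrow> x $ 2 = y $ 2 \<Longrightarrow> x = y" for x y :: "real ^ 2"
  by (simp add: vec_eq_iff forall_2)

lemma dir_inner: "dir s \<bullet> dir t = cos (s - t)"
  by (simp add: inner2 cos_diff)

lemma norm_dir [simp]: "norm (dir t) = 1"
  by (simp add: norm_eq_sqrt_inner dir_inner)

lemma dir_nonzero [simp]: "dir t \<noteq> 0"
  by (metis norm_dir norm_zero zero_neq_one)

lemma cos_shift: "cos (t + of_int n * (2 * pi)) = cos t"
  and sin_shift: "sin (t + of_int n * (2 * pi)) = sin t"
  using cos_int_2pin[of n] sin_int_2pin[of n]
  by (simp_all add: cos_add sin_add mult.commute)

lemma dir_periodic: "dir (t + of_int n * (2 * pi)) = dir t"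
  by (rule vec2_eqI) (simp_all only: dir_nth cos_shift sin_shift)

lemma dir_sum: "dir (a - d) + dir (a + d) = (2 * cos d) *\<^sub>R dir a"
  by (rule vec2_eqI) (simp_all add: cos_diff sin_diff cos_add sin_add)

lemma dir_difference: "dir (a + d) - dir (a - d) = (2 * sin d) *\<^sub>R dir (a + pi / 2)"
  by (rule vec2_eqI) (simp_all add: cos_diff sin_diff cos_add sin_add)

lemma dir_combination:
  "sin (b - a) *\<^sub>R dir t = sin (b - t) *\<^sub>R dir a + sin (t - a) *\<^sub>R dir b"
  by (rule vec2_eqI) (simp_all add: sin_diff algebra_simps)

lemma orthogonal_to_two_dirs:
  assumes "sin (b - a) \<noteq> 0" "y \<bullet> dir a = 0" "y \<bullet> dir b = 0"
  shows "y = 0"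
proof (rule vec2_eqI)
  have 1: "y $ 1 * cos a + y $ 2 * sin a = 0" and 2: "y $ 1 * cos b + y $ 2 * sin b = 0"
    using assms by (simp_all add: inner2)
  have "y $ 1 * sin (b - a) = (y $ 1 * cos a + y $ 2 * sin a) * sin b - (y $ 1 * cos b + y $ 2 * sin b) * sin a"
    by (simp add: sin_diff algebra_simps)
  then show "y $ 1 = 0 $ 1" using 1 2 assms(1) by simp
  have "y $ 2 * sin (b - a) = (y $ 1 * cos b + y $ 2 * sin b) * cos a - (y $ 1 * cos a + y $ 2 * sin a) * cos b"
    by (simp add: sin_diff algebra_simps)
  then show "y $ 2 = 0 $ 2" using 1 2 assms(1) by simp
qed

lemma unit_vector_is_dir:
  assumes "norm (x :: real ^ 2) = 1"
  obtains t where "x = dir t"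
proof -
  have "(x $ 1)\<^sup>2 + (x $ 2)\<^sup>2 = 1"
    using assms by (simp add: norm_eq_sqrt_inner inner2 power2_eq_square)
  then obtain t where "x $ 1 = cos t" "x $ 2 = sin t"
    using sincos_total_2pi by metis
  then show ?thesis by (intro that[of t] vec2_eqI) auto
qed

lemma vector_is_scaled_dir:
  obtains t where "(x :: real ^ 2) = norm x *\<^sub>R dir t"
proof (cases "x = 0")
  case True then show ?thesis using that by simp
next
  case False
  then have "norm ((1 / norm x) *\<^sub>R x) = 1" by simp
  then obtain t where "(1 / norm x) *\<^sub>R x = dir t" by (rule unit_vector_is_dir)
  then have "norm x *\<^sub>R dir t = norm x *\<^sub>R (1 / norm x) *\<^sub>R x" by simp
  then have "x = norm x *\<^sub>R dir t" using False by simp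
  then show ?thesis by (rule that)
qed

lemma perp_decomposition:
  "x = (x \<bullet> dir t) *\<^sub>R dir t + (x \<bullet> dir (t + pi / 2)) *\<^sub>R dir (t + pi / 2)"
proof -
  define y where "y = x - ((x \<bullet> dir t) *\<^sub>R dir t + (x \<bullet> dir (t + pi / 2)) *\<^sub>R dir (t + pi / 2))"
  have "y = 0"
    by (rule orthogonal_to_two_dirs[of "t + pi / 2" t])
       (simp_all add: y_def inner_diff_left inner_add_left dir_inner)
  then show ?thesis by (simp add: y_def)
qed

section \<open>The regular polygon and its faces\<close>

locale regular_polygon =
  fixes J :: nat
  assumes J_ge_3: "J \<ge> 3"
begin

text \<open>
  The apothem of the polygon is 1, so the outward unit normal of a side is also its midpoint, and
  the line of the side consists of the points with inner product 1 with it.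
\<close>
definition nrm :: "int \<Rightarrow> real ^ 2" where
  "nrm i = dir (2 * pi / J * i - pi / 2)"

lemma J_pos [simp]: "0 < J" "int J > 0" "J \<noteq> 0"
  using J_ge_3 by auto

lemma ZJ_iff: "i \<in> ZJ J \<longleftrightarrow> 0 \<le> i \<and> i < int J"
  by (simp add: ZJ_def)

lemma mod_in_ZJ [simp]: "i mod int J \<in> ZJ J"
  by (simp add: ZJ_iff)

lemma finite_ZJ [simp]: "finite (ZJ J)"
  by (simp add: ZJ_def)

lemma angle_bounds: "0 < pi / J" "pi / J < pi / 2"
  using J_ge_3 by (auto simp: field_simps)

lemma cos_angle_pos: "cos (pi / J) > 0"
  using angle_bounds pi_gt_zero by (intro cos_gt_zero_pi) linarith+

lemma sin_angle_pos: "sin (pi / J) > 0"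
  using angle_bounds pi_gt_zero by (intro sin_gt_zero) linarith+

lemma sin_double_angle_pos: "sin (2 * pi / J) > 0"
  using J_ge_3 by (intro sin_gt_zero) (auto simp: field_simps)

lemma vert_dir: "vert J k = (1 / cos (pi / J)) *\<^sub>R dir (2 * pi / J * k - pi / 2 + pi / J)"
  by (simp add: vert_def dir_def Let_def algebra_simps)

lemma vert_dir': "vert J (k - 1) = (1 / cos (pi / J)) *\<^sub>R dir (2 * pi / J * k - pi / 2 - pi / J)"
proof -
  have "2 * pi / J * (k - 1) - pi / 2 + pi / J = 2 * pi / J * k - pi / 2 - pi / J"
    by (simp add: algebra_simps diff_divide_distrib)
  then show ?thesis unfolding vert_dir of_int_diff of_int_1 by (simp only:)
qed

lemma angle_mod: "2 * pi / J * i - c = (2 * pi / J * (i mod int J) - c) + of_int (i div int J) * (2 * pi)" for c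
proof -
  have "real_of_int i = real J * of_int (i div int J) + of_int (i mod int J)"
    by (metis mult_div_mod_eq of_int_add of_int_mult of_int_of_nat_eq)
  then have "2 * pi / J * i = 2 * pi / J * (i mod int J) + of_int (i div int J) * (2 * pi)"
    by (simp add: field_simps)
  then show ?thesis by simp
qed

lemma vert_mod: "vert J (i mod int J) = vert J i"
proof -
  have *: "2 * pi / J * i - pi / 2 + pi / J = 2 * pi / J * i - (pi / 2 - pi / J)" for i by simp
  show ?thesis
    unfolding vert_dir * by (simp only: dir_periodic angle_mod[of i "pi / 2 - pi / J"])
qed

lemma vert_cong: "k mod int J = i mod int J \<Longrightarrow> vert J k = vert J i"
  by (metis vert_mod)

lemma edge_mod: "edge J (i mod int J) = edge J i"
proof -
  have "vert J (i mod int J - 1) = vert J (i - 1)"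
    by (rule vert_cong) (simp add: mod_diff_left_eq)
  then show ?thesis by (simp add: edge_def vert_mod)
qed

lemma vert_inner_nrm: "vert J k \<bullet> nrm i = cos (pi / J * (2 * (k - i) + 1)) / cos (pi / J)"
  by (simp add: vert_dir nrm_def dir_inner algebra_simps add_divide_distrib diff_divide_distrib)

lemma cos_odd_multiple:
  assumes "0 \<le> l" "l < int J"
  shows "cos (pi / J * (2 * l + 1)) \<le> cos (pi / J)"
    and "l \<noteq> 0 \<Longrightarrow> l \<noteq> int J - 1 \<Longrightarrow> cos (pi / J * (2 * l + 1)) < cos (pi / J)"
proof -
  \<comment> \<open>\<open>s\<close> is the odd multiple or its reflection in \<open>J\<close>, which moves the angle into the interval where the cosine decreases\<close>
  obtain s :: int where s: "1 \<le> s" "s \<le> int J" "cos (pi / J * (2 * l + 1)) = cos (pi / J * s)"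
     "l \<noteq> 0 \<Longrightarrow> l \<noteq> int J - 1 \<Longrightarrow> s > 1"
  proof (cases "2 * l + 1 \<le> int J")
    case True then show ?thesis using assms by (intro that[of "2 * l + 1"]) auto
  next
    case False
    have eq: "pi / J * (2 * l + 1) = 2 * pi - pi / J * (2 * int J - (2 * l + 1))"
      by (simp add: field_simps)
    have "cos (pi / J * (2 * l + 1)) = cos (pi / J * (2 * int J - (2 * l + 1)))"
      unfolding eq by (metis add.inverse_inverse cos_2pi_minus)
    then show ?thesis using assms False by (intro that[of "2 * int J - (2 * l + 1)"]) auto
  qed
  have b: "pi / J * s \<le> pi" "pi / J \<le> pi / J * s"
    using s(1,2) by (auto simp: field_simps)
  show "cos (pi / J * (2 * l + 1)) \<le> cos (pi / J)"
    unfolding s(3) using b angle_bounds by (intro cos_monotone_0_pi_le) auto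
  show "cos (pi / J * (2 * l + 1)) < cos (pi / J)" if "l \<noteq> 0" "l \<noteq> int J - 1"
    unfolding s(3) using b angle_bounds s(4)[OF that]
    by (intro cos_monotone_0_pi) (auto simp: field_simps)
qed

lemma vert_inner_nrm_mod:
  "vert J k \<bullet> nrm i = cos (pi / J * (2 * ((k - i) mod int J) + 1)) / cos (pi / J)"
proof -
  have "real_of_int (k - i) = real J * of_int ((k - i) div int J) + of_int ((k - i) mod int J)"
    by (metis mult_div_mod_eq of_int_add of_int_mult of_int_of_nat_eq)
  then have "pi / J * (2 * (k - i) + 1) = pi / J * (2 * ((k - i) mod int J) + 1) + of_int ((k - i) div int J) * (2 * pi)"
    by (simp add: field_simps)
  then show ?thesis
    unfolding vert_inner_nrm by (simp only: cos_shift)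
qed

lemma vert_inner_nrm_le: "vert J k \<bullet> nrm i \<le> 1"
  unfolding vert_inner_nrm_mod using cos_odd_multiple(1)[of "(k - i) mod int J"] cos_angle_pos
  by (simp add: divide_le_eq)

text \<open>
  The angle between a vertex and a normal is an odd multiple of \<open>pi / J\<close>, and only the multiples by
  \<open>1\<close> and \<open>-1\<close> modulo \<open>2 * J\<close> reach the cosine of \<open>pi / J\<close>.
\<close>
lemma vert_inner_nrm_eqD:
  assumes "vert J k \<bullet> nrm i = 1"
  shows "k mod int J = i mod int J \<or> k mod int J = (i - 1) mod int J"
proof -
  have "\<not> cos (pi / J * (2 * ((k - i) mod int J) + 1)) < cos (pi / J)"
    using assms cos_angle_pos unfolding vert_inner_nrm_mod by (auto simp: field_simps)
  then have "(k - i) mod int J = 0 \<or> (k - i) mod int J = int J - 1"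
    using cos_odd_multiple(2)[of "(k - i) mod int J"] by auto
  then show ?thesis
  proof
    assume "(k - i) mod int J = 0"
    then show ?thesis by (simp add: mod_eq_dvd_iff dvd_eq_mod_eq_0)
  next
    assume "(k - i) mod int J = int J - 1"
    then have "(k - i) mod int J = (- 1) mod int J"
      by (simp add: zmod_minus1)
    then have "int J dvd (k - i) - (- 1)" by (simp only: mod_eq_dvd_iff)
    then have "int J dvd k - (i - 1)" by (simp add: algebra_simps)
    then show ?thesis using mod_eq_dvd_iff[of k "int J" "i - 1"] by blast
  qed
qed

lemma vert_inner_own_nrm [simp]: "vert J i \<bullet> nrm i = 1" "vert J (i - 1) \<bullet> nrm i = 1" "vert J i \<bullet> nrm (i + 1) = 1"
proof -
  show "vert J i \<bullet> nrm i = 1"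
    using cos_angle_pos by (simp add: vert_inner_nrm)
  show 2: "vert J (i - 1) \<bullet> nrm i = 1" for i
    using cos_angle_pos by (simp add: vert_inner_nrm)
  show "vert J i \<bullet> nrm (i + 1) = 1"
    using 2[of "i + 1"] by simp
qed

lemma nrm_inner_self [simp]: "nrm i \<bullet> nrm i = 1"
  by (simp add: nrm_def dir_inner)

lemma norm_nrm [simp]: "norm (nrm i) = 1"
  by (simp add: nrm_def)

lemma nrm_nonzero [simp]: "nrm i \<noteq> 0"
  by (simp add: nrm_def)

lemma vert_in_Q [simp]: "vert J k \<in> Qpoly J"
proof -
  have "vert J (k mod int J) \<in> Qpoly J"
    unfolding Qpoly_def by (intro hull_inc imageI) simp
  then show ?thesis by (simp add: vert_mod)
qed

lemma convex_Q: "convex (Qpoly J)"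
  by (simp add: Qpoly_def)

lemma compact_Q: "compact (Qpoly J)"
  unfolding Qpoly_def by (intro compact_convex_hull finite_imp_compact) simp

lemma Q_nonempty: "Qpoly J \<noteq> {}"
  using vert_in_Q by blast

lemma Q_inner_nrm_le:
  assumes "x \<in> Qpoly J" shows "x \<bullet> nrm i \<le> 1"
proof -
  have "Qpoly J \<subseteq> {x. nrm i \<bullet> x \<le> 1}"
    unfolding Qpoly_def
    by (rule hull_minimal[where S = convex, OF _ convex_halfspace_le]) (auto simp: inner_commute[of "nrm i"] vert_inner_nrm_le)
  then show ?thesis using assms by (auto simp: inner_commute)
qed

lemma edge_subset_Q: "edge J i \<subseteq> Qpoly J"
  unfolding edge_def by (intro closed_segment_subset convex_Q) auto

lemma edge_inner_nrm: assumes "x \<in> edge J i" shows "x \<bullet> nrm i = 1"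
  using assms unfolding edge_def closed_segment_def
  by (auto simp: inner_add_left)

text \<open>
  The points on the line of a side form a face of a convex hull, hence the hull of those vertices that lie on
  the line, and these are the two ends of the side.
\<close>
lemma edge_eq: "edge J i = {x \<in> Qpoly J. x \<bullet> nrm i = 1}"
proof
  show "edge J i \<subseteq> {x \<in> Qpoly J. x \<bullet> nrm i = 1}"
    using edge_subset_Q edge_inner_nrm by auto
  define F where "F = Qpoly J \<inter> {x. nrm i \<bullet> x = 1}"
  have "F face_of Qpoly J"
    unfolding F_def using Q_inner_nrm_le convex_Q
    by (intro face_of_Int_supporting_hyperplane_le) (auto simp: inner_commute)
  then obtain V where V: "V \<subseteq> vert J ` ZJ J" "F = convex hull V"
    using face_of_convex_hull_subset[of "vert J ` ZJ J" F] unfolding Qpoly_def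
    by (metis finite_ZJ finite_imageI finite_imp_compact)
  have "V \<subseteq> {vert J (i - 1), vert J i}"
  proof
    fix v assume v: "v \<in> V"
    then obtain k where k: "v = vert J k" using V by auto
    have "v \<in> F" using v V hull_inc by metis
    then have "vert J k \<bullet> nrm i = 1" by (simp add: F_def k inner_commute)
    then show "v \<in> {vert J (i - 1), vert J i}"
      using vert_inner_nrm_eqD vert_cong k by blast
  qed
  then have "F \<subseteq> edge J i"
    unfolding V(2) edge_def segment_convex_hull by (rule hull_mono)
  then show "{x \<in> Qpoly J. x \<bullet> nrm i = 1} \<subseteq> edge J i"
    by (auto simp: F_def inner_commute)
qed

lemma vert_in_edge [simp]: "vert J i \<in> edge J i" "vert J (i - 1) \<in> edge J i" "vert J i \<in> edge J (i + 1)"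
  by (simp_all add: edge_eq)

lemma edge_midpoint: "midpoint (vert J (i - 1)) (vert J i) = nrm i"
proof -
  have "vert J (i - 1) + vert J i = 2 *\<^sub>R nrm i"
    unfolding vert_dir'[of i] vert_dir[of i] scaleR_right_distrib[symmetric] dir_sum nrm_def
    using cos_angle_pos by simp
  then show ?thesis by (simp add: midpoint_def)
qed

lemma edge_vector:
  "vert J i - vert J (i - 1) = (2 * tan (pi / J)) *\<^sub>R dir (2 * pi / J * i - pi / 2 + pi / 2)"
  unfolding vert_dir'[of i] vert_dir[of i] scaleR_right_diff_distrib[symmetric] dir_difference
  by (simp add: tan_def)

lemma tan_angle_pos: "tan (pi / J) > 0"
  using sin_angle_pos cos_angle_pos by (simp add: tan_def)

lemma edge_endpoints_distinct: "vert J (i - 1) \<noteq> vert J i"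
proof
  assume "vert J (i - 1) = vert J i"
  then have "(2 * tan (pi / J)) *\<^sub>R dir (2 * pi / J * i - pi / 2 + pi / 2) = 0"
    using edge_vector[of i] by simp
  then show False using tan_angle_pos by simp
qed

lemma edge_nonempty: "edge J i \<noteq> {}"
  using vert_in_edge(1) by blast

lemma nrm_in_edge: "nrm i \<in> edge J i"
  using edge_midpoint[of i] unfolding edge_def by (metis midpoint_in_closed_segment)

lemma perp_edge_imp_parallel_nrm:
  assumes "u \<bullet> (vert J i - vert J (i - 1)) = 0"
  shows "u = (u \<bullet> nrm i) *\<^sub>R nrm i"
proof -
  have "u \<bullet> dir (2 * pi / J * i - pi / 2 + pi / 2) = 0"
    using assms tan_angle_pos unfolding edge_vector by simp
  then show ?thesis
    using perp_decomposition[of u "2 * pi / J * i - pi / 2"] by (simp add: nrm_def)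
qed

lemma edge_vector_perp_nrm: "nrm i \<bullet> (vert J i - vert J (i - 1)) = 0"
  by (simp add: inner_diff_right inner_commute[of "nrm i"])

lemma vert_unique:
  assumes "x \<bullet> nrm k = 1" "x \<bullet> nrm (k + 1) = 1" shows "x = vert J k"
proof -
  have "x - vert J k = 0"
  proof (rule orthogonal_to_two_dirs)
    show "sin ((2 * pi / J * (k + 1) - pi / 2) - (2 * pi / J * k - pi / 2)) \<noteq> 0"
      using sin_double_angle_pos by (simp add: algebra_simps add_divide_distrib)
    show "(x - vert J k) \<bullet> dir (2 * pi / J * k - pi / 2) = 0"
      using assms(1) vert_inner_own_nrm(1)[of k] unfolding nrm_def inner_diff_left by linarith
    show "(x - vert J k) \<bullet> dir (2 * pi / J * (k + 1) - pi / 2) = 0"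
      using assms(2) vert_inner_own_nrm(3)[of k] unfolding nrm_def inner_diff_left by simp
  qed
  then show ?thesis by simp
qed

lemma Q_not_in_line: "\<exists>x\<in>Qpoly J. x \<bullet> nrm i < 1"
proof -
  have "vert J (i + 1) \<bullet> nrm i \<noteq> 1"
  proof
    assume "vert J (i + 1) \<bullet> nrm i = 1"
    then have "int J dvd 1 \<or> int J dvd 2"
      using vert_inner_nrm_eqD[of "i + 1" i] by (auto simp: mod_eq_dvd_iff)
    then show False using J_ge_3 zdvd_imp_le by fastforce
  qed
  then show ?thesis
    using vert_inner_nrm_le[of "i + 1" i] vert_in_Q[of "i + 1"]
    by (metis order_less_le)
qed

text \<open>
  The direction \<open>u\<close> lies between two consecutive normals.  If it equals one of them the face is a
  side; otherwise \<open>u\<close> is a combination of both with positive coefficients, and only their common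
  vertex is extremal for both.
\<close>
lemma exposed_face:
  assumes u: "u \<noteq> 0" and le: "\<And>x. x \<in> Qpoly J \<Longrightarrow> x \<bullet> u \<le> \<beta>" and ne: "x0 \<in> Qpoly J" "x0 \<bullet> u = \<beta>"
  shows "\<exists>k\<in>ZJ J. {x \<in> Qpoly J. x \<bullet> u = \<beta>} = {vert J k} \<or> {x \<in> Qpoly J. x \<bullet> u = \<beta>} = edge J k"
proof -
  obtain t where t: "u = norm u *\<^sub>R dir t" by (rule vector_is_scaled_dir)
  have nu: "norm u > 0" using u by simp
  \<comment> \<open>\<open>nrm k\<close> is the last normal not beyond the direction \<open>t\<close>, and \<open>\<epsilon>\<close> is the angle from it to \<open>t\<close>\<close>
  define k where "k = \<lfloor>(t + pi / 2) / (2 * pi / J)\<rfloor>"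
  define \<epsilon> where "\<epsilon> = t - (2 * pi / J * k - pi / 2)"
  have pos: "2 * pi / J > 0" by simp
  have "of_int k \<le> (t + pi / 2) / (2 * pi / J)" "(t + pi / 2) / (2 * pi / J) < of_int k + 1"
    unfolding k_def by linarith+
  then have "2 * pi / J * k \<le> t + pi / 2" "t + pi / 2 < 2 * pi / J * (k + 1)"
    using pos by (simp_all only: pos_le_divide_eq pos_divide_less_eq mult.commute of_int_add of_int_1)
  then have eps: "0 \<le> \<epsilon>" "\<epsilon> < 2 * pi / J"
    unfolding \<epsilon>_def by (simp_all add: algebra_simps add_divide_distrib)
  show ?thesis
  proof (cases "\<epsilon> = 0")
    case True
    then have ud: "x \<bullet> u = norm u * (x \<bullet> nrm k)" for x
      by (subst t) (simp add: nrm_def \<epsilon>_def)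
    have "\<beta> = norm u"
      using le[of "vert J k"] ne Q_inner_nrm_le[OF ne(1), of k] nu unfolding ud by auto
    then have "{x \<in> Qpoly J. x \<bullet> u = \<beta>} = edge J k"
      unfolding edge_eq ud using nu by auto
    then show ?thesis using edge_mod[of k] mod_in_ZJ[of k] by metis
  next
    case False
    define a where "a = norm u * sin (2 * pi / J - \<epsilon>) / sin (2 * pi / J)"
    define b where "b = norm u * sin \<epsilon> / sin (2 * pi / J)"
    have "2 * pi / J < pi" using J_ge_3 by (simp add: field_simps)
    then have "sin (2 * pi / J - \<epsilon>) > 0" "sin \<epsilon> > 0"
      using eps False by (auto intro!: sin_gt_zero)
    then have ab: "a > 0" "b > 0"
      unfolding a_def b_def using nu sin_double_angle_pos by simp_all
    have t_eq: "t = 2 * pi / J * k - pi / 2 + \<epsilon>" by (simp add: \<epsilon>_def)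
    have comb: "sin (2 * pi / J) *\<^sub>R dir t = sin (2 * pi / J - \<epsilon>) *\<^sub>R nrm k + sin \<epsilon> *\<^sub>R nrm (k + 1)"
    proof -
      have "(2 * pi / J * (k + 1) - pi / 2) - (2 * pi / J * k - pi / 2) = 2 * pi / J"
           "(2 * pi / J * (k + 1) - pi / 2) - t = 2 * pi / J - \<epsilon>"
           "t - (2 * pi / J * k - pi / 2) = \<epsilon>"
        unfolding t_eq by (simp_all add: algebra_simps add_divide_distrib)
      then show ?thesis
        using dir_combination[of "2 * pi / J * (k + 1) - pi / 2" "2 * pi / J * k - pi / 2" t]
        unfolding nrm_def by (simp only: of_int_add of_int_1)
    qed
    have "dir t = (1 / sin (2 * pi / J)) *\<^sub>R (sin (2 * pi / J) *\<^sub>R dir t)"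
      using sin_double_angle_pos by simp
    then have "u = a *\<^sub>R nrm k + b *\<^sub>R nrm (k + 1)"
      unfolding comb by (subst t) (simp add: a_def b_def scaleR_right_distrib)
    then have ud: "x \<bullet> u = a * (x \<bullet> nrm k) + b * (x \<bullet> nrm (k + 1))" for x
      by (simp add: inner_add_right)
    have ule: "a * (x \<bullet> nrm k) \<le> a" "b * (x \<bullet> nrm (k + 1)) \<le> b" if "x \<in> Qpoly J" for x
      using Q_inner_nrm_le[OF that] ab by auto
    have \<beta>: "\<beta> = a + b"
      using le[of "vert J k"] ne ule[OF ne(1)] unfolding ud by auto
    have "x = vert J k" if "x \<in> Qpoly J" "x \<bullet> u = \<beta>" for x
    proof (rule vert_unique)
      have "a * (x \<bullet> nrm k) = a" "b * (x \<bullet> nrm (k + 1)) = b"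
        using ule[OF that(1)] that(2) unfolding ud \<beta> by linarith+
      then show "x \<bullet> nrm k = 1" "x \<bullet> nrm (k + 1) = 1" using ab by auto
    qed
    moreover have "vert J k \<bullet> u = \<beta>" unfolding ud \<beta> by simp
    ultimately have "{x \<in> Qpoly J. x \<bullet> u = \<beta>} = {vert J k}" by auto
    then show ?thesis using vert_mod[of k] mod_in_ZJ[of k] by metis
  qed
qed

end

section \<open>Similarities and reflections in the sides\<close>

text \<open>The plain inverse notation denotes the inverse in a group.\<close>
abbreviation finv :: "('a \<Rightarrow> 'b) \<Rightarrow> 'b \<Rightarrow> 'a" where
  "finv F \<equiv> inv_into UNIV F"

text \<open>
  Only distances are prescribed, so compositions and inverses need no computation; the affine form is
  recovered in \<open>similarity_obtain\<close>.
\<close>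
definition similarity :: "real \<Rightarrow> (real ^ 2 \<Rightarrow> real ^ 2) \<Rightarrow> bool" where
  "similarity \<rho> F \<longleftrightarrow> 0 < \<rho> \<and> (\<forall>x y. dist (F x) (F y) = \<rho> * dist x y)"

lemma similarity_comp: "similarity \<rho> F \<Longrightarrow> similarity \<sigma> H \<Longrightarrow> similarity (\<rho> * \<sigma>) (F \<circ> H)"
  by (simp add: similarity_def)

lemma similarity_orthogonal: "orthogonal_transformation g \<Longrightarrow> similarity 1 g"
  by (simp add: similarity_def orthogonal_transformation_isometry)

lemma similarity_affine_form:
  assumes "0 < \<rho>" "orthogonal_transformation \<phi>" "\<And>x. F x = \<rho> *\<^sub>R \<phi> x + c"
  shows "similarity \<rho> F"
proof -
  have "dist (F x) (F y) = \<rho> * dist x y" for x y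
  proof -
    have "F x - F y = \<rho> *\<^sub>R (\<phi> x - \<phi> y)" by (simp add: assms(3) algebra_simps)
    then have "dist (F x) (F y) = \<rho> * dist (\<phi> x) (\<phi> y)"
      using assms(1) by (simp add: dist_norm)
    then show ?thesis
      using assms(2) by (simp add: orthogonal_transformation_isometry)
  qed
  then show ?thesis using assms(1) by (simp add: similarity_def)
qed

lemma similarity_obtain:
  assumes "similarity \<rho> F"
  obtains \<phi> c where "0 < \<rho>" "orthogonal_transformation \<phi>" "\<And>x. F x = \<rho> *\<^sub>R \<phi> x + c"
proof
  have \<rho>: "0 < \<rho>" and d: "\<And>x y. dist (F x) (F y) = \<rho> * dist x y"
    using assms by (auto simp: similarity_def)
  define \<phi> where "\<phi> = (\<lambda>x. (1 / \<rho>) *\<^sub>R (F x - F 0))"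
  show "0 < \<rho>" by (rule \<rho>)
  show "F x = \<rho> *\<^sub>R \<phi> x + F 0" for x using \<rho> by (simp add: \<phi>_def)
  have "dist (\<phi> x) (\<phi> y) = dist x y" for x y
  proof -
    have "\<phi> x - \<phi> y = (1 / \<rho>) *\<^sub>R (F x - F y)" by (simp add: \<phi>_def algebra_simps)
    then show ?thesis using \<rho> d[of x y] by (simp add: dist_norm)
  qed
  then show "orthogonal_transformation \<phi>"
    unfolding orthogonal_transformation_isometry by (simp add: \<phi>_def)
qed

lemma orthogonal_inner: "orthogonal_transformation g \<Longrightarrow> g x \<bullet> g y = x \<bullet> y"
  by (simp add: orthogonal_transformation_def)

lemma orthogonal_linear: "orthogonal_transformation g \<Longrightarrow> linear g"
  by (simp add: orthogonal_transformation_def)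

lemma similarity_bij: assumes "similarity \<rho> F" shows "bij F"
proof -
  obtain \<phi> c where *: "0 < \<rho>" "orthogonal_transformation \<phi>" "\<And>x. F x = \<rho> *\<^sub>R \<phi> x + c"
    using assms by (rule similarity_obtain) blast
  have "inj F"
  proof (rule injI)
    fix x y assume "F x = F y"
    then have "\<rho> * dist x y = 0" using assms unfolding similarity_def by (metis dist_self)
    then show "x = y" using *(1) by simp
  qed
  moreover have "surj F"
  proof (rule surjI)
    fix y
    have "\<phi> (finv \<phi> ((1 / \<rho>) *\<^sub>R (y - c))) = (1 / \<rho>) *\<^sub>R (y - c)"
      by (rule surj_f_inv_f[OF orthogonal_transformation_surj[OF *(2)]])
    then show "F (finv \<phi> ((1 / \<rho>) *\<^sub>R (y - c))) = y" using *(1,3) by simp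
  qed
  ultimately show ?thesis by (simp add: bij_def)
qed

lemma similarity_inj: "similarity \<rho> F \<Longrightarrow> inj F"
  using similarity_bij bij_is_inj by blast

lemma similarity_inv: assumes "similarity \<rho> F" shows "similarity (1 / \<rho>) (finv F)"
proof -
  have "dist (finv F x) (finv F y) = dist x y / \<rho>" for x y
    using assms similarity_bij[OF assms] unfolding similarity_def
    by (metis bij_inv_eq_iff nonzero_mult_div_cancel_left order_less_irrefl)
  then show ?thesis using assms by (simp add: similarity_def)
qed

lemma similarity_affine_combination:
  assumes "similarity \<rho> F" "u + v = 1"
  shows "F (u *\<^sub>R a + v *\<^sub>R b) = u *\<^sub>R F a + v *\<^sub>R F b"
proof -
  obtain \<phi> c where *: "0 < \<rho>" "orthogonal_transformation \<phi>" "\<And>x. F x = \<rho> *\<^sub>R \<phi> x + c"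
    using assms(1) by (rule similarity_obtain) blast
  have "u *\<^sub>R c + v *\<^sub>R c = c" using assms(2) by (metis scaleR_left_distrib scaleR_one)
  then show ?thesis
    using linear_add[OF orthogonal_linear[OF *(2)]] linear_scale[OF orthogonal_linear[OF *(2)]]
    by (simp add: *(3) algebra_simps)
qed

lemma similarity_segment:
  assumes "similarity \<rho> F" shows "F ` closed_segment a b = closed_segment (F a) (F b)"
proof -
  have "F ((1 - u) *\<^sub>R a + u *\<^sub>R b) = (1 - u) *\<^sub>R F a + u *\<^sub>R F b" for u
    using similarity_affine_combination[OF assms] by simp
  then show ?thesis by (simp add: closed_segment_image_interval image_image)
qed

lemma similarity_midpoint:
  assumes "similarity \<rho> F" shows "F (midpoint a b) = midpoint (F a) (F b)"
  using similarity_affine_combination[OF assms, of "1/2" "1/2" a b]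
  by (simp add: midpoint_def scaleR_right_distrib)

lemma similarity_functional:
  assumes "similarity \<rho> F" "u \<noteq> 0"
  obtains w d where "w \<noteq> 0" "\<And>x. F x \<bullet> u = x \<bullet> w + d"
proof -
  obtain \<phi> c where *: "0 < \<rho>" "orthogonal_transformation \<phi>" "\<And>x. F x = \<rho> *\<^sub>R \<phi> x + c"
    using assms(1) by (rule similarity_obtain) blast
  obtain v where v: "\<phi> v = u" using orthogonal_transformation_surj[OF *(2)] by (metis surjD)
  have "v \<noteq> 0" using v assms(2) linear_0[OF orthogonal_linear[OF *(2)]] by auto
  then show ?thesis
    using *(1) orthogonal_inner[OF *(2)]
    by (intro that[of "\<rho> *\<^sub>R v" "c \<bullet> u"]) (auto simp: *(3) inner_add_left v[symmetric])
qed

text \<open>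
  A relative interior point of a segment can lie on a supporting line only if the whole segment does.
\<close>
lemma segment_meets_supporting_line:
  fixes a b u :: "'a::real_inner"
  assumes "a \<bullet> u \<le> \<beta>" "b \<bullet> u \<le> \<beta>" "z \<in> closed_segment a b" "z \<bullet> u = \<beta>"
    and "\<not> closed_segment a b \<subseteq> {x. x \<bullet> u = \<beta>}"
  shows "closed_segment a b \<inter> {x. x \<bullet> u = \<beta>} = {a} \<or> closed_segment a b \<inter> {x. x \<bullet> u = \<beta>} = {b}"
proof -
  have val: "((1 - t) *\<^sub>R a + t *\<^sub>R b) \<bullet> u = \<beta> - (1 - t) * (\<beta> - a \<bullet> u) - t * (\<beta> - b \<bullet> u)" for t
    by (simp add: inner_add_left algebra_simps)
  have zero: "(1 - t) * (\<beta> - a \<bullet> u) = 0 \<and> t * (\<beta> - b \<bullet> u) = 0"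
    if "0 \<le> t" "t \<le> 1" "((1 - t) *\<^sub>R a + t *\<^sub>R b) \<bullet> u = \<beta>" for t
  proof -
    have "(1 - t) * (\<beta> - a \<bullet> u) \<ge> 0" "t * (\<beta> - b \<bullet> u) \<ge> 0" using that assms by simp_all
    then show ?thesis using that(3) unfolding val by linarith
  qed
  obtain t where t: "0 \<le> t" "t \<le> 1" "((1 - t) *\<^sub>R a + t *\<^sub>R b) \<bullet> u = \<beta>"
    using assms(3,4) by (auto simp: closed_segment_def)
  have "\<not> (a \<bullet> u = \<beta> \<and> b \<bullet> u = \<beta>)"
  proof
    assume "a \<bullet> u = \<beta> \<and> b \<bullet> u = \<beta>"
    then have "closed_segment a b \<subseteq> {x. x \<bullet> u = \<beta>}"
      unfolding closed_segment_def by (auto simp: val)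
    then show False using assms(5) by blast
  qed
  then consider "a \<bullet> u = \<beta>" "b \<bullet> u \<noteq> \<beta>" | "a \<bullet> u \<noteq> \<beta>" "b \<bullet> u = \<beta>"
    using zero[OF t] unfolding mult_eq_0_iff by auto
  then show ?thesis
  proof cases
    case 1
    have "closed_segment a b \<inter> {x. x \<bullet> u = \<beta>} \<subseteq> {a}"
      using zero 1 by (fastforce simp: closed_segment_def)
    then show ?thesis using 1 by auto
  next
    case 2
    have "closed_segment a b \<inter> {x. x \<bullet> u = \<beta>} \<subseteq> {b}"
      using zero 2 by (fastforce simp: closed_segment_def)
    then show ?thesis using 2 by auto
  qed
qed

text \<open>
  In the plane an orthogonal map is a rotation or a reflection; on unit vectors it adds an angle or
  subtracts from one.
\<close>
lemma orthogonal_on_dirs: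
  assumes "orthogonal_transformation g"
  obtains t where "\<And>\<theta>. g (dir \<theta>) = dir (t + \<theta>)" | t where "\<And>\<theta>. g (dir \<theta>) = dir (t - \<theta>)"
proof -
  have "norm (g (dir 0)) = 1"
    using assms by (simp add: orthogonal_transformation_norm)
  then obtain t where t: "g (dir 0) = dir t" by (rule unit_vector_is_dir)
  define y where "y = g (dir (pi / 2))"
  have "y \<bullet> dir t = 0"
    unfolding y_def t[symmetric] orthogonal_inner[OF assms] by (simp add: dir_inner)
  then have y: "y = (y \<bullet> dir (t + pi / 2)) *\<^sub>R dir (t + pi / 2)"
    using perp_decomposition[of y t] by simp
  define s where "s = y \<bullet> dir (t + pi / 2)"
  have "norm y = 1"
    unfolding y_def using assms by (simp add: orthogonal_transformation_norm)
  then have "\<bar>s\<bar> = 1" using y unfolding s_def by (metis norm_dir norm_scaleR mult.right_neutral)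
  then have s: "s = 1 \<or> s = -1" by linarith
  have "dir \<theta> = cos \<theta> *\<^sub>R dir 0 + sin \<theta> *\<^sub>R dir (pi / 2)" for \<theta>
    by (rule vec2_eqI) auto
  then have g: "g (dir \<theta>) = cos \<theta> *\<^sub>R dir t + (sin \<theta> * s) *\<^sub>R dir (t + pi / 2)" for \<theta>
    using y linear_add[OF orthogonal_linear[OF assms]] linear_scale[OF orthogonal_linear[OF assms]]
    by (metis s_def scaleR_scaleR t y_def)
  show ?thesis
    using s
  proof
    assume "s = 1"
    then have "g (dir \<theta>) = dir (t + \<theta>)" for \<theta>
      unfolding g by (intro vec2_eqI) (auto simp: cos_add sin_add)
    then show ?thesis by (rule that(1))
  next
    assume "s = -1"
    then have "g (dir \<theta>) = dir (t - \<theta>)" for \<theta>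
      unfolding g by (intro vec2_eqI) (auto simp: cos_add sin_add cos_diff sin_diff)
    then show ?thesis by (rule that(2))
  qed
qed

lemma dir_eq_shift:
  assumes "dir x = dir y" shows "dir (x + d) = dir (y + d)"
proof -
  have "cos x = cos y" "sin x = sin y" using assms by (metis dir_nth(1), metis dir_nth(2))
  then show ?thesis by (intro vec2_eqI) (auto simp: cos_add sin_add)
qed

context regular_polygon
begin

text \<open>
  The reflection in the line of side \<open>i\<close>.
\<close>
definition tau :: "int \<Rightarrow> real ^ 2 \<Rightarrow> real ^ 2" where
  "tau i x = x - (2 * (x \<bullet> nrm i - 1)) *\<^sub>R nrm i"

lemma tau_inner: "tau i x \<bullet> nrm i = 2 - x \<bullet> nrm i"
  by (simp add: tau_def inner_diff_left)

lemma tau_tau [simp]: "tau i (tau i x) = x"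
  by (simp add: tau_def[of i "tau i x"] tau_inner) (simp add: tau_def algebra_simps)

lemma tau_comp_tau [simp]: "tau i \<circ> tau i = id"
  by auto

lemma tau_fixes: "x \<bullet> nrm i = 1 \<Longrightarrow> tau i x = x"
  by (simp add: tau_def)

lemma tau_edge: "tau i ` edge J i = edge J i"
  using tau_fixes edge_inner_nrm by force

lemma similarity_tau: "similarity 1 (tau i)"
proof -
  have "dist (tau i x) (tau i y) = dist x y" for x y
  proof -
    have 1: "tau i x - tau i y = (x - y) - (2 * ((x - y) \<bullet> nrm i)) *\<^sub>R nrm i"
      by (simp add: tau_def algebra_simps inner_diff_left)
    have "(tau i x - tau i y) \<bullet> (tau i x - tau i y) = (x - y) \<bullet> (x - y)"
      unfolding 1 by (simp add: inner_diff_left inner_diff_right inner_commute[of "nrm i"] algebra_simps)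
    then show ?thesis by (simp add: dist_norm norm_eq_sqrt_inner)
  qed
  then show ?thesis by (simp add: similarity_def)
qed

lemma Q_inter_tau_Q: "Qpoly J \<inter> tau i ` Qpoly J = edge J i"
proof
  show "edge J i \<subseteq> Qpoly J \<inter> tau i ` Qpoly J"
    using tau_edge edge_subset_Q by blast
  show "Qpoly J \<inter> tau i ` Qpoly J \<subseteq> edge J i"
  proof
    fix x assume x: "x \<in> Qpoly J \<inter> tau i ` Qpoly J"
    then obtain y where "y \<in> Qpoly J" "x = tau i y" by auto
    then have "x \<bullet> nrm i \<ge> 1" using Q_inner_nrm_le[of y i] by (simp add: tau_inner)
    then show "x \<in> edge J i" using x Q_inner_nrm_le[of x i] by (auto simp: edge_eq)
  qed
qed

lemma similarity_edge_image_eq: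
  assumes "similarity \<rho> F" "similarity \<sigma> H" "F ` edge J i = H ` edge J j"
  shows "{F (vert J (i - 1)), F (vert J i)} = {H (vert J (j - 1)), H (vert J j)}"
    and "F (nrm i) = H (nrm j)"
proof -
  show 1: "{F (vert J (i - 1)), F (vert J i)} = {H (vert J (j - 1)), H (vert J j)}"
    using assms unfolding edge_def similarity_segment[OF assms(1)] similarity_segment[OF assms(2)]
    by simp
  then have "midpoint (F (vert J (i - 1))) (F (vert J i)) = midpoint (H (vert J (j - 1))) (H (vert J j))"
    by (auto simp: doubleton_eq_iff midpoint_sym)
  then show "F (nrm i) = H (nrm j)"
    using assms by (metis edge_midpoint similarity_midpoint)
qed

text \<open>
  A rotation or reflection of the plane that respects one pair of normals shifts the vertex indices,
  or reverses them.
\<close>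
lemma orthogonal_nrm_vert:
  assumes "orthogonal_transformation g" "g (nrm j) = nrm i"
  shows "(\<forall>k. g (vert J k) = vert J (k + i - j)) \<or> (\<forall>k. g (vert J k) = vert J (i + j - k - 1))"
proof -
  have scale: "g (a *\<^sub>R x) = a *\<^sub>R g x" for a x
    using linear_scale[OF orthogonal_linear[OF assms(1)]] .
  from assms(1) show ?thesis
  proof (cases rule: orthogonal_on_dirs)
    case (1 t)
    have "g (vert J k) = vert J (k + i - j)" for k
    proof -
      have "dir (t + (2 * pi / J * j - pi / 2) + (2 * pi / J * (k - j) + pi / J))
        = dir ((2 * pi / J * i - pi / 2) + (2 * pi / J * (k - j) + pi / J))"
        using assms(2) by (intro dir_eq_shift) (simp add: nrm_def 1)
      then have "dir (t + (2 * pi / J * k - pi / 2 + pi / J)) = dir (2 * pi / J * (k + i - j) - pi / 2 + pi / J)"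
        by (simp add: algebra_simps add_divide_distrib diff_divide_distrib)
      then show ?thesis unfolding vert_dir scale 1 by simp
    qed
    then show ?thesis by blast
  next
    case (2 t)
    have "g (vert J k) = vert J (i + j - k - 1)" for k
    proof -
      have "dir (t - (2 * pi / J * j - pi / 2) + (2 * pi / J * (j - k) - pi / J))
        = dir ((2 * pi / J * i - pi / 2) + (2 * pi / J * (j - k) - pi / J))"
        using assms(2) by (intro dir_eq_shift) (simp add: nrm_def 2)
      then have "dir (t - (2 * pi / J * k - pi / 2 + pi / J)) = dir (2 * pi / J * (i + j - k - 1) - pi / 2 + pi / J)"
        by (simp add: algebra_simps add_divide_distrib diff_divide_distrib)
      then show ?thesis unfolding vert_dir scale 2 by simp
    qed
    then show ?thesis by blast
  qed
qed

lemma orthogonal_nrm_edge: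
  assumes "orthogonal_transformation g" "g (nrm j) = nrm i"
  shows "g ` edge J j = edge J i"
proof -
  have "closed_segment (g (vert J (j - 1))) (g (vert J j)) = edge J i"
    using orthogonal_nrm_vert[OF assms]
  proof
    assume "\<forall>k. g (vert J k) = vert J (k + i - j)"
    then show ?thesis unfolding edge_def by simp
  next
    assume "\<forall>k. g (vert J k) = vert J (i + j - k - 1)"
    then show ?thesis unfolding edge_def by (simp add: insert_commute)
  qed
  then show ?thesis
    unfolding edge_def similarity_segment[OF similarity_orthogonal[OF assms(1)]] .
qed

lemma orthogonal_nrm_imp_D:
  assumes "orthogonal_transformation g" "g (nrm j) = nrm i"
  shows "g \<in> D_grp J"
proof -
  have sub: "g ` Qpoly J \<subseteq> Qpoly J" if "orthogonal_transformation g" "g (nrm j) = nrm i" for g i j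
  proof -
    have "g ` vert J ` ZJ J \<subseteq> Qpoly J"
      using orthogonal_nrm_vert[OF that] by auto
    then have "convex hull (g ` vert J ` ZJ J) \<subseteq> Qpoly J"
      using convex_Q by (simp add: hull_minimal)
    then show ?thesis
      unfolding Qpoly_def using convex_hull_linear_image[OF orthogonal_linear[OF that(1)]] by metis
  qed
  have inv: "orthogonal_transformation (finv g)" "finv g (nrm i) = nrm j"
    using assms by (auto simp: orthogonal_transformation_inv orthogonal_transformation_inj inv_f_eq)
  have "g ` finv g ` Qpoly J = Qpoly J"
    using orthogonal_transformation_surj[OF assms(1)] by (rule image_f_inv_f)
  then have "Qpoly J \<subseteq> g ` Qpoly J" using sub[OF inv] by blast
  then show ?thesis using sub[OF assms] assms(1) by (auto simp: D_grp_def)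
qed

lemma affine_hull_edge: "affine hull (edge J i) = {x. x \<bullet> nrm i = 1}"
proof
  show "affine hull (edge J i) \<subseteq> {x. x \<bullet> nrm i = 1}"
  proof (rule hull_minimal)
    show "edge J i \<subseteq> {x. x \<bullet> nrm i = 1}" using edge_inner_nrm by auto
    show "affine {x. x \<bullet> nrm i = 1}"
      using affine_hyperplane[of "nrm i" 1] by (simp add: inner_commute)
  qed
  show "{x. x \<bullet> nrm i = 1} \<subseteq> affine hull (edge J i)"
  proof
    fix x assume "x \<in> {x. x \<bullet> nrm i = 1}"
    define a where "a = vert J (i - 1)"
    define e where "e = 2 * pi / J * i - pi / 2"
    have "(x - a) \<bullet> dir e = 0"
      using \<open>x \<in> _\<close> vert_inner_own_nrm(2)[of i] by (simp add: a_def e_def inner_diff_left nrm_def)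
    then have "x - a = ((x - a) \<bullet> dir (e + pi / 2)) *\<^sub>R dir (e + pi / 2)"
      using perp_decomposition[of "x - a" e] by simp
    moreover have "dir (e + pi / 2) = (1 / (2 * tan (pi / J))) *\<^sub>R (vert J i - a)"
      unfolding a_def edge_vector e_def using tan_angle_pos by simp
    ultimately obtain t where "x - a = t *\<^sub>R (vert J i - a)" by (metis scaleR_scaleR)
    then have "x = (1 - t) *\<^sub>R a + t *\<^sub>R vert J i" by (simp add: algebra_simps)
    then have "x \<in> affine hull {a, vert J i}" unfolding affine_hull_2 
      by (intro CollectI exI[of _ "1 - t"] exI[of _ t]) simp
    then show "x \<in> affine hull (edge J i)"
      by (simp add: edge_def a_def segment_convex_hull)
  qed
qed

text \<open>
  Reflection commutes with similarities, since these preserve nearest points.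
\<close>
lemma reflect_in_edge_line:
  assumes "similarity \<rho> F"
  shows "reflect_in (affine hull (F ` edge J i)) (F x) = F (tau i x)"
proof -
  define p where "p = x - (x \<bullet> nrm i - 1) *\<^sub>R nrm i"
  have \<rho>: "0 < \<rho>" and d: "\<And>x y. dist (F x) (F y) = \<rho> * dist x y"
    using assms by (auto simp: similarity_def)
  have hull: "affine hull (F ` edge J i) = F ` {x. x \<bullet> nrm i = 1}"
  proof -
    have "F ` edge J i = convex hull {F (vert J (i - 1)), F (vert J i)}"
      unfolding edge_def similarity_segment[OF assms] by (rule segment_convex_hull)
    then have "affine hull (F ` edge J i) = affine hull {F (vert J (i - 1)), F (vert J i)}"
      by simp
    also have "\<dots> = F ` (affine hull {vert J (i - 1), vert J i})"
      unfolding affine_hull_2 by (auto simp: similarity_affine_combination[OF assms] image_iff) 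
        (metis similarity_affine_combination[OF assms])+
    also have "affine hull {vert J (i - 1), vert J i} = affine hull (edge J i)"
      by (simp add: edge_def segment_convex_hull)
    finally show ?thesis by (simp add: affine_hull_edge)
  qed
  have p: "p \<bullet> nrm i = 1" by (simp add: p_def inner_diff_left)
  have min: "dist x p \<le> dist x y" if "y \<bullet> nrm i = 1" for y
  proof -
    have "dist x p = \<bar>(x - y) \<bullet> nrm i\<bar>"
      using that by (simp add: p_def dist_norm inner_diff_left)
    also have "\<dots> \<le> norm (x - y) * norm (nrm i)" by (rule Cauchy_Schwarz_ineq2)
    finally show ?thesis by (simp add: dist_norm)
  qed
  have "F p = closest_point (affine hull (F ` edge J i)) (F x)"
  proof (rule closest_point_unique)
    show "F p \<in> affine hull (F ` edge J i)" using p by (simp add: hull)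
    show "\<forall>z\<in>affine hull (F ` edge J i). dist (F x) (F p) \<le> dist (F x) z"
      unfolding hull using min \<rho> by (auto simp: d)
  qed (auto simp: affine_imp_convex)
  then have 1: "reflect_in (affine hull (F ` edge J i)) (F x) = 2 *\<^sub>R F p - F x"
    by (simp add: reflect_in_def)
  have "p = (1/2) *\<^sub>R x + (1/2) *\<^sub>R tau i x"
    by (simp add: p_def tau_def algebra_simps flip: scaleR_left_distrib)
  then have "F p = (1/2) *\<^sub>R F x + (1/2) *\<^sub>R F (tau i x)"
    using similarity_affine_combination[OF assms, of "1/2" "1/2"] by simp
  then show ?thesis unfolding 1 by (simp add: algebra_simps)
qed

lemma R_refl_rho: "R_refl (rho J i) x = x - (2 * (x \<bullet> nrm i)) *\<^sub>R nrm i"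
proof -
  define L where "L = span {dir (rho J i)}"
  define p where "p = x - (x \<bullet> nrm i) *\<^sub>R nrm i"
  have rho: "dir (rho J i) = dir (2 * pi / J * i - pi / 2 + pi / 2)" by (simp add: rho_def)
  have L: "y \<bullet> nrm i = 0" if y: "y \<in> L" for y
  proof -
    obtain c where "y = c *\<^sub>R dir (rho J i)"
      using y unfolding L_def span_singleton by blast
    then show ?thesis by (simp add: nrm_def rho dir_inner)
  qed
  have pL: "p \<in> L"
  proof -
    have "p = (p \<bullet> dir (rho J i)) *\<^sub>R dir (rho J i)"
    proof -
      have "p \<bullet> nrm i = 0" by (simp add: p_def inner_diff_left)
      then show ?thesis
        using perp_decomposition[of p "2 * pi / J * i - pi / 2"]
        unfolding rho nrm_def by simp
    qed
    then show ?thesis unfolding L_def by (metis span_base span_scale singletonI)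
  qed
  have "p = closest_point L x"
  proof (rule closest_point_unique)
    show "\<forall>z\<in>L. dist x p \<le> dist x z"
    proof
      fix z assume "z \<in> L"
      then have "dist x p = \<bar>(x - z) \<bullet> nrm i\<bar>"
        using L by (simp add: p_def dist_norm inner_diff_left)
      also have "\<dots> \<le> norm (x - z) * norm (nrm i)" by (rule Cauchy_Schwarz_ineq2)
      finally show "dist x p \<le> dist x z" by (simp add: dist_norm)
    qed
  qed (simp_all add: pL[unfolded L_def] L_def closed_subspace subspace_imp_convex)
  then have "R_refl (rho J i) x = 2 *\<^sub>R p - x"
    unfolding R_refl_def reflect_in_def dir_def[symmetric] L_def[symmetric] by simp
  then show ?thesis by (simp add: p_def scaleR_diff_right scaleR_2)
qed

text \<open>
  Similarities carry supporting lines to supporting lines, so the faces of cells are those of \<open>exposed_face\<close>.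
\<close>
lemma similarity_cell_face:
  assumes "similarity \<rho> F" "u \<noteq> 0" "\<And>x. x \<in> F ` Qpoly J \<Longrightarrow> x \<bullet> u \<le> \<beta>"
    "x0 \<in> F ` Qpoly J" "x0 \<bullet> u = \<beta>"
  shows "\<exists>k\<in>ZJ J. {x \<in> F ` Qpoly J. x \<bullet> u = \<beta>} = {F (vert J k)} \<or>
                  {x \<in> F ` Qpoly J. x \<bullet> u = \<beta>} = F ` edge J k"
proof -
  obtain w d where w: "w \<noteq> 0" "\<And>x. F x \<bullet> u = x \<bullet> w + d"
    using assms(1,2) by (rule similarity_functional) blast
  obtain y0 where y0: "y0 \<in> Qpoly J" "y0 \<bullet> w = \<beta> - d" using assms(4,5) w(2) by auto
  have "x \<bullet> w \<le> \<beta> - d" if "x \<in> Qpoly J" for x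
    using assms(3)[of "F x"] that w(2)[of x] by simp
  from exposed_face[OF w(1) this y0]
  obtain k where k: "k \<in> ZJ J" "{x \<in> Qpoly J. x \<bullet> w = \<beta> - d} = {vert J k} \<or> {x \<in> Qpoly J. x \<bullet> w = \<beta> - d} = edge J k"
    by auto
  have "{x \<in> F ` Qpoly J. x \<bullet> u = \<beta>} = F ` {x \<in> Qpoly J. x \<bullet> w = \<beta> - d}"
    using w(2) by (auto simp: algebra_simps)
  then show ?thesis using k by (metis (no_types, lifting) image_empty image_insert)
qed

text \<open>
  A vertex of \<open>Q\<close> is the only maximum on \<open>Q\<close> of the sum of two neighbouring normals.  A similar copy of \<open>Q\<close> inside \<open>Q\<close>
  that contains it therefore has a face consisting of this point.
\<close>
lemma vertex_of_inscribed_cell: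
  assumes "similarity \<rho> F" "F ` Qpoly J \<subseteq> Qpoly J" "vert J a \<in> F ` Qpoly J"
  shows "\<exists>k\<in>ZJ J. vert J a = F (vert J k)"
proof -
  define u where "u = nrm a + nrm (a + 1)"
  have au: "vert J a \<bullet> u = 2" by (simp add: u_def inner_add_right)
  have "u \<noteq> 0" using au by auto
  moreover have "x \<bullet> u \<le> 2" if "x \<in> F ` Qpoly J" for x
    using that assms(2) Q_inner_nrm_le[of x a] Q_inner_nrm_le[of x "a + 1"]
    by (auto simp: u_def inner_add_right)
  moreover have "x = vert J a" if "x \<in> F ` Qpoly J" "x \<bullet> u = 2" for x
    using that assms(2) Q_inner_nrm_le[of x a] Q_inner_nrm_le[of x "a + 1"]
    by (intro vert_unique) (auto simp: u_def inner_add_right)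
  then have "{x \<in> F ` Qpoly J. x \<bullet> u = 2} \<subseteq> {vert J a}" by blast
  then have "{x \<in> F ` Qpoly J. x \<bullet> u = 2} = {vert J a}" using au assms(3) by blast
  ultimately obtain k where k: "k \<in> ZJ J" "{vert J a} = {F (vert J k)} \<or> {vert J a} = F ` edge J k"
    using similarity_cell_face[OF assms(1), of u 2 "vert J a"] au assms(3) by auto
  from k(2) show ?thesis
  proof
    assume "{vert J a} = {F (vert J k)}" then show ?thesis using k(1) by auto
  next
    assume "{vert J a} = F ` edge J k"
    moreover have "F (vert J k) \<in> F ` edge J k" by simp
    ultimately have "vert J a = F (vert J k)" by (metis singletonD)
    then show ?thesis using k(1) by blast
  qed
qed

lemma D_orthogonal: "g \<in> D_grp J \<Longrightarrow> orthogonal_transformation g"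
  and D_Q: "g \<in> D_grp J \<Longrightarrow> g ` Qpoly J = Qpoly J"
  by (simp_all add: D_grp_def)

lemma D_inv: assumes "g \<in> D_grp J" shows "finv g \<in> D_grp J"
proof -
  have "finv g ` Qpoly J = Qpoly J"
    using D_Q[OF assms] orthogonal_transformation_inj[OF D_orthogonal[OF assms]]
    by (metis image_inv_f_f)
  then show ?thesis using assms by (auto simp: D_grp_def orthogonal_transformation_inv)
qed

lemma D_vert: assumes "g \<in> D_grp J" shows "\<exists>k\<in>ZJ J. g (vert J i) = vert J k"
proof -
  have "\<exists>k\<in>ZJ J. vert J i = finv g (vert J k)"
    using D_inv[OF assms] by (intro vertex_of_inscribed_cell[of 1])
      (auto simp: D_Q D_orthogonal similarity_orthogonal)
  then show ?thesis
    using orthogonal_transformation_surj[OF D_orthogonal[OF assms]] by (metis surj_f_inv_f)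
qed

text \<open>
  The image of a side is again an exposed face of \<open>Q\<close>, and it has more than one point.
\<close>
lemma D_edge: assumes "g \<in> D_grp J" shows "\<exists>k\<in>ZJ J. g ` edge J i = edge J k"
proof -
  have lin: "g x \<bullet> g (nrm i) = x \<bullet> nrm i" for x
    using D_orthogonal[OF assms] by (simp add: orthogonal_inner)
  have face: "{x \<in> g ` Qpoly J. x \<bullet> g (nrm i) = 1} = g ` edge J i"
    by (auto simp: edge_eq lin)
  have "g (nrm i) \<noteq> 0"
    using lin[of "nrm i"] by auto
  then have "\<exists>k\<in>ZJ J. {x \<in> Qpoly J. x \<bullet> g (nrm i) = 1} = {vert J k} \<or>
                  {x \<in> Qpoly J. x \<bullet> g (nrm i) = 1} = edge J k"
  proof (rule exposed_face[where ?x0.0 = "g (nrm i)"])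
    show "x \<bullet> g (nrm i) \<le> 1" if x: "x \<in> Qpoly J" for x
    proof -
      obtain y where "y \<in> Qpoly J" "x = g y" using x D_Q[OF assms] by blast
      then show ?thesis using lin Q_inner_nrm_le by simp
    qed
    show "g (nrm i) \<in> Qpoly J" using D_Q[OF assms] nrm_in_edge edge_subset_Q by blast
    show "g (nrm i) \<bullet> g (nrm i) = 1" using lin[of "nrm i"] by simp
  qed
  then obtain k where k: "k \<in> ZJ J" "g ` edge J i = {vert J k} \<or> g ` edge J i = edge J k"
    using face D_Q[OF assms] by auto
  have "g ` edge J i \<noteq> {vert J k}"
  proof
    assume "g ` edge J i = {vert J k}"
    moreover have "g (vert J (i - 1)) \<in> g ` edge J i" "g (vert J i) \<in> g ` edge J i" by simp_all
    ultimately have "g (vert J (i - 1)) = g (vert J i)" by simp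
    then show False
      using edge_endpoints_distinct orthogonal_transformation_inj[OF D_orthogonal[OF assms]]
      by (meson injD)
  qed
  then show ?thesis using k by auto
qed

lemma D_nrm:
  assumes "g \<in> D_grp J" "g ` edge J i = edge J k" shows "g (nrm i) = nrm k"
proof -
  have "similarity 1 (id :: real ^ 2 \<Rightarrow> real ^ 2)" by (simp add: similarity_def)
  then show ?thesis
    using similarity_edge_image_eq(2)[of 1 g 1 id i k] assms
    by (simp add: D_orthogonal similarity_orthogonal)
qed

lemma D_tau:
  assumes "g \<in> D_grp J" "g ` edge J i = edge J k" shows "g (tau i x) = tau k (g x)"
proof -
  note lin = orthogonal_linear[OF D_orthogonal[OF assms(1)]]
  have "g x \<bullet> nrm k = x \<bullet> nrm i"
    using D_nrm[OF assms] orthogonal_inner[OF D_orthogonal[OF assms(1)]] by metis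
  then show ?thesis
    using D_nrm[OF assms] by (simp add: tau_def linear_diff[OF lin] linear_scale[OF lin])
qed

text \<open>
  After pulling back by \<open>F\<close> the second cell is an isometric copy of \<open>Q\<close> with the side \<open>i\<close>, whose normal there
  is \<open>nrm i\<close> or its negative.  With the same normal the two cells would coincide, so the
  normals are opposite, and reflecting in the side brings the second cell onto the first.
\<close>
lemma shared_edge_reflection:
  assumes F: "similarity \<rho> F" and H: "similarity \<rho> H"
    and cap: "F ` Qpoly J \<inter> H ` Qpoly J = F ` edge J i" and ed: "F ` edge J i = H ` edge J j"
  obtains g where "g \<in> D_grp J" "g ` edge J j = edge J i" "H = F \<circ> tau i \<circ> g"
proof -
  define H' where "H' = finv F \<circ> H"
  have invF: "finv F (F x) = x" "F (finv F x) = x" for x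
    using similarity_bij[OF F] by (simp_all add: bij_is_inj bij_is_surj surj_f_inv_f)
  have simH': "similarity 1 H'"
    using similarity_comp[OF similarity_inv[OF F] H] F unfolding H'_def by (simp add: similarity_def)
  have edH': "H' ` edge J j = edge J i"
    unfolding H'_def image_comp[symmetric] ed[symmetric] using invF by (simp add: image_image)
  obtain \<psi> c where \<psi>: "orthogonal_transformation \<psi>" "\<And>x. H' x = \<psi> x + c"
    using simH' by (rule similarity_obtain) simp
  have ends: "{H' (vert J (j - 1)), H' (vert J j)} = {vert J (i - 1), vert J i}" and mid: "H' (nrm j) = nrm i"
    using similarity_edge_image_eq[OF simH', of 1 id j i] edH' similarity_orthogonal[OF orthogonal_transformation_id]
    by (simp_all add: id_def)
  have "H' (vert J j) - H' (vert J (j - 1)) = \<psi> (vert J j - vert J (j - 1))"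
    using linear_diff[OF orthogonal_linear[OF \<psi>(1)]] by (simp add: \<psi>(2))
  moreover have "H' (vert J j) - H' (vert J (j - 1)) = vert J i - vert J (i - 1) \<or>
     H' (vert J j) - H' (vert J (j - 1)) = - (vert J i - vert J (i - 1))"
    using ends by (auto simp: doubleton_eq_iff)
  ultimately have "\<psi> (vert J j - vert J (j - 1)) = vert J i - vert J (i - 1) \<or>
     \<psi> (vert J j - vert J (j - 1)) = - (vert J i - vert J (i - 1))" by simp
  moreover have "\<psi> (nrm j) \<bullet> \<psi> (vert J j - vert J (j - 1)) = 0"
    by (simp add: orthogonal_inner[OF \<psi>(1)] edge_vector_perp_nrm)
  ultimately have "\<psi> (nrm j) \<bullet> (vert J i - vert J (i - 1)) = 0" by (auto simp: inner_diff_right)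
  then have par: "\<psi> (nrm j) = (\<psi> (nrm j) \<bullet> nrm i) *\<^sub>R nrm i" by (rule perp_edge_imp_parallel_nrm)
  have "norm (\<psi> (nrm j)) = 1" using \<psi>(1) by (simp add: orthogonal_transformation_norm)
  then have "\<bar>\<psi> (nrm j) \<bullet> nrm i\<bar> = 1"
    by (metis par norm_nrm norm_scaleR mult.right_neutral)
  then have "\<psi> (nrm j) = nrm i \<or> \<psi> (nrm j) = - nrm i"
  proof -
    have "\<psi> (nrm j) \<bullet> nrm i = 1 \<or> \<psi> (nrm j) \<bullet> nrm i = - 1"
      using \<open>\<bar>_\<bar> = 1\<close> by linarith
    then show ?thesis using par by (metis scaleR_minus1_left scaleR_one)
  qed
  moreover have "\<psi> (nrm j) \<noteq> nrm i"
  proof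
    assume a: "\<psi> (nrm j) = nrm i"
    then have "c = 0" using mid \<psi>(2) by simp
    then have "H' = \<psi>" using \<psi>(2) by auto
    then have "H' ` Qpoly J = Qpoly J"
      using D_Q[OF orthogonal_nrm_imp_D[OF \<psi>(1) a]] by simp
    moreover have "H ` Qpoly J = F ` H' ` Qpoly J"
      by (simp add: H'_def image_image invF)
    ultimately have "F ` Qpoly J = F ` edge J i" using cap by simp
    then have "Qpoly J = edge J i" using similarity_inj[OF F] by (simp add: inj_image_eq_iff)
    then show False using Q_not_in_line[of i] edge_inner_nrm by force
  qed
  ultimately have neg: "\<psi> (nrm j) = - nrm i" by blast
  then have c: "c = 2 *\<^sub>R nrm i" using mid \<psi>(2)[of "nrm j"] by (simp add: algebra_simps scaleR_2)
  define g where "g = tau i \<circ> H'"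
  have "g 0 = 0"
    using linear_0[OF orthogonal_linear[OF \<psi>(1)]] by (simp add: g_def \<psi>(2) c tau_def)
  moreover have "similarity 1 g"
    unfolding g_def using similarity_comp[OF similarity_tau simH'] by simp
  ultimately have og: "orthogonal_transformation g"
    by (simp add: orthogonal_transformation_isometry similarity_def)
  have gn: "g (nrm j) = nrm i" by (simp add: g_def mid tau_fixes)
  have "H = F \<circ> tau i \<circ> g" by (auto simp: g_def H'_def invF)
  then show ?thesis
    using that orthogonal_nrm_imp_D[OF og gn] orthogonal_nrm_edge[OF og gn] by blast
qed

text \<open>
  The two cells that share the side lie on opposite sides of its line, so this line supports only one of them.
\<close>
lemma shared_edge_not_in_supporting_line:
  assumes F: "similarity \<rho> F" and "u \<noteq> 0"
    and "\<And>x. x \<in> Qpoly J \<Longrightarrow> F x \<bullet> u \<le> \<beta>" "\<And>x. x \<in> Qpoly J \<Longrightarrow> F (tau i x) \<bullet> u \<le> \<beta>"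
  shows "\<not> F ` edge J i \<subseteq> {x. x \<bullet> u = \<beta>}"
proof
  assume a: "F ` edge J i \<subseteq> {x. x \<bullet> u = \<beta>}"
  obtain w d where w: "w \<noteq> 0" "\<And>x. F x \<bullet> u = x \<bullet> w + d"
    using F \<open>u \<noteq> 0\<close> by (rule similarity_functional) blast
  have e: "x \<bullet> w = \<beta> - d" if "x \<in> edge J i" for x using a w(2)[of x] that by auto
  have "w \<bullet> (vert J i - vert J (i - 1)) = 0"
    using e vert_in_edge[of i] by (simp add: inner_diff_right inner_commute[of w])
  then have par: "w = (w \<bullet> nrm i) *\<^sub>R nrm i" by (rule perp_edge_imp_parallel_nrm)
  define l where "l = w \<bullet> nrm i"
  have w_l: "x \<bullet> w = l * (x \<bullet> nrm i)" for x
    unfolding l_def by (subst par) simp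
  obtain q where q: "q \<in> Qpoly J" "q \<bullet> nrm i < 1" using Q_not_in_line by blast
  have "l = \<beta> - d" using e[OF nrm_in_edge] w_l by simp
  then have "l * (q \<bullet> nrm i) \<le> l" "l * (2 - q \<bullet> nrm i) \<le> l"
    using assms(3,4)[OF q(1)] unfolding w(2) w_l tau_inner by simp_all
  then have "l * (1 - q \<bullet> nrm i) = 0" by (simp add: algebra_simps)
  then have "l = 0" using q(2) by simp
  then show False using w(1) par l_def by simp
qed

text \<open>
  The similarity maps the line of side \<open>i\<close> to the line of side \<open>a\<close>, and reflection in a line is
  natural under similarities.
\<close>
lemma tau_similarity_commute:
  assumes F: "similarity \<rho> F" and "F ` edge J i \<subseteq> {x. x \<bullet> nrm a = 1}"
  shows "tau a (F x) = F (tau i x)"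
proof -
  obtain \<phi> c where *: "0 < \<rho>" "orthogonal_transformation \<phi>" "\<And>x. F x = \<rho> *\<^sub>R \<phi> x + c"
    using F by (rule similarity_obtain) blast
  note lin = orthogonal_linear[OF *(2)]
  obtain v where v: "\<phi> v = nrm a" using orthogonal_transformation_surj[OF *(2)] by (metis surjD)
  have Fa: "F y \<bullet> nrm a = \<rho> * (y \<bullet> v) + c \<bullet> nrm a" for y
    by (simp add: *(3) inner_add_left orthogonal_inner[OF *(2)] flip: v)
  have "F (vert J i) \<bullet> nrm a = 1" "F (vert J (i - 1)) \<bullet> nrm a = 1" and mid: "F (nrm i) \<bullet> nrm a = 1"
    using assms(2) vert_in_edge nrm_in_edge by blast+
  then have "\<rho> * (vert J i \<bullet> v) = \<rho> * (vert J (i - 1) \<bullet> v)" unfolding Fa by linarith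
  then have "v \<bullet> (vert J i - vert J (i - 1)) = 0"
    using *(1) by (simp add: inner_diff_right inner_commute[of v])
  then have par: "v = (v \<bullet> nrm i) *\<^sub>R nrm i" by (rule perp_edge_imp_parallel_nrm)
  define l where "l = v \<bullet> nrm i"
  have "norm v = 1" using v *(2) by (metis norm_nrm orthogonal_transformation_norm)
  then have l2: "l * l = 1"
    using par by (metis l_def abs_mult_self_eq mult.right_neutral norm_nrm norm_scaleR)
  have vl: "y \<bullet> v = l * (y \<bullet> nrm i)" for y
    unfolding l_def by (subst par) simp
  have "nrm a = l *\<^sub>R \<phi> (nrm i)"
    using v par linear_scale[OF lin] by (metis l_def)
  then have "\<phi> (nrm i) = l *\<^sub>R nrm a" using l2 by simp
  have cl: "c \<bullet> nrm a = 1 - \<rho> * l" using mid unfolding Fa vl by simp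
  have "F x \<bullet> nrm a - 1 = \<rho> * l * (x \<bullet> nrm i - 1)"
    unfolding Fa vl cl by (simp add: algebra_simps)
  then have 1: "tau a (F x) = F x - (2 * (\<rho> * l * (x \<bullet> nrm i - 1))) *\<^sub>R nrm a"
    by (simp add: tau_def)
  have "\<phi> (tau i x) = \<phi> x - (2 * (x \<bullet> nrm i - 1)) *\<^sub>R l *\<^sub>R nrm a"
    unfolding tau_def linear_diff[OF lin] linear_scale[OF lin] \<open>\<phi> (nrm i) = _\<close> ..
  then have "F (tau i x) = F x - \<rho> *\<^sub>R (2 * (x \<bullet> nrm i - 1)) *\<^sub>R l *\<^sub>R nrm a"
    unfolding *(3) by (simp add: scaleR_diff_right)
  then show ?thesis unfolding 1 by (simp add: mult_ac)
qed

lemma edge_inj: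
  assumes "edge J e = edge J e'" "e \<in> ZJ J" "e' \<in> ZJ J" shows "e = e'"
proof -
  have 1: "vert J e \<bullet> nrm e' = 1" "vert J (e - 1) \<bullet> nrm e' = 1"
    using assms(1) vert_in_edge edge_inner_nrm by blast+
  have e: "e mod int J = e" "e' mod int J = e'" using assms by (auto simp: ZJ_iff)
  show ?thesis
  proof (rule ccontr)
    assume "e \<noteq> e'"
    then have "e mod int J = (e' - 1) mod int J"
      using vert_inner_nrm_eqD[OF 1(1)] e by simp
    moreover have "(e - 1) mod int J \<noteq> (e' - 1) mod int J"
    proof
      assume "(e - 1) mod int J = (e' - 1) mod int J"
      then have "int J dvd e - e'" by (simp add: mod_eq_dvd_iff)
      then show False using \<open>e \<noteq> e'\<close> e by (simp flip: mod_eq_dvd_iff)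
    qed
    then have "(e - 1) mod int J = e' mod int J"
      using vert_inner_nrm_eqD[OF 1(2)] by simp
    ultimately have "int J dvd e - (e' - 1)" "int J dvd e' - (e - 1)"
      by (simp_all only: mod_eq_dvd_iff[symmetric])
    then have "int J dvd (e - (e' - 1)) + (e' - (e - 1))" by (rule dvd_add)
    then have "int J dvd 2" by simp
    then show False using J_ge_3 zdvd_imp_le by fastforce
  qed
qed

lemma act_index_eqI:
  assumes "k \<in> ZJ J" "g ` edge J i = edge J k" shows "act_index J g i = k"
  unfolding act_index_def using assms edge_inj by (intro the_equality) auto

lemma edges_meet_once:
  assumes "e \<in> ZJ J" "e' \<in> ZJ J" "e \<noteq> e'" "q \<in> edge J e \<inter> edge J e'" "q' \<in> edge J e \<inter> edge J e'"
  shows "q = q'"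
proof (rule ccontr)
  assume "q \<noteq> q'"
  define t where "t = 2 * pi / J * e - pi / 2"
  have q: "q \<bullet> nrm e = 1" "q' \<bullet> nrm e = 1" "q \<bullet> nrm e' = 1" "q' \<bullet> nrm e' = 1"
    using assms(4,5) edge_inner_nrm by blast+
  have perp: "(q - q') \<bullet> dir t = 0"
    using q(1,2) unfolding t_def nrm_def inner_diff_left by linarith
  define s where "s = (q - q') \<bullet> dir (t + pi / 2)"
  have s: "q - q' = s *\<^sub>R dir (t + pi / 2)"
    using perp_decomposition[of "q - q'" t] perp by (simp add: s_def)
  then have "s \<noteq> 0" using \<open>q \<noteq> q'\<close> by auto
  moreover have "(q - q') \<bullet> nrm e' = 0" using q by (simp add: inner_diff_left)
  ultimately have "nrm e' \<bullet> dir (t + pi / 2) = 0" unfolding s by (simp add: inner_commute)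
  then have par: "nrm e' = (nrm e' \<bullet> nrm e) *\<^sub>R nrm e"
    using perp_decomposition[of "nrm e'" t] by (simp add: t_def nrm_def)
  have "q \<bullet> nrm e' = (nrm e' \<bullet> nrm e) * (q \<bullet> nrm e)" by (subst par) simp
  then have "nrm e' \<bullet> nrm e = 1" using q by simp
  then have "nrm e' = nrm e" using par by simp
  then have "edge J e = edge J e'" by (simp add: edge_eq)
  then show False using edge_inj assms by blast
qed

lemma vertex_on_two_edges:
  shows "card {e \<in> ZJ J. vert J k \<in> edge J e} \<ge> 2"
proof -
  have "k mod int J \<noteq> (k + 1) mod int J"
  proof
    assume "k mod int J = (k + 1) mod int J"
    then have "int J dvd k - (k + 1)" by (simp only: mod_eq_dvd_iff)
    then have "int J dvd 1" by simp
    then show False using J_ge_3 zdvd_imp_le by fastforce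
  qed
  moreover have "{k mod int J, (k + 1) mod int J} \<subseteq> {e \<in> ZJ J. vert J k \<in> edge J e}"
    using vert_in_edge[of k] by (simp add: edge_mod)
  ultimately show ?thesis
    by (metis (no_types, lifting) card_2_iff card_mono finite_ZJ finite_subset mem_Collect_eq subsetI)
qed

end

section \<open>The cells of a polygon-based self-similar system\<close>

lemma Int_singleton_mono: "A \<inter> B \<noteq> {} \<Longrightarrow> A \<subseteq> A' \<Longrightarrow> B \<subseteq> B' \<Longrightarrow> A' \<inter> B' = {x} \<Longrightarrow> A \<inter> B = {x}"
  by auto

lemma Int_nonempty_mono: "A \<inter> B \<noteq> {} \<Longrightarrow> A \<subseteq> A' \<Longrightarrow> B \<subseteq> B' \<Longrightarrow> A' \<inter> B' \<noteq> {}"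
  by auto

lemma group_O2: "group O2"
proof (rule groupI)
  fix g assume "g \<in> carrier O2"
  then have g: "orthogonal_transformation g" by (simp add: O2_def)
  then show "\<exists>h\<in>carrier O2. h \<otimes>\<^bsub>O2\<^esub> g = \<one>\<^bsub>O2\<^esub>"
    by (intro bexI[of _ "finv g"])
       (auto simp: O2_def orthogonal_transformation_inv orthogonal_transformation_inj)
qed (auto simp: O2_def orthogonal_transformation_compose comp_assoc id_def orthogonal_transformation_id)

lemma inv_O2:
  assumes "orthogonal_transformation g" shows "m_inv O2 g = finv g"
  using assms
  by (intro group.inv_equality[OF group_O2])
     (auto simp: O2_def orthogonal_transformation_inv orthogonal_transformation_inj)

lemma (in regular_polygon) D_star_orthogonal:
  assumes "\<phi> \<in> D_star J" shows "orthogonal_transformation \<phi>"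
proof -
  have "orthogonal_transformation (R_refl (rho J i))" for i
  proof -
    have "R_refl (rho J i) x = tau i x - 2 *\<^sub>R nrm i" for x
      by (simp add: R_refl_rho tau_def algebra_simps scaleR_2)
    then have "dist (R_refl (rho J i) x) (R_refl (rho J i) y) = dist x y" for x y
      using similarity_tau[of i] by (simp add: similarity_def dist_norm)
    moreover have "R_refl (rho J i) 0 = 0" by (simp add: R_refl_rho)
    ultimately show ?thesis by (simp add: orthogonal_transformation_isometry)
  qed
  then have "D_grp J \<union> {R_refl (rho J i) | i. i \<in> ZJ J} \<subseteq> carrier O2"
    by (auto simp: O2_def D_orthogonal)
  from group.generate_incl[OF group_O2 this] show ?thesis
    using assms unfolding D_star_def by (auto simp: O2_def)
qed

lemma words_0: "words S 0 = {[]}"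
  by (auto simp: words_def)

lemma words_Suc_iff: "w \<in> words S (Suc n) \<longleftrightarrow> (\<exists>s w'. w = s # w' \<and> s \<in> S \<and> w' \<in> words S n)"
  by (cases w) (auto simp: words_def)

lemma words_length: "w \<in> words S n \<Longrightarrow> length w = n"
  by (simp add: words_def)

lemma finite_words: "finite S \<Longrightarrow> finite (words S n)"
  unfolding words_def by (rule finite_lists_length_eq)

lemma fword_Nil [simp]: "fword f [] = id"
  and fword_Cons: "fword f (s # w) = f s \<circ> fword f w"
  and fword_Cons_image [simp]: "fword f (s # w) ` A = f s ` fword f w ` A"
  by (simp_all add: fword_def image_comp)

lemma fword_Cons_apply: "fword f (s # w) x = f s (fword f w x)"
  by (simp add: fword_def)

lemma fword_append: "fword f (w @ v) = fword f w \<circ> fword f v"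
  by (induction w) (auto simp: fword_Cons)

locale polygon_system = regular_polygon J for J :: nat +
  fixes G :: "(real ^ 2 \<Rightarrow> real ^ 2) set" and S :: "'s set" and f :: "'s \<Rightarrow> real ^ 2 \<Rightarrow> real ^ 2"
    and r :: real and \<phi> :: "'s \<Rightarrow> real ^ 2 \<Rightarrow> real ^ 2" and c :: "'s \<Rightarrow> real ^ 2"
  assumes G_subgroup: "subgroup G O2" and G_subset_D: "G \<subseteq> D_grp J"
    and finite_S: "finite S" and r_bounds: "0 < r" "r < 1"
    and \<phi>_orthogonal: "\<And>s. s \<in> S \<Longrightarrow> orthogonal_transformation (\<phi> s)"
    and f_form: "\<And>s x. s \<in> S \<Longrightarrow> f s x = r *\<^sub>R \<phi> s x + c s"
    and f_Q: "\<And>s. s \<in> S \<Longrightarrow> f s ` Qpoly J \<subseteq> Qpoly J"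
    and A2: "\<And>i. i \<in> ZJ J \<Longrightarrow> \<exists>s\<in>S. \<exists>j\<in>ZJ J. f s ` edge J j \<subseteq> edge J i"
    and A3: "\<And>g. g \<in> G \<Longrightarrow> \<exists>h. \<forall>s\<in>S. h s \<in> S \<and> finv (f (h s)) \<circ> g \<circ> f s \<in> G"
    and A4: "\<And>s s'. s \<in> S \<Longrightarrow> s' \<in> S \<Longrightarrow> s \<noteq> s' \<Longrightarrow> f s ` Qpoly J \<inter> f s' ` Qpoly J \<noteq> {} \<Longrightarrow>
           share_edge J G f \<phi> s s' \<or> share_vertex J f s s'"
begin

lemma G_orthogonal: "g \<in> G \<Longrightarrow> orthogonal_transformation g"
  and G_Q: "g \<in> G \<Longrightarrow> g ` Qpoly J = Qpoly J"
  using G_subset_D D_orthogonal D_Q by blast+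

lemma G_id: "id \<in> G"
  using subgroup.one_closed[OF G_subgroup] by (simp add: O2_def)

lemma G_comp: "g \<in> G \<Longrightarrow> h \<in> G \<Longrightarrow> g \<circ> h \<in> G"
  using subgroup.m_closed[OF G_subgroup] by (simp add: O2_def)

lemma G_inv: "g \<in> G \<Longrightarrow> finv g \<in> G"
  using subgroup.m_inv_closed[OF G_subgroup] inv_O2 G_orthogonal by metis

lemma G_inj: "g \<in> G \<Longrightarrow> inj g" and G_surj: "g \<in> G \<Longrightarrow> surj g"
  using G_orthogonal orthogonal_transformation_inj orthogonal_transformation_surj by blast+

lemma G_inv_left [simp]: "g \<in> G \<Longrightarrow> finv g (g x) = x"
  and G_inv_right [simp]: "g \<in> G \<Longrightarrow> g (finv g x) = x"
  using G_inj G_surj by (simp_all add: surj_f_inv_f)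

lemma similarity_f: "s \<in> S \<Longrightarrow> similarity r (f s)"
  using similarity_affine_form[OF r_bounds(1) \<phi>_orthogonal f_form] by blast

lemma similarity_fword: "w \<in> words S n \<Longrightarrow> similarity (r ^ n) (fword f w)"
proof (induction n arbitrary: w)
  case 0 then show ?case by (simp add: words_0 similarity_def)
next
  case (Suc n)
  then obtain s w' where w: "w = s # w'" "s \<in> S" "w' \<in> words S n" by (auto simp: words_Suc_iff)
  then show ?case
    using similarity_comp[OF similarity_f[OF w(2)] Suc.IH[OF w(3)]]
    by (simp only: w(1) fword_Cons power_Suc)
qed

lemma inj_f: "s \<in> S \<Longrightarrow> inj (f s)"
  using similarity_f similarity_inj by blast

lemma inj_fword: "w \<in> words S n \<Longrightarrow> inj (fword f w)"
  using similarity_fword similarity_inj by blast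

lemma fword_eq_iff: "w \<in> words S n \<Longrightarrow> fword f w x = fword f w y \<longleftrightarrow> x = y"
  using inj_fword by (metis injD)

lemma fword_Q: "w \<in> words S n \<Longrightarrow> fword f w ` Qpoly J \<subseteq> Qpoly J"
proof (induction n arbitrary: w)
  case 0 then show ?case by (simp add: words_0)
next
  case (Suc n)
  then obtain s w' where w: "w = s # w'" "s \<in> S" "w' \<in> words S n" by (auto simp: words_Suc_iff)
  have "f s ` fword f w' ` Qpoly J \<subseteq> f s ` Qpoly J" using Suc.IH[OF w(3)] by (rule image_mono)
  then show ?case using f_Q[OF w(2)] by (simp add: w(1))
qed

text \<open>
  The condition on single letters is iterated: pushing \<open>g\<close> past the first letter leaves another element
  of \<open>G\<close> to push past the rest of the word.
\<close>
lemma G_permutes_words: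
  assumes "w \<in> words S n" "g \<in> G"
  shows "\<exists>v\<in>words S n. \<exists>g'\<in>G. g \<circ> fword f w = fword f v \<circ> g'"
  using assms
proof (induction n arbitrary: w g)
  case 0 then show ?case by (simp add: words_0)
next
  case (Suc n)
  then obtain s w' where w: "w = s # w'" "s \<in> S" "w' \<in> words S n" by (auto simp: words_Suc_iff)
  obtain h where h: "\<forall>s\<in>S. h s \<in> S \<and> finv (f (h s)) \<circ> g \<circ> f s \<in> G"
    using A3[OF Suc.prems(2)] by blast
  define g1 where "g1 = finv (f (h s)) \<circ> g \<circ> f s"
  have hs: "h s \<in> S" "g1 \<in> G" using h w(2) by (auto simp: g1_def)
  have "surj (f (h s))" using similarity_bij[OF similarity_f[OF hs(1)]] by (rule bij_is_surj)
  then have eq: "g \<circ> f s = f (h s) \<circ> g1" by (auto simp: g1_def surj_f_inv_f)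
  obtain v' g' where v': "v' \<in> words S n" "g' \<in> G" "g1 \<circ> fword f w' = fword f v' \<circ> g'"
    using Suc.IH[OF w(3) hs(2)] by blast
  have "g \<circ> fword f w = (g \<circ> f s) \<circ> fword f w'" by (simp add: w(1) fword_Cons comp_assoc)
  also have "\<dots> = f (h s) \<circ> (g1 \<circ> fword f w')" unfolding eq by (simp add: comp_assoc)
  also have "\<dots> = fword f (h s # v') \<circ> g'" unfolding v'(3) by (simp add: fword_Cons comp_assoc)
  finally have "g \<circ> fword f w = fword f (h s # v') \<circ> g'" .
  moreover have "h s # v' \<in> words S (Suc n)" using hs v' by (auto simp: words_Suc_iff)
  ultimately show ?case using v'(2) by blast
qed

text \<open>
  The element supplied by \<open>shared_edge_reflection\<close> fixes the origin.  Comparing linear parts shows that it is the inverse of the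
  element that the definition of a shared side requires to be in \<open>G\<close>.
\<close>
lemma symbols_sharing_edge:
  assumes s: "s \<in> S" "s' \<in> S" and share: "share_edge J G f \<phi> s s'"
  obtains a g where "a \<in> ZJ J" "g \<in> G" "f s' = f s \<circ> tau a \<circ> g"
proof -
  obtain i j where ij: "i \<in> ZJ J" "j \<in> ZJ J" "f s ` Qpoly J \<inter> f s' ` Qpoly J = f s ` edge J i"
      "f s ` edge J i = f s' ` edge J j"
    and G: "finv (\<phi> s') \<circ> \<phi> s \<circ> R_refl (rho J i) \<in> G"
    using share unfolding share_edge_def by blast
  obtain g where g: "g \<in> D_grp J" "g ` edge J j = edge J i" "f s' = f s \<circ> tau i \<circ> g"
    by (rule shared_edge_reflection[OF similarity_f[OF s(1)] similarity_f[OF s(2)] ij(3,4)])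
  define R where "R = R_refl (rho J i)"
  have tauR: "tau i x = R x + 2 *\<^sub>R nrm i" for x
    by (simp add: R_def R_refl_rho tau_def algebra_simps scaleR_2)
  have RR: "R (R x) = x" for x by (simp add: R_def R_refl_rho inner_diff_left)
  have R0: "R 0 = 0" by (simp add: R_def R_refl_rho)
  note lin = orthogonal_linear[OF \<phi>_orthogonal[OF s(1)]]
  have f_eq: "r *\<^sub>R \<phi> s' x + c s' = r *\<^sub>R \<phi> s (R (g x)) + r *\<^sub>R \<phi> s (2 *\<^sub>R nrm i) + c s" for x
    using fun_cong[OF g(3), of x] f_form[OF s(1)] f_form[OF s(2)]
    by (simp add: tauR linear_add[OF lin] scaleR_add_right)
  have "\<phi> s' 0 = 0" "\<phi> s 0 = 0" "g 0 = 0"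
    using linear_0[OF orthogonal_linear] \<phi>_orthogonal s D_orthogonal[OF g(1)] by blast+
  then have "c s' = r *\<^sub>R \<phi> s (2 *\<^sub>R nrm i) + c s" using f_eq[of 0] R0 by simp
  then have "r *\<^sub>R \<phi> s' x = r *\<^sub>R \<phi> s (R (g x))" for x using f_eq[of x] by simp
  then have eq: "\<phi> s' x = \<phi> s (R (g x))" for x using r_bounds by simp
  define h where "h = finv (\<phi> s') \<circ> \<phi> s \<circ> R"
  have "h \<in> G" using G by (simp add: h_def R_def)
  have "h (g x) = x" for x
  proof -
    have "h (g x) = finv (\<phi> s') (\<phi> s' x)" unfolding h_def eq by simp
    then show ?thesis using orthogonal_transformation_inj[OF \<phi>_orthogonal[OF s(2)]] by simp
  qed
  then have "g x = finv h x" for x using \<open>h \<in> G\<close> by (metis G_inv_left)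
  then have "g \<in> G" using G_inv[OF \<open>h \<in> G\<close>] by (metis ext)
  then show ?thesis using that ij(1) g(3) by blast
qed

text \<open>
  When two first-level cells share a side, cells inside them can be compared after reflecting
  one of the two first-level cells onto the other.
\<close>
lemma unfold_first_letter:
  assumes s: "s \<in> S" "s' \<in> S" and share: "share_edge J G f \<phi> s s'"
    and w: "w \<in> words S n" and v: "v \<in> words S n"
  obtains a u g where "a \<in> ZJ J" "u \<in> words S n" "g \<in> G"
    "fword f (s' # v) = f s \<circ> tau a \<circ> fword f u \<circ> g"
    "fword f (s # w) ` Qpoly J \<inter> fword f (s' # v) ` Qpoly J =
       f s ` (fword f w ` Qpoly J \<inter> fword f u ` Qpoly J \<inter> {x. x \<bullet> nrm a = 1})"
proof -
  obtain a g0 where a: "a \<in> ZJ J" "g0 \<in> G" "f s' = f s \<circ> tau a \<circ> g0"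
    using s share by (rule symbols_sharing_edge)
  obtain u g where u: "u \<in> words S n" "g \<in> G" "g0 \<circ> fword f v = fword f u \<circ> g"
    using G_permutes_words[OF v a(2)] by blast
  have eq: "fword f (s' # v) = f s \<circ> tau a \<circ> fword f u \<circ> g"
    using u(3) by (simp add: a(3) fword_Cons comp_assoc)
  have cap: "X \<inter> tau a ` Y = X \<inter> Y \<inter> {x. x \<bullet> nrm a = 1}" if "X \<subseteq> Qpoly J" "Y \<subseteq> Qpoly J" for X Y
  proof
    show "X \<inter> tau a ` Y \<subseteq> X \<inter> Y \<inter> {x. x \<bullet> nrm a = 1}"
    proof
      fix x assume x: "x \<in> X \<inter> tau a ` Y"
      then obtain y where y: "y \<in> Y" "x = tau a y" by blast
      have "x \<in> edge J a" using x y that Q_inter_tau_Q[of a] by blast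
      then have "x \<bullet> nrm a = 1" by (rule edge_inner_nrm)
      moreover from this have "y \<bullet> nrm a = 1" using y(2) tau_inner[of a y] by simp
      ultimately show "x \<in> X \<inter> Y \<inter> {x. x \<bullet> nrm a = 1}" using x y tau_fixes by auto
    qed
    show "X \<inter> Y \<inter> {x. x \<bullet> nrm a = 1} \<subseteq> X \<inter> tau a ` Y"
      using tau_fixes by (force simp: image_iff)
  qed
  have "fword f (s' # v) ` Qpoly J = f s ` tau a ` fword f u ` g ` Qpoly J"
    unfolding eq by (simp only: image_comp comp_assoc)
  also have "\<dots> = f s ` tau a ` fword f u ` Qpoly J" using G_Q[OF u(2)] by simp
  finally have "fword f (s # w) ` Qpoly J \<inter> fword f (s' # v) ` Qpoly J =
      f s ` (fword f w ` Qpoly J \<inter> tau a ` fword f u ` Qpoly J)"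
    using inj_f[OF s(1)] by (simp add: image_Int)
  also have "\<dots> = f s ` (fword f w ` Qpoly J \<inter> fword f u ` Qpoly J \<inter> {x. x \<bullet> nrm a = 1})"
    unfolding cap[OF fword_Q[OF w] fword_Q[OF u(1)]] ..
  finally show ?thesis using that a(1) u(1,2) eq by blast
qed

lemma shared_edge_off_supporting_edge:
  assumes w: "w \<in> words S n" and u: "u \<in> words S n"
    and cap: "fword f w ` Qpoly J \<inter> fword f u ` Qpoly J = fword f w ` edge J k"
    and ed: "fword f w ` edge J k = fword f u ` edge J l"
  shows "\<not> fword f w ` edge J k \<subseteq> {x. x \<bullet> nrm a = 1}"
proof -
  obtain g where g: "g \<in> D_grp J" "g ` edge J l = edge J k" "fword f u = fword f w \<circ> tau k \<circ> g"
    by (rule shared_edge_reflection[OF similarity_fword[OF w] similarity_fword[OF u] cap ed])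
  show ?thesis
  proof (rule shared_edge_not_in_supporting_line[OF similarity_fword[OF w]])
    show "nrm a \<noteq> 0" by simp
    show "fword f w x \<bullet> nrm a \<le> 1" if "x \<in> Qpoly J" for x
      using fword_Q[OF w] that by (intro Q_inner_nrm_le) blast
    show "fword f w (tau k x) \<bullet> nrm a \<le> 1" if x: "x \<in> Qpoly J" for x
    proof (rule Q_inner_nrm_le)
      obtain y where y: "y \<in> Qpoly J" "x = g y" using D_Q[OF g(1)] x by blast
      then have "fword f w (tau k x) = fword f u y" by (simp add: g(3))
      then show "fword f w (tau k x) \<in> Qpoly J" using fword_Q[OF u] y(1) by auto
    qed
  qed
qed

text \<open>
  By induction on the length of the words.  The essential case is that the first letters differ and
  their cells share a side: reflecting one of these cells onto the other reduces the intersection to that of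
  two cells inside one polygon, cut with one of its sides.  Two equal cells meet the side in a
  face.  For different cells the intersection is a vertex or a side by induction, and a side
  has only an end point on the line, because its two cells cannot both be supported by that line.
\<close>
lemma cells_meet:
  assumes "w \<in> words S n" "v \<in> words S n" "w \<noteq> v" "fword f w ` Qpoly J \<inter> fword f v ` Qpoly J \<noteq> {}"
  shows "(\<exists>i\<in>ZJ J. \<exists>j\<in>ZJ J. fword f w ` Qpoly J \<inter> fword f v ` Qpoly J = fword f w ` edge J i \<and>
             fword f w ` edge J i = fword f v ` edge J j) \<or>
         (\<exists>i\<in>ZJ J. \<exists>j\<in>ZJ J. fword f w ` Qpoly J \<inter> fword f v ` Qpoly J = {fword f w (vert J i)} \<and>
             fword f w (vert J i) = fword f v (vert J j))"
  using assms
proof (induction n arbitrary: w v)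
  case 0 then show ?case by (simp add: words_0)
next
  case (Suc n)
  obtain s w' where w: "w = s # w'" "s \<in> S" "w' \<in> words S n" using Suc.prems by (auto simp: words_Suc_iff)
  obtain s' v' where v: "v = s' # v'" "s' \<in> S" "v' \<in> words S n" using Suc.prems by (auto simp: words_Suc_iff)
  let ?X = "fword f w' ` Qpoly J"
  show ?case
  proof (cases "s = s'")
    case True
    let ?Y = "fword f v' ` Qpoly J"
    have cap: "fword f w ` Qpoly J \<inter> fword f v ` Qpoly J = f s ` (?X \<inter> ?Y)"
      using inj_f[OF w(2)] by (simp add: w v True image_Int)
    have img: "fword f w ` A = f s ` fword f w' ` A" "fword f v ` A = f s ` fword f v' ` A" for A
      by (simp_all add: w v True)
    have "?X \<inter> ?Y \<noteq> {}" using Suc.prems(4) cap by auto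
    moreover have "w' \<noteq> v'" using Suc.prems(3) True w v by auto
    ultimately have "(\<exists>i\<in>ZJ J. \<exists>j\<in>ZJ J. ?X \<inter> ?Y = fword f w' ` edge J i \<and>
             fword f w' ` edge J i = fword f v' ` edge J j) \<or>
         (\<exists>i\<in>ZJ J. \<exists>j\<in>ZJ J. ?X \<inter> ?Y = {fword f w' (vert J i)} \<and>
             fword f w' (vert J i) = fword f v' (vert J j))"
      using Suc.IH[OF w(3) v(3)] by blast
    then show ?thesis
      unfolding cap
    proof (elim disjE bexE conjE, goal_cases)
      case (1 i j)
      then show ?case
        by (intro disjI1 bexI[of _ i] bexI[of _ j] conjI) (simp_all only: w v True fword_Cons_image)
    next
      case (2 i j)
      then show ?case
        by (intro disjI2 bexI[of _ i] bexI[of _ j] conjI)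
           (simp_all only: w v True fword_Cons_apply[of _ _ _ "vert J i"] fword_Cons_apply[of _ _ _ "vert J j"]
             image_insert image_empty)
    qed
  next
    case False
    have sub: "fword f w ` Qpoly J \<subseteq> f s ` Qpoly J" "fword f v ` Qpoly J \<subseteq> f s' ` Qpoly J"
      unfolding w(1) v(1) fword_Cons_image
      using fword_Q[OF w(3)] fword_Q[OF v(3)] by (simp_all add: image_mono)
    have "f s ` Qpoly J \<inter> f s' ` Qpoly J \<noteq> {}"
      using Suc.prems(4) sub by (rule Int_nonempty_mono)
    then consider "share_edge J G f \<phi> s s'" | "share_vertex J f s s'"
      using A4[OF w(2) v(2) False] by blast
    then show ?thesis
    proof cases
      case 2
      then obtain a b where ab: "f s ` Qpoly J \<inter> f s' ` Qpoly J = {f s (vert J a)}" "f s (vert J a) = f s' (vert J b)"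
        unfolding share_vertex_def by blast
      have cap: "fword f w ` Qpoly J \<inter> fword f v ` Qpoly J = {f s (vert J a)}"
        using Suc.prems(4) sub ab(1) by (rule Int_singleton_mono)
      have "f s (vert J a) \<in> f s ` fword f w' ` Qpoly J" "f s' (vert J b) \<in> f s' ` fword f v' ` Qpoly J"
        using cap ab(2) by (auto simp: w v)
      then have "vert J a \<in> fword f w' ` Qpoly J" "vert J b \<in> fword f v' ` Qpoly J"
        using inj_f[OF w(2)] inj_f[OF v(2)] by (simp_all add: inj_image_mem_iff)
      then obtain k l where "k \<in> ZJ J" "vert J a = fword f w' (vert J k)" "l \<in> ZJ J" "vert J b = fword f v' (vert J l)"
        using vertex_of_inscribed_cell similarity_fword fword_Q w(3) v(3) by meson
      then show ?thesis
        using cap ab(2) by (intro disjI2 bexI[of _ k] bexI[of _ l]) (simp_all only: w v fword_Cons_apply[of _ _ _ "vert J k"] fword_Cons_apply[of _ _ _ "vert J l"])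
    next
      case 1
      obtain a u g where a: "a \<in> ZJ J" "u \<in> words S n" "g \<in> G"
        "fword f v = f s \<circ> tau a \<circ> fword f u \<circ> g"
        "fword f w ` Qpoly J \<inter> fword f v ` Qpoly J =
           f s ` (?X \<inter> fword f u ` Qpoly J \<inter> {x. x \<bullet> nrm a = 1})"
        using unfold_first_letter[OF w(2) v(2) 1 w(3) v(3)] unfolding w(1) v(1) by blast
      let ?Y = "fword f u ` Qpoly J"
      let ?I = "?X \<inter> ?Y \<inter> {x. x \<bullet> nrm a = 1}"
      have ne: "?I \<noteq> {}" using Suc.prems(4) a(5) by auto
      have ginv: "finv g \<in> D_grp J" using G_inv[OF a(3)] G_subset_D by blast
      have tau_id: "tau a x = x" if "x \<in> ?I" for x using that tau_fixes by auto
      \<comment> \<open>a point of \<open>?I\<close> that is a vertex of both cells gives the second alternative\<close>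
      have vertex: ?thesis if "?I = {fword f w' (vert J k)}" "fword f w' (vert J k) = fword f u (vert J l)"
          "k \<in> ZJ J" for k l
      proof -
        obtain j where j: "j \<in> ZJ J" "finv g (vert J l) = vert J j" using D_vert[OF ginv] by blast
        have "fword f v (vert J j) = f s (tau a (fword f u (vert J l)))"
          using a(3) by (simp add: a(4) flip: j(2))
        also have "\<dots> = fword f w (vert J k)"
          using that tau_id[of "fword f w' (vert J k)"] by (simp add: w fword_Cons_apply[of _ _ _ "vert J k"])
        finally show ?thesis
          using that a(5) j(1) by (intro disjI2 bexI[of _ k] bexI[of _ j]) (simp_all only: w fword_Cons_apply[of _ _ _ "vert J k"] image_insert image_empty)
      qed
      show ?thesis
      proof (cases "w' = u")
        case True
        obtain x0 where x0: "x0 \<in> ?X" "x0 \<bullet> nrm a = 1" using ne by auto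
        have "nrm a \<noteq> 0" by simp
        moreover have "x \<bullet> nrm a \<le> 1" if "x \<in> ?X" for x
          using fword_Q[OF w(3)] that by (intro Q_inner_nrm_le) blast
        ultimately obtain k where k: "k \<in> ZJ J"
          "{x \<in> ?X. x \<bullet> nrm a = 1} = {fword f w' (vert J k)} \<or> {x \<in> ?X. x \<bullet> nrm a = 1} = fword f w' ` edge J k"
          using similarity_cell_face[OF similarity_fword[OF w(3)], of "nrm a" 1 x0] x0 by blast
        have I: "?I = {x \<in> ?X. x \<bullet> nrm a = 1}" using True by auto
        from k(2) show ?thesis
        proof
          assume "{x \<in> ?X. x \<bullet> nrm a = 1} = {fword f w' (vert J k)}"
          then show ?thesis using vertex[of k k] I True k(1) by simp
        next
          assume e: "{x \<in> ?X. x \<bullet> nrm a = 1} = fword f w' ` edge J k"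
          obtain j where j: "j \<in> ZJ J" "finv g ` edge J k = edge J j" using D_edge[OF ginv] by blast
          have "fword f v ` edge J j = f s ` tau a ` fword f u ` g ` finv g ` edge J k"
            unfolding a(4) j(2)[symmetric] by (simp only: image_comp comp_assoc)
          also have "g ` finv g ` edge J k = edge J k" using a(3) by (simp add: image_image)
          also have "tau a ` fword f u ` edge J k = fword f w' ` edge J k"
          proof -
            have "tau a ` (fword f w' ` edge J k) = (\<lambda>x. x) ` (fword f w' ` edge J k)"
              using tau_id I e by (intro image_cong) auto
            then show ?thesis using True by simp
          qed
          also have "f s ` fword f w' ` edge J k = fword f w ` edge J k" by (simp add: w)
          finally show ?thesis
            using a(5) I e k(1) j(1) by (intro disjI1 bexI[of _ k] bexI[of _ j]) (auto simp: w)
        qed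
      next
        case False
        have "?X \<inter> ?Y \<noteq> {}" using ne by blast
        then consider (e) i j where "i \<in> ZJ J" "j \<in> ZJ J" "?X \<inter> ?Y = fword f w' ` edge J i"
            "fword f w' ` edge J i = fword f u ` edge J j"
          | (v) i j where "i \<in> ZJ J" "j \<in> ZJ J" "?X \<inter> ?Y = {fword f w' (vert J i)}"
            "fword f w' (vert J i) = fword f u (vert J j)"
          using Suc.IH[OF w(3) a(2) False] by blast
        then show ?thesis
        proof cases
          case v
          then have "?I = {fword f w' (vert J i)}" using ne unfolding v(3) by auto
          then show ?thesis using vertex[of i j] v by blast
        next
          case e
          let ?p = "fword f w' (vert J (i - 1))" and ?q = "fword f w' (vert J i)"
          have seg: "fword f w' ` edge J i = closed_segment ?p ?q"
            unfolding edge_def by (rule similarity_segment[OF similarity_fword[OF w(3)]])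
          have "?p \<bullet> nrm a \<le> 1" "?q \<bullet> nrm a \<le> 1"
            using fword_Q[OF w(3)] by (auto intro!: Q_inner_nrm_le)
          moreover obtain z where "z \<in> closed_segment ?p ?q" "z \<bullet> nrm a = 1"
            using ne e(3) seg by blast
          moreover have "\<not> closed_segment ?p ?q \<subseteq> {x. x \<bullet> nrm a = 1}"
            using shared_edge_off_supporting_edge[OF w(3) a(2) e(3,4)] unfolding seg .
          ultimately have "?I = {?p} \<or> ?I = {?q}"
            unfolding e(3) seg by (rule segment_meets_supporting_line)
          moreover have "{?p, ?q} = {fword f u (vert J (j - 1)), fword f u (vert J j)}"
            using similarity_edge_image_eq(1)[OF similarity_fword[OF w(3)] similarity_fword[OF a(2)] e(4)] .
          ultimately obtain k l where "?I = {fword f w' (vert J k)}" "fword f w' (vert J k) = fword f u (vert J l)"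
            by (auto simp: doubleton_eq_iff)
          then show ?thesis
            using vertex[of "k mod int J" l] by (simp add: vert_mod)
        qed
      qed
    qed
  qed
qed

lemma edge_image_not_singleton: "w \<in> words S n \<Longrightarrow> \<not> fword f w ` edge J i \<subseteq> {x}"
  using edge_endpoints_distinct[of i] vert_in_edge[of i] fword_eq_iff[of w n "vert J (i - 1)" "vert J i"]
  by (metis image_subset_iff singletonD)

text \<open>
  A cell is neither one of its own sides nor a point, so it is not the intersection of two different cells.
\<close>
lemma Qcell_inj:
  assumes "w \<in> words S n" "v \<in> words S n" "Qcell J f w = Qcell J f v" shows "w = v"
proof (rule ccontr)
  assume "w \<noteq> v"
  have Q: "fword f w ` Qpoly J \<inter> fword f v ` Qpoly J = fword f w ` Qpoly J"
    using assms(3) by (simp add: Qcell_def)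
  then have "(\<exists>i. fword f w ` Qpoly J = fword f w ` edge J i) \<or> (\<exists>x. fword f w ` Qpoly J = {x})"
    using cells_meet[OF assms(1,2) \<open>w \<noteq> v\<close>] Q_nonempty by auto
  then show False
  proof (elim disjE exE)
    fix i assume "fword f w ` Qpoly J = fword f w ` edge J i"
    then have "Qpoly J = edge J i" using inj_fword[OF assms(1)] by (simp add: inj_image_eq_iff)
    then show False using Q_not_in_line[of i] edge_inner_nrm by force
  next
    fix x assume "fword f w ` Qpoly J = {x}"
    then show False using edge_image_not_singleton[OF assms(1), of 0 x] edge_subset_Q[of 0] by blast
  qed
qed

text \<open>
  If the first letters differ, reflecting in the common side of their cells puts both cells into
  the same polygon with a common side on its boundary.  Different cells with a common side lie on opposite
  sides of it, so the two are equal, and only an element of \<open>G\<close> from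
  \<open>G_permutes_words\<close> remains.
\<close>
lemma shared_edge_in_G:
  assumes "w \<in> words S n" "v \<in> words S n" "w \<noteq> v"
    "fword f w ` Qpoly J \<inter> fword f v ` Qpoly J = fword f w ` edge J i" "i \<in> ZJ J"
  shows "\<exists>g\<in>G. fword f v = fword f w \<circ> tau i \<circ> g"
  using assms
proof (induction n arbitrary: w v)
  case 0 then show ?case by (simp add: words_0)
next
  case (Suc n)
  obtain s w' where w: "w = s # w'" "s \<in> S" "w' \<in> words S n" using Suc.prems by (auto simp: words_Suc_iff)
  obtain s' v' where v: "v = s' # v'" "s' \<in> S" "v' \<in> words S n" using Suc.prems by (auto simp: words_Suc_iff)
  have edw: "fword f w ` edge J i = f s ` fword f w' ` edge J i" by (simp add: w)
  show ?case
  proof (cases "s = s'")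
    case True
    have "f s ` (fword f w' ` Qpoly J \<inter> fword f v' ` Qpoly J) = f s ` (fword f w' ` edge J i)"
      using Suc.prems(4) inj_f[OF w(2)] by (simp add: w v True image_Int)
    then have "fword f w' ` Qpoly J \<inter> fword f v' ` Qpoly J = fword f w' ` edge J i"
      using inj_f[OF w(2)] by (simp add: inj_image_eq_iff)
    moreover have "w' \<noteq> v'" using Suc.prems(3) True w v by auto
    ultimately obtain g where "g \<in> G" "fword f v' = fword f w' \<circ> tau i \<circ> g"
      using Suc.IH[OF w(3) v(3)] Suc.prems(5) by blast
    then show ?thesis by (intro bexI[of _ g]) (simp_all add: w v True fword_Cons comp_assoc)
  next
    case False
    have sub: "fword f w ` Qpoly J \<subseteq> f s ` Qpoly J" "fword f v ` Qpoly J \<subseteq> f s' ` Qpoly J"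
      unfolding w(1) v(1) fword_Cons_image
      using fword_Q[OF w(3)] fword_Q[OF v(3)] by (simp_all add: image_mono)
    have cap_ne: "fword f w ` Qpoly J \<inter> fword f v ` Qpoly J \<noteq> {}"
      unfolding Suc.prems(4) using edge_nonempty[of i] by simp
    have "f s ` Qpoly J \<inter> f s' ` Qpoly J \<noteq> {}"
      using cap_ne sub by (rule Int_nonempty_mono)
    moreover have "\<not> share_vertex J f s s'"
    proof
      assume "share_vertex J f s s'"
      then obtain x where "f s ` Qpoly J \<inter> f s' ` Qpoly J = {x}" unfolding share_vertex_def by blast
      then have "fword f w ` edge J i \<subseteq> {x}"
        using Int_singleton_mono[OF cap_ne sub] Suc.prems(4) by simp
      then show False using edge_image_not_singleton[OF Suc.prems(1)] by blast
    qed
    ultimately have share: "share_edge J G f \<phi> s s'" using A4[OF w(2) v(2) False] by blast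
    let ?X = "fword f w' ` Qpoly J"
    obtain a u g where a: "a \<in> ZJ J" "u \<in> words S n" "g \<in> G"
      "fword f v = f s \<circ> tau a \<circ> fword f u \<circ> g"
      "fword f w ` Qpoly J \<inter> fword f v ` Qpoly J =
         f s ` (?X \<inter> fword f u ` Qpoly J \<inter> {x. x \<bullet> nrm a = 1})"
      using unfold_first_letter[OF w(2) v(2) share w(3) v(3)] unfolding w(1) v(1) by blast
    let ?Y = "fword f u ` Qpoly J"
    have I: "?X \<inter> ?Y \<inter> {x. x \<bullet> nrm a = 1} = fword f w' ` edge J i"
      using a(5) Suc.prems(4) edw inj_f[OF w(2)] by (simp add: inj_image_eq_iff)
    have "w' = u"
    proof (rule ccontr)
      assume "w' \<noteq> u"
      have "?X \<inter> ?Y \<noteq> {}" using I edge_nonempty[of i] by blast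
      then consider (e) k l where "k \<in> ZJ J" "?X \<inter> ?Y = fword f w' ` edge J k"
            "fword f w' ` edge J k = fword f u ` edge J l"
          | (v) x where "?X \<inter> ?Y = {x}"
          using cells_meet[OF w(3) a(2) \<open>w' \<noteq> u\<close>] by blast
      then show False
      proof cases
        case v
        then show False using I edge_image_not_singleton[OF w(3), of i x] by blast
      next
        case e
        have "fword f w' ` edge J i \<subseteq> fword f w' ` edge J k" using I e(2) by blast
        then have "edge J i \<subseteq> edge J k" using inj_fword[OF w(3)] by (simp add: inj_image_subset_iff)
        then have "i = k"
          using edges_meet_once[OF Suc.prems(5) e(1), of "vert J (i - 1)" "vert J i"]
            vert_in_edge(1,2)[of i] edge_endpoints_distinct[of i] by blast
        then show False
          using shared_edge_off_supporting_edge[OF w(3) a(2) e(2,3), of a] I by blast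
      qed
    qed
    have "fword f w' ` edge J i \<subseteq> {x. x \<bullet> nrm a = 1}" using I by blast
    then have "tau a \<circ> fword f w' = fword f w' \<circ> tau i"
      using tau_similarity_commute[OF similarity_fword[OF w(3)]] by auto
    then have "fword f v = fword f w \<circ> tau i \<circ> g"
      unfolding a(4) \<open>w' = u\<close>[symmetric] by (simp add: w fword_Cons fun_eq_iff)
    then show ?thesis using a(3) by blast
  qed
qed

end

section \<open>Connected sets in a graph\<close>

text \<open>
  Connectedness is handled by reflexive transitive closures, which compose more easily than
  lists of vertices.
\<close>
lemma path_within_iff:
  assumes "A \<subseteq> V" "x \<in> A"
  shows "(\<exists>xs. is_path V E xs \<and> set xs \<subseteq> A \<and> hd xs = x \<and> last xs = y) \<longleftrightarrow> (x, y) \<in> (E \<inter> A \<times> A)\<^sup>*"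
proof
  assume "\<exists>xs. is_path V E xs \<and> set xs \<subseteq> A \<and> hd xs = x \<and> last xs = y"
  then obtain xs where "is_path V E xs" "set xs \<subseteq> A" "hd xs = x" "last xs = y" by blast
  then show "(x, y) \<in> (E \<inter> A \<times> A)\<^sup>*"
  proof (induction xs arbitrary: x)
    case (Cons a xs)
    show ?case
    proof (cases xs)
      case Nil then show ?thesis using Cons.prems by simp
    next
      case (Cons b ys)
      then have "(a, b) \<in> E \<inter> A \<times> A" "is_path V E xs"
        using Cons.prems unfolding is_path_def by auto
      moreover have "(b, y) \<in> (E \<inter> A \<times> A)\<^sup>*"
        using Cons.IH[of b] Cons.prems Cons \<open>is_path V E xs\<close> by simp
      ultimately show ?thesis using Cons.prems by (metis converse_rtrancl_into_rtrancl list.sel(1))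
    qed
  qed (simp add: is_path_def)
next
  assume "(x, y) \<in> (E \<inter> A \<times> A)\<^sup>*"
  then show "\<exists>xs. is_path V E xs \<and> set xs \<subseteq> A \<and> hd xs = x \<and> last xs = y"
    using assms(2)
  proof (induction rule: converse_rtrancl_induct)
    case base then show ?case using assms(1) by (intro exI[of _ "[y]"]) (auto simp: is_path_def)
  next
    case (step x z)
    then obtain xs where xs: "is_path V E xs" "set xs \<subseteq> A" "hd xs = z" "last xs = y" by blast
    then show ?case
      using step assms(1)
      by (intro exI[of _ "x # xs"]) (cases xs; auto simp: is_path_def)
  qed
qed

lemma graph_connected_iff:
  "graph_connected V E A \<longleftrightarrow> A \<subseteq> V \<and> (\<forall>x\<in>A. \<forall>y\<in>A. (x, y) \<in> (E \<inter> A \<times> A)\<^sup>*)"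
  unfolding graph_connected_def using path_within_iff[of A V _ E] by blast

lemma graph_connected_Un:
  assumes A: "graph_connected V E A" and B: "graph_connected V E B" and "sym E"
    and ab: "a \<in> A" "b \<in> B" "a = b \<or> (a, b) \<in> E"
  shows "graph_connected V E (A \<union> B)"
proof -
  let ?E = "E \<inter> (A \<union> B) \<times> (A \<union> B)"
  have mono: "(x, y) \<in> (E \<inter> C \<times> C)\<^sup>* \<Longrightarrow> (x, y) \<in> ?E\<^sup>*" if "C \<subseteq> A \<union> B" for x y C
    using that rtrancl_mono[of "E \<inter> C \<times> C" ?E] by blast
  have "sym ?E" using \<open>sym E\<close> by (auto simp: sym_def)
  then have symm: "(x, y) \<in> ?E\<^sup>* \<Longrightarrow> (y, x) \<in> ?E\<^sup>*" for x y by (meson sym_rtrancl symD)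
  have "(a, b) \<in> ?E\<^sup>*" using ab by auto
  moreover have "(x, a) \<in> ?E\<^sup>*" if "x \<in> A" for x
    using A ab(1) that mono[of A] unfolding graph_connected_iff by blast
  moreover have "(b, x) \<in> ?E\<^sup>*" if "x \<in> B" for x
    using B ab(2) that mono[of B] unfolding graph_connected_iff by blast
  ultimately have to_b: "(x, b) \<in> ?E\<^sup>*" if "x \<in> A \<union> B" for x
    using that symm by (meson Un_iff rtrancl_trans)
  have "(x, y) \<in> ?E\<^sup>*" if "x \<in> A \<union> B" "y \<in> A \<union> B" for x y
    using to_b[OF that(1)] symm[OF to_b[OF that(2)]] by (rule rtrancl_trans)
  then show ?thesis using A B unfolding graph_connected_iff by blast
qed

lemma graph_connected_image:
  assumes A: "graph_connected V E A" and V: "\<And>x. x \<in> V \<Longrightarrow> h x \<in> V'"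
    and E: "\<And>x y. (x, y) \<in> E \<Longrightarrow> (h x, h y) \<in> E'"
  shows "graph_connected V' E' (h ` A)"
proof -
  have "(h x, h y) \<in> (E' \<inter> h ` A \<times> h ` A)\<^sup>*" if "(x, y) \<in> (E \<inter> A \<times> A)\<^sup>*" for x y
    using that
  proof (induction rule: rtrancl_induct)
    case (step y z)
    then have "(h y, h z) \<in> E' \<inter> h ` A \<times> h ` A" using E by auto
    then show ?case using step.IH by (rule rtrancl_into_rtrancl[rotated])
  qed simp
  then show ?thesis using A V unfolding graph_connected_iff by blast
qed

context polygon_system
begin

lemma images_meetE:
  assumes "F ` A \<inter> H ` B \<noteq> {}" obtains a b where "a \<in> A" "b \<in> B" "F a = H b"
  using assms by auto

section \<open>The action of the symmetry group on words\<close>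

abbreviation act :: "(real ^ 2 \<Rightarrow> real ^ 2) \<Rightarrow> 's list \<Rightarrow> 's list" where
  "act \<equiv> act_word J S f"

lemma act_eqI:
  assumes "w \<in> words S n" "v \<in> words S n" "g ` Qcell J f w = Qcell J f v" shows "act g w = v"
  unfolding act_word_def
proof (rule the_equality)
  show "v \<in> words S (length w) \<and> g ` Qcell J f w = Qcell J f v"
    using assms by (simp add: words_length)
  show "u = v" if "u \<in> words S (length w) \<and> g ` Qcell J f w = Qcell J f u" for u
    using that assms by (intro Qcell_inj[of u n v]) (auto simp: words_length)
qed

text \<open>
  The cell of \<open>act g w\<close> is the image of the cell of \<open>w\<close>; the element \<open>g'\<close> records how
  the two parametrisations of that cell differ.
\<close>
lemma act_fword:
  assumes "g \<in> G" "w \<in> words S n"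
  shows "act g w \<in> words S n" "\<exists>g'\<in>G. g \<circ> fword f w = fword f (act g w) \<circ> g'"
proof -
  obtain v g' where v: "v \<in> words S n" "g' \<in> G" "g \<circ> fword f w = fword f v \<circ> g'"
    using G_permutes_words[OF assms(2,1)] by blast
  have "g ` Qcell J f w = (g \<circ> fword f w) ` Qpoly J" by (simp add: Qcell_def image_comp)
  also have "\<dots> = fword f v ` g' ` Qpoly J" unfolding v(3) by (rule image_comp[symmetric])
  finally have "g ` Qcell J f w = Qcell J f v" by (simp add: Qcell_def G_Q[OF v(2)])
  then have "act g w = v" using act_eqI assms(2) v(1) by blast
  then show "act g w \<in> words S n" "\<exists>g'\<in>G. g \<circ> fword f w = fword f (act g w) \<circ> g'" using v by auto
qed

lemma act_Qcell:
  assumes "g \<in> G" "w \<in> words S n" shows "Qcell J f (act g w) = g ` Qcell J f w"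
proof -
  obtain g' where g': "g' \<in> G" "g \<circ> fword f w = fword f (act g w) \<circ> g'" using act_fword(2)[OF assms] by blast
  have "g ` Qcell J f w = (g \<circ> fword f w) ` Qpoly J" by (simp add: Qcell_def image_comp)
  also have "\<dots> = fword f (act g w) ` g' ` Qpoly J" unfolding g'(2) by (rule image_comp[symmetric])
  finally show ?thesis by (simp add: Qcell_def G_Q[OF g'(1)])
qed

lemma act_id: "w \<in> words S n \<Longrightarrow> act id w = w"
  by (rule act_eqI) auto

lemma act_comp:
  assumes "g \<in> G" "h \<in> G" "w \<in> words S n" shows "act (g \<circ> h) w = act g (act h w)"
proof (rule act_eqI[OF assms(3)])
  show "act g (act h w) \<in> words S n" using assms act_fword(1) by blast
  show "(g \<circ> h) ` Qcell J f w = Qcell J f (act g (act h w))"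
    unfolding act_Qcell[OF assms(1) act_fword(1)[OF assms(2,3)]] act_Qcell[OF assms(2,3)]
    by (rule image_comp[symmetric])
qed

lemma act_inv:
  assumes "g \<in> G" "w \<in> words S n" shows "act (finv g) (act g w) = w" "act g (act (finv g) w) = w"
proof -
  have "finv g \<circ> g = id" "g \<circ> finv g = id" using assms(1) by auto
  then show "act (finv g) (act g w) = w" "act g (act (finv g) w) = w"
    using act_comp[OF G_inv[OF assms(1)] assms] act_comp[OF assms(1) G_inv[OF assms(1)] assms(2)] act_id[OF assms(2)]
    by simp_all
qed

text \<open>
  The affine hull of the common side is the line of side \<open>i\<close> of the first cell, so \<open>g_cross\<close> is the
  element found in \<open>shared_edge_in_G\<close>.
\<close>
lemma g_cross_fold:
  assumes "w \<in> words S n" "v \<in> words S n" "w \<noteq> v" "i \<in> ZJ J" "Qcell J f w \<inter> Qcell J f v = edge_cell J f i w"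
  shows "g_cross J f w v \<in> G" "fword f v = fword f w \<circ> tau i \<circ> g_cross J f w v"
proof -
  obtain g where g: "g \<in> G" "fword f v = fword f w \<circ> tau i \<circ> g"
    using shared_edge_in_G[OF assms(1-3) _ assms(4)] assms(5) by (auto simp: Qcell_def edge_cell_def)
  have "g_cross J f w v x = g x" for x
  proof -
    have "g_cross J f w v x = finv (fword f w) (fword f w (tau i (tau i (g x))))"
      unfolding g_cross_def assms(5) edge_cell_def comp_apply g(2)
      by (simp only: reflect_in_edge_line[OF similarity_fword[OF assms(1)]] comp_apply)
    then show ?thesis using inj_fword[OF assms(1)] by simp
  qed
  then have "g_cross J f w v = g" by auto
  then show "g_cross J f w v \<in> G" "fword f v = fword f w \<circ> tau i \<circ> g_cross J f w v" using g by auto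
qed

section \<open>The self-similar set\<close>

definition level_union :: "nat \<Rightarrow> (real ^ 2) set" where
  "level_union n = (\<Union>w\<in>words S n. fword f w ` Qpoly J)"

lemma level_union_0: "level_union 0 = Qpoly J"
  by (simp add: level_union_def words_0)

lemma level_union_Suc: "level_union (Suc n) = (\<Union>s\<in>S. f s ` level_union n)"
proof
  show "level_union (Suc n) \<subseteq> (\<Union>s\<in>S. f s ` level_union n)"
  proof
    fix x assume "x \<in> level_union (Suc n)"
    then obtain w' where "w' \<in> words S (Suc n)" "x \<in> fword f w' ` Qpoly J"
      unfolding level_union_def by blast
    then obtain s w where "s \<in> S" "w \<in> words S n" "x \<in> fword f (s # w) ` Qpoly J"
      unfolding words_Suc_iff by blast
    then show "x \<in> (\<Union>s\<in>S. f s ` level_union n)"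
      unfolding level_union_def fword_Cons_image by blast
  qed
  show "(\<Union>s\<in>S. f s ` level_union n) \<subseteq> level_union (Suc n)"
  proof
    fix x assume "x \<in> (\<Union>s\<in>S. f s ` level_union n)"
    then obtain s w where "s \<in> S" "w \<in> words S n" "x \<in> f s ` fword f w ` Qpoly J"
      unfolding level_union_def by blast
    then have "s # w \<in> words S (Suc n)" "x \<in> fword f (s # w) ` Qpoly J"
      by (simp_all add: words_Suc_iff)
    then show "x \<in> level_union (Suc n)" unfolding level_union_def by blast
  qed
qed

lemma level_union_antimono: "m \<le> n \<Longrightarrow> level_union n \<subseteq> level_union m"
proof (rule lift_Suc_antimono_le)
  show "level_union (Suc n) \<subseteq> level_union n" for n
  proof (induction n)
    case 0 then show ?case using f_Q by (auto simp: level_union_Suc level_union_0)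
  next
    case (Suc n)
    then show ?case unfolding level_union_Suc[of "Suc n"] level_union_Suc[of n] by blast
  qed
qed

lemma compact_level_union: "compact (level_union n)"
proof -
  have "continuous_on UNIV (fword f w)" if "w \<in> words S n" for w
    using similarity_fword[OF that]
    by (intro lipschitz_on_continuous_on[of "r ^ n"] lipschitz_onI) (auto simp: similarity_def)
  then show ?thesis
    unfolding level_union_def using finite_words[OF finite_S] compact_Q
    by (intro compact_UN ballI compact_continuous_image) (auto intro: continuous_on_subset)
qed

text \<open>
  The nested unions of cells shrink to the self-similar set.  This description makes it visible that the set
  is \<open>G\<close>-invariant and meets every side.
\<close>
definition attractor :: "(real ^ 2) set" where
  "attractor = (\<Inter>n. level_union n)"

lemma compact_attractor: "compact attractor"
  unfolding attractor_def by (rule compact_Inter) (auto simp: compact_level_union)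

lemma edge_has_subcell_edges: "i \<in> ZJ J \<Longrightarrow> \<exists>w\<in>words S n. \<exists>j\<in>ZJ J. fword f w ` edge J j \<subseteq> edge J i"
proof (induction n arbitrary: i)
  case 0 then show ?case by (auto simp: words_0)
next
  case (Suc n)
  obtain s j where s: "s \<in> S" "j \<in> ZJ J" "f s ` edge J j \<subseteq> edge J i" using A2[OF Suc.prems] by blast
  obtain w k where w: "w \<in> words S n" "k \<in> ZJ J" "fword f w ` edge J k \<subseteq> edge J j"
    using Suc.IH[OF s(2)] by blast
  have "fword f (s # w) ` edge J k \<subseteq> edge J i" using s(3) w(3) by (simp add: image_mono order_trans[of _ "f s ` edge J j"])
  moreover have "s # w \<in> words S (Suc n)" using s(1) w(1) by (simp add: words_Suc_iff)
  ultimately show ?case using w(2) by blast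
qed

text \<open>
  Every side contains a side of some cell of each level, so the side meets all level unions, and compactness gives a
  common point.
\<close>
lemma attractor_meets_edges:
  assumes "i \<in> ZJ J" shows "edge J i \<inter> attractor \<noteq> {}"
proof -
  have "\<Inter>(range (\<lambda>n. edge J i \<inter> level_union n)) \<noteq> {}"
  proof (rule compact_nest)
    show "compact (edge J i \<inter> level_union n)" for n
      by (intro compact_Int compact_level_union) (simp add: edge_def)
    show "edge J i \<inter> level_union n \<noteq> {}" for n
    proof -
      obtain w j where w: "w \<in> words S n" "fword f w ` edge J j \<subseteq> edge J i"
        using edge_has_subcell_edges[OF assms] by blast
      have "fword f w (vert J j) \<in> edge J i" using w(2) by auto
      moreover have "fword f w (vert J j) \<in> level_union n"
        unfolding level_union_def using w(1) vert_in_Q[of j] by blast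
      ultimately show ?thesis by blast
    qed
    show "edge J i \<inter> level_union n \<subseteq> edge J i \<inter> level_union m" if "m \<le> n" for m n
      using level_union_antimono[OF that] by blast
  qed
  then show ?thesis by (auto simp: attractor_def)
qed

lemma attractor_nonempty: "attractor \<noteq> {}"
  using attractor_meets_edges[of 0] by (auto simp: ZJ_iff)

text \<open>
  For the inclusion from left to right a single letter has to serve for all levels.  If every letter failed at some
  level, then all of the finitely many letters would fail at the largest of these levels.
\<close>
lemma attractor_self_similar: "attractor = (\<Union>s\<in>S. f s ` attractor)"
proof
  show "(\<Union>s\<in>S. f s ` attractor) \<subseteq> attractor"
  proof -
    have "(\<Union>s\<in>S. f s ` attractor) \<subseteq> level_union (Suc n)" for n
      unfolding level_union_Suc by (auto simp: attractor_def)
    then show ?thesis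
      using level_union_antimono[of _ "Suc _"] unfolding attractor_def
      by (meson INT_greatest le_SucI order_refl order_trans)
  qed
  show "attractor \<subseteq> (\<Union>s\<in>S. f s ` attractor)"
  proof
    fix x assume x: "x \<in> attractor"
    have "\<exists>s\<in>S. \<forall>n. x \<in> f s ` level_union n"
    proof (rule ccontr)
      assume "\<not> (\<exists>s\<in>S. \<forall>n. x \<in> f s ` level_union n)"
      then obtain N where N: "\<forall>s\<in>S. x \<notin> f s ` level_union (N s)" by metis
      define M where "M = (if S = {} then 0 else Max (N ` S))"
      have "x \<in> level_union (Suc M)" using x by (auto simp: attractor_def)
      then obtain s where s: "s \<in> S" "x \<in> f s ` level_union M" unfolding level_union_Suc by blast
      then have "N s \<le> M" using finite_S by (auto simp: M_def)
      then have "level_union M \<subseteq> level_union (N s)" by (rule level_union_antimono)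
      then show False using N s by blast
    qed
    then obtain s where s: "s \<in> S" "\<And>n. x \<in> f s ` level_union n" by blast
    obtain y where y: "x = f s y" using s(2)[of 0] by blast
    have "y \<in> level_union n" for n
      using s(2)[of n] inj_f[OF s(1)] unfolding y by (simp add: inj_image_mem_iff)
    then show "x \<in> (\<Union>s\<in>S. f s ` attractor)" using s(1) y by (auto simp: attractor_def)
  qed
qed

text \<open>The distance to one invariant set, maximised over the other, shrinks by the factor \<open>r\<close>.\<close>
lemma invariant_compact_subset:
  assumes A: "compact A" "A \<noteq> {}" "A = (\<Union>s\<in>S. f s ` A)"
    and B: "compact B" "B \<noteq> {}" "B = (\<Union>s\<in>S. f s ` B)"
  shows "A \<subseteq> B"
proof -
  have "continuous_on A (\<lambda>x. infdist x B)" by (intro continuous_intros)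
  then obtain x where x: "x \<in> A" "\<And>a. a \<in> A \<Longrightarrow> infdist a B \<le> infdist x B"
    using continuous_attains_sup[OF A(1,2)] by metis
  obtain s y where y: "s \<in> S" "y \<in> A" "x = f s y" using x(1) A(3) by blast
  obtain b where b: "b \<in> B" "infdist y B = dist y b"
    using infdist_attains_inf[OF compact_imp_closed[OF B(1)] B(2)] by metis
  have "f s b \<in> B" using B(3) y(1) b(1) by blast
  then have "infdist x B \<le> dist x (f s b)" by (rule infdist_le)
  also have "\<dots> = r * infdist y B" using similarity_f[OF y(1)] by (simp add: similarity_def y(3) b(2))
  also have "\<dots> \<le> r * infdist x B" using x(2)[OF y(2)] r_bounds by (intro mult_left_mono) auto
  finally have "(1 - r) * infdist x B \<le> 0" by (simp add: algebra_simps)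
  then have "infdist x B \<le> 0" using r_bounds by (simp add: mult_le_0_iff)
  then have "infdist a B = 0" if "a \<in> A" for a using x(2)[OF that] infdist_nonneg[of a B] by linarith
  then show ?thesis
    using in_closed_iff_infdist_zero[OF compact_imp_closed[OF B(1)] B(2)] by blast
qed

lemma Kset_eq: "Kset S f = attractor"
  unfolding Kset_def
proof (rule the_equality)
  show "attractor \<noteq> {} \<and> compact attractor \<and> attractor = (\<Union>s\<in>S. f s ` attractor)"
    using attractor_nonempty compact_attractor attractor_self_similar by blast
  show "K = attractor" if "K \<noteq> {} \<and> compact K \<and> K = (\<Union>s\<in>S. f s ` K)" for K
    using that invariant_compact_subset attractor_nonempty compact_attractor attractor_self_similar
    by (metis subset_antisym)
qed

lemma K_subset_Q: "Kset S f \<subseteq> Qpoly J"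
  unfolding Kset_eq attractor_def using level_union_0 by blast

lemma G_level_union: assumes "g \<in> G" shows "g ` level_union n \<subseteq> level_union n"
proof
  fix x assume "x \<in> g ` level_union n"
  then obtain w where w: "w \<in> words S n" "x \<in> g ` Qcell J f w"
    by (auto simp: level_union_def Qcell_def)
  then have "x \<in> Qcell J f (act g w)" using act_Qcell[OF assms] by blast
  then show "x \<in> level_union n"
    using act_fword(1)[OF assms w(1)] by (auto simp: level_union_def Qcell_def)
qed

lemma G_K: assumes "g \<in> G" shows "g ` Kset S f = Kset S f"
proof -
  have sub: "g ` attractor \<subseteq> attractor" if "g \<in> G" for g
    using G_level_union[OF that] unfolding attractor_def by blast
  have "attractor = g ` finv g ` attractor" using assms by (simp add: image_image)
  also have "\<dots> \<subseteq> g ` attractor" using sub[OF G_inv[OF assms]] by (rule image_mono)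
  finally show ?thesis using sub[OF assms] unfolding Kset_eq by blast
qed

lemma Kcell_append: "Kcell S f (w @ v) = fword f w ` Kcell S f v"
  by (simp add: Kcell_def fword_append image_comp)

lemma Kcell_subset_K: "w \<in> words S n \<Longrightarrow> Kcell S f w \<subseteq> Kset S f"
proof (induction n arbitrary: w)
  case 0 then show ?case by (simp add: words_0 Kcell_def)
next
  case (Suc n)
  then obtain s w' where w: "w = s # w'" "s \<in> S" "w' \<in> words S n" by (auto simp: words_Suc_iff)
  have "Kcell S f w = f s ` Kcell S f w'" by (simp add: w(1) Kcell_def)
  also have "\<dots> \<subseteq> f s ` Kset S f" using Suc.IH[OF w(3)] by (rule image_mono)
  also have "\<dots> \<subseteq> Kset S f" using attractor_self_similar w(2) unfolding Kset_eq by blast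
  finally show ?case .
qed

lemma act_Kcell:
  assumes "g \<in> G" "w \<in> words S n" shows "Kcell S f (act g w) = g ` Kcell S f w"
proof -
  obtain g' where g': "g' \<in> G" "g \<circ> fword f w = fword f (act g w) \<circ> g'" using act_fword(2)[OF assms] by blast
  have "g ` Kcell S f w = (g \<circ> fword f w) ` Kset S f" by (simp add: Kcell_def image_comp)
  also have "\<dots> = fword f (act g w) ` g' ` Kset S f" unfolding g'(2) by (rule image_comp[symmetric])
  finally show ?thesis by (simp add: Kcell_def G_K[OF g'(1)])
qed

section \<open>Crossing from one cell into a neighbouring cell\<close>

lemma sym_E_star: "sym (E_star S f n)"
  by (auto simp: sym_def E_star_def)

lemma E_star_act:
  assumes "g \<in> G" "(w, v) \<in> E_star S f n" shows "(act g w, act g v) \<in> E_star S f n"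
proof -
  have w: "w \<in> words S n" "v \<in> words S n" "w \<noteq> v" "Kcell S f w \<inter> Kcell S f v \<noteq> {}"
    using assms(2) by (auto simp: E_star_def)
  have "act g w \<noteq> act g v" using act_inv(1)[OF assms(1)] w(1-3) by metis
  moreover have "Kcell S f (act g w) \<inter> Kcell S f (act g v) \<noteq> {}"
    using w(4) unfolding act_Kcell[OF assms(1) w(1)] act_Kcell[OF assms(1) w(2)] by blast
  ultimately show ?thesis using act_fword(1)[OF assms(1)] w(1,2) by (simp add: E_star_def)
qed

lemma connected_act:
  assumes "g \<in> G" "graph_connected (words S m) (E_star S f m) A"
  shows "graph_connected (words S m) (E_star S f m) (act g ` A)"
  using assms(2) act_fword(1)[OF assms(1)] E_star_act[OF assms(1)] by (rule graph_connected_image)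

lemma finite_bdry [simp]: "finite (bdry J S f A)"
  by (simp add: bdry_def)

lemma bdry_mono: "A \<subseteq> B \<Longrightarrow> bdry J S f A \<subseteq> bdry J S f B"
  by (auto simp: bdry_def)

lemma bdry_act:
  assumes "g \<in> G" "A \<subseteq> words S m" "e' \<in> bdry J S f A" "e \<in> ZJ J" "g ` edge J e' = edge J e"
  shows "e \<in> bdry J S f (act g ` A)"
proof -
  obtain w x where w: "w \<in> A" "x \<in> edge J e'" "x \<in> Kcell S f w" using assms(3) by (auto simp: bdry_def)
  have "g x \<in> edge J e" using w(2) assms(5) by blast
  moreover have "g x \<in> Kcell S f (act g w)" using act_Kcell[OF assms(1)] w assms(2) by blast
  ultimately show ?thesis using assms(4) w(1) by (auto simp: bdry_def)
qed

lemma ZJe_iff: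
  "e \<in> ZJe J G S f \<longleftrightarrow> e \<in> ZJ J \<and> (\<exists>g\<in>G. \<exists>i\<in>ZJ J. g ` edge J i = edge J e \<and>
     (\<exists>n. \<exists>w\<in>words S n. \<exists>v\<in>words S n. w \<noteq> v \<and> Qcell J f w \<inter> Qcell J f v = edge_cell J f i w))"
proof
  assume "e \<in> ZJe J G S f"
  then obtain g i where *: "e = act_index J g i" "g \<in> G" "i \<in> ZJ J"
     "\<exists>n. \<exists>w\<in>words S n. \<exists>v\<in>words S n. w \<noteq> v \<and> Qcell J f w \<inter> Qcell J f v = edge_cell J f i w"
    unfolding ZJe_def by blast
  obtain k where k: "k \<in> ZJ J" "g ` edge J i = edge J k" using D_edge G_subset_D *(2) by blast
  then have "e = k" using act_index_eqI *(1) by blast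
  then show "e \<in> ZJ J \<and> (\<exists>g\<in>G. \<exists>i\<in>ZJ J. g ` edge J i = edge J e \<and>
     (\<exists>n. \<exists>w\<in>words S n. \<exists>v\<in>words S n. w \<noteq> v \<and> Qcell J f w \<inter> Qcell J f v = edge_cell J f i w))"
    using * k by blast
next
  assume "e \<in> ZJ J \<and> (\<exists>g\<in>G. \<exists>i\<in>ZJ J. g ` edge J i = edge J e \<and>
     (\<exists>n. \<exists>w\<in>words S n. \<exists>v\<in>words S n. w \<noteq> v \<and> Qcell J f w \<inter> Qcell J f v = edge_cell J f i w))"
  then obtain g i where *: "e \<in> ZJ J" "g \<in> G" "i \<in> ZJ J" "g ` edge J i = edge J e"
     "\<exists>n. \<exists>w\<in>words S n. \<exists>v\<in>words S n. w \<noteq> v \<and> Qcell J f w \<inter> Qcell J f v = edge_cell J f i w" by blast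
  then have "e = act_index J g i" using act_index_eqI[of e g i] by simp
  then show "e \<in> ZJe J G S f" unfolding ZJe_def using *(2,3,5) by blast
qed

lemma ZJe_crossing:
  assumes "w \<in> words S n" "v \<in> words S n" "w \<noteq> v" "i \<in> ZJ J" "Qcell J f w \<inter> Qcell J f v = edge_cell J f i w"
  shows "i \<in> ZJe J G S f"
  unfolding ZJe_iff using assms G_id by (intro conjI bexI[of _ id] bexI[of _ i]) auto

lemma ZJe_act:
  assumes "e' \<in> ZJe J G S f" "g \<in> G" "e \<in> ZJ J" "g ` edge J e' = edge J e"
  shows "e \<in> ZJe J G S f"
proof -
  obtain h i where h: "h \<in> G" "i \<in> ZJ J" "h ` edge J i = edge J e'"
     "\<exists>n. \<exists>w\<in>words S n. \<exists>v\<in>words S n. w \<noteq> v \<and> Qcell J f w \<inter> Qcell J f v = edge_cell J f i w"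
    using assms(1) unfolding ZJe_iff by blast
  have "(g \<circ> h) ` edge J i = edge J e" unfolding assms(4)[symmetric] h(3)[symmetric] by (rule image_comp[symmetric])
  then show ?thesis unfolding ZJe_iff using G_comp[OF assms(2) h(1)] h(2,4) assms(3) by blast
qed

lemma sym_E_line: "sym (E_line J S f n)"
  unfolding sym_def E_line_def by (auto simp: Int_commute)

text \<open>
  The index of the side in the second cell is obtained by applying the inverse of \<open>g_cross\<close>.
\<close>
lemma E_line_iff:
  "(w, v) \<in> E_line J S f n \<longleftrightarrow> w \<in> words S n \<and> v \<in> words S n \<and> w \<noteq> v \<and>
     (\<exists>i\<in>ZJ J. Qcell J f w \<inter> Qcell J f v = edge_cell J f i w)"
proof
  assume a: "w \<in> words S n \<and> v \<in> words S n \<and> w \<noteq> v \<and>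
     (\<exists>i\<in>ZJ J. Qcell J f w \<inter> Qcell J f v = edge_cell J f i w)"
  then obtain i where i: "i \<in> ZJ J" "Qcell J f w \<inter> Qcell J f v = edge_cell J f i w" by blast
  let ?g = "g_cross J f w v"
  have g: "?g \<in> G" "fword f v = fword f w \<circ> tau i \<circ> ?g" using g_cross_fold[OF _ _ _ i] a by blast+
  obtain j where j: "j \<in> ZJ J" "finv ?g ` edge J i = edge J j"
    using D_edge G_inv[OF g(1)] G_subset_D by blast
  have "edge_cell J f j v = fword f w ` tau i ` ?g ` finv ?g ` edge J i"
    unfolding edge_cell_def j(2)[symmetric] by (subst g(2)) (simp only: image_comp comp_assoc)
  also have "?g ` finv ?g ` edge J i = edge J i" using g(1) by (simp add: image_image)
  also have "fword f w ` tau i ` edge J i = edge_cell J f i w" by (simp add: tau_edge edge_cell_def)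
  finally show "(w, v) \<in> E_line J S f n" using a i j(1) by (auto simp: E_line_def)
qed (auto simp: E_line_def)

text \<open>
  A point of the self-similar set on the side \<open>i\<close> is fixed by the reflection that
  exchanges the two cells, and \<open>G\<close> preserves the set; so its image lies in both small copies.
\<close>
lemma E_line_subset_E_star: "E_line J S f n \<subseteq> E_star S f n"
proof clarify
  fix w v assume "(w, v) \<in> E_line J S f n"
  then obtain i where w: "w \<in> words S n" "v \<in> words S n" "w \<noteq> v" and
    i: "i \<in> ZJ J" "Qcell J f w \<inter> Qcell J f v = edge_cell J f i w" unfolding E_line_iff by blast
  let ?g = "g_cross J f w v"
  have g: "?g \<in> G" "fword f v = fword f w \<circ> tau i \<circ> ?g" using g_cross_fold[OF w i] by blast+
  obtain x where x: "x \<in> edge J i" "x \<in> Kset S f" using attractor_meets_edges[OF i(1)] unfolding Kset_eq by blast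
  have "finv ?g x \<in> Kset S f" using G_K[OF G_inv[OF g(1)]] x(2) by blast
  moreover have "fword f v (finv ?g x) = fword f w x"
    using x(1) edge_inner_nrm tau_fixes g(1) by (subst g(2)) simp
  ultimately have "fword f w x \<in> Kcell S f w \<inter> Kcell S f v" using x(2) unfolding Kcell_def by (metis IntI imageI)
  then show "(w, v) \<in> E_star S f n" using w by (auto simp: E_star_def)
qed

text \<open>
  A block is a pair of a word of length \<open>n\<close> and a set of words of length \<open>m\<close>, standing for the cells
  of level \<open>n + m\<close> in it.  Linked blocks lie in different cells and contain smaller cells that meet.
\<close>
definition linked :: "nat \<Rightarrow> nat \<Rightarrow> 's list \<times> 's list set \<Rightarrow> 's list \<times> 's list set \<Rightarrow> bool" where
  "linked n m p q \<longleftrightarrow> fst p \<in> words S n \<and> fst q \<in> words S n \<and> fst p \<noteq> fst q \<and>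
     snd p \<subseteq> words S m \<and> snd q \<subseteq> words S m \<and>
     (\<exists>x\<in>snd p. \<exists>y\<in>snd q. Kcell S f (fst p @ x) \<inter> Kcell S f (fst q @ y) \<noteq> {})"

lemma linked_sym: "linked n m p q \<Longrightarrow> linked n m q p"
  unfolding linked_def by (metis Int_commute)

text \<open>
  A point of the crossing lies on the common side, so it is fixed by the reflection.  In the coordinates of the
  first cell it belongs to a small cell of \<open>X\<close> and to the folded image of a small cell of \<open>Y\<close>.
\<close>
lemma linked_edge:
  assumes "linked n m (w, X) (v, Y)" "i \<in> ZJ J" "Qcell J f w \<inter> Qcell J f v = edge_cell J f i w"
  shows "i \<in> bdry J S f X" "\<exists>x\<in>X. \<exists>y\<in>Y. Kcell S f x \<inter> Kcell S f (act (g_cross J f w v) y) \<noteq> {}"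
proof -
  have w: "w \<in> words S n" "v \<in> words S n" "w \<noteq> v" "X \<subseteq> words S m" "Y \<subseteq> words S m"
    using assms(1) by (auto simp: linked_def)
  obtain x y where xy: "x \<in> X" "y \<in> Y" "Kcell S f (w @ x) \<inter> Kcell S f (v @ y) \<noteq> {}"
    using assms(1) by (auto simp: linked_def)
  have xw: "x \<in> words S m" "y \<in> words S m" using xy w by auto
  obtain \<zeta> \<eta> where z: "\<zeta> \<in> Kcell S f x" "\<eta> \<in> Kcell S f y" "fword f w \<zeta> = fword f v \<eta>"
    using xy(3) unfolding Kcell_append by (elim images_meetE)
  have Q: "\<zeta> \<in> Qpoly J" "\<eta> \<in> Qpoly J"
    using z Kcell_subset_K[OF xw(1)] Kcell_subset_K[OF xw(2)] K_subset_Q by auto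
  then have "fword f w \<zeta> \<in> Qcell J f w \<inter> Qcell J f v"
    using z(3) unfolding Qcell_def by (metis IntI imageI)
  then have "fword f w \<zeta> \<in> fword f w ` edge J i" unfolding assms(3) edge_cell_def .
  then have edge: "\<zeta> \<in> edge J i" using inj_fword[OF w(1)] by (simp add: inj_image_mem_iff)
  then show "i \<in> bdry J S f X" using z(1) xy(1) assms(2) by (auto simp: bdry_def)
  let ?g = "g_cross J f w v"
  have g: "?g \<in> G" "fword f v = fword f w \<circ> tau i \<circ> ?g" using g_cross_fold[OF w(1-3) assms(2,3)] by blast+
  have "fword f w \<zeta> = fword f w (tau i (?g \<eta>))" using z(3) fun_cong[OF g(2), of \<eta>] by simp
  then have "tau i \<zeta> = ?g \<eta>" using fword_eq_iff[OF w(1)] by simp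
  then have "?g \<eta> = \<zeta>" using edge edge_inner_nrm tau_fixes by simp
  then have "\<zeta> \<in> Kcell S f (act ?g y)" using act_Kcell[OF g(1) xw(2)] z(2) by blast
  then show "\<exists>x\<in>X. \<exists>y\<in>Y. Kcell S f x \<inter> Kcell S f (act ?g y) \<noteq> {}" using xy z(1) by blast
qed

text \<open>
  If there is no common side the whole crossing takes place at one vertex, and both blocks touch all
  sides at that vertex.
\<close>
lemma linked_vertex:
  assumes "linked n m (w, X) (v, Y)" "(w, v) \<notin> E_line J S f n"
  obtains i j where "i \<in> ZJ J" "j \<in> ZJ J" "fword f w (vert J i) = fword f v (vert J j)"
    "vert J i \<in> Kset S f" "vert J j \<in> Kset S f"
    "{e \<in> ZJ J. vert J i \<in> edge J e} \<subseteq> bdry J S f X" "{e \<in> ZJ J. vert J j \<in> edge J e} \<subseteq> bdry J S f Y"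
proof -
  have w: "w \<in> words S n" "v \<in> words S n" "w \<noteq> v" "X \<subseteq> words S m" "Y \<subseteq> words S m"
    using assms(1) by (auto simp: linked_def)
  obtain x y where xy: "x \<in> X" "y \<in> Y" "Kcell S f (w @ x) \<inter> Kcell S f (v @ y) \<noteq> {}"
    using assms(1) by (auto simp: linked_def)
  have xw: "x \<in> words S m" "y \<in> words S m" using xy w by auto
  obtain \<zeta> \<eta> where z: "\<zeta> \<in> Kcell S f x" "\<eta> \<in> Kcell S f y" "fword f w \<zeta> = fword f v \<eta>"
    using xy(3) unfolding Kcell_append by (elim images_meetE)
  have K: "\<zeta> \<in> Kset S f" "\<eta> \<in> Kset S f"
    using z Kcell_subset_K[OF xw(1)] Kcell_subset_K[OF xw(2)] by auto
  then have in_cap: "fword f w \<zeta> \<in> fword f w ` Qpoly J \<inter> fword f v ` Qpoly J"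
    using z(3) K_subset_Q by (metis IntI imageI subsetD)
  then have ne: "fword f w ` Qpoly J \<inter> fword f v ` Qpoly J \<noteq> {}" by blast
  have no_edge: "\<not> (\<exists>i\<in>ZJ J. fword f w ` Qpoly J \<inter> fword f v ` Qpoly J = fword f w ` edge J i)"
    using assms(2) w(1-3) unfolding E_line_iff by (auto simp: Qcell_def edge_cell_def)
  obtain i j where ij: "i \<in> ZJ J" "j \<in> ZJ J"
    "fword f w ` Qpoly J \<inter> fword f v ` Qpoly J = {fword f w (vert J i)}" "fword f w (vert J i) = fword f v (vert J j)"
    using cells_meet[OF w(1-3) ne] no_edge by metis
  have "fword f w \<zeta> = fword f w (vert J i)" using in_cap unfolding ij(3) by simp
  then have "\<zeta> = vert J i" "\<eta> = vert J j"
    using fword_eq_iff[OF w(1)] fword_eq_iff[OF w(2)] z(3) ij(4) by metis+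
  then show ?thesis
    using that[OF ij(1,2,4)] K z xy by (auto simp: bdry_def)
qed

end

section \<open>Words in the reflections in two sides\<close>

fun alternating :: "'a \<Rightarrow> 'a \<Rightarrow> nat \<Rightarrow> 'a list" where
  "alternating a b 0 = []"
| "alternating a b (Suc n) = a # alternating b a n"

lemma length_alternating [simp]: "length (alternating a b n) = n"
  by (induction n arbitrary: a b) auto

lemma set_alternating: "set (alternating a b n) \<subseteq> {a, b}"
proof (induction n arbitrary: a b)
  case (Suc n) then show ?case using Suc.IH[of b a] by auto
qed simp

lemma take_alternating: "k \<le> n \<Longrightarrow> take k (alternating a b n) = alternating a b k"
proof (induction n arbitrary: a b k)
  case (Suc n) then show ?case by (cases k) auto
qed simp

lemma distinct_adj_imp_alternating:
  assumes "distinct_adj xs" "set xs \<subseteq> {a, b}" "xs = [] \<or> hd xs = a"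
  shows "xs = alternating a b (length xs)"
  using assms
proof (induction xs arbitrary: a b)
  case (Cons x xs)
  then have "set xs \<subseteq> {b, a}" "xs = [] \<or> hd xs = b"
    by (auto simp: distinct_adj_Cons) (metis hd_in_set insertE singletonD subsetD)
  then show ?case using Cons by (auto simp: distinct_adj_Cons)
qed simp

lemma not_distinct_adj_split:
  assumes "\<not> distinct_adj xs" obtains us e vs where "xs = us @ e # e # vs"
proof -
  obtain i where i: "Suc i < length xs" "xs ! i = xs ! Suc i"
    using assms unfolding distinct_adj_conv_nth by blast
  then have "xs = take i xs @ xs ! i # xs ! i # drop (Suc (Suc i)) xs"
    by (metis Cons_nth_drop_Suc Suc_lessD append_take_drop_id)
  then show ?thesis by (rule that)
qed

context regular_polygon
begin

definition taus :: "int list \<Rightarrow> real ^ 2 \<Rightarrow> real ^ 2" where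
  "taus es = foldr (\<lambda>e h. tau e \<circ> h) es id"

lemma taus_Nil [simp]: "taus [] = id"
  and taus_Cons: "taus (e # es) = tau e \<circ> taus es"
  by (simp_all add: taus_def)

lemma taus_append: "taus (xs @ ys) = taus xs \<circ> taus ys"
  by (induction xs) (simp_all add: taus_Cons comp_assoc)

lemma similarity_taus: "similarity 1 (taus es)"
proof (induction es)
  case Nil then show ?case by (simp add: similarity_def)
next
  case (Cons e es) then show ?case
    using similarity_comp[OF similarity_tau Cons] by (simp only: taus_Cons mult_1)
qed

lemma alternating_double: "taus (alternating a b (2 * p)) = (tau a \<circ> tau b) ^^ p"
proof (induction p)
  case (Suc p)
  have "alternating a b (2 * Suc p) = a # b # alternating a b (2 * p)" by simp
  then show ?case by (simp only: taus_Cons Suc.IH funpow.simps comp_assoc)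
qed simp

text \<open>
  For sides on lines that meet in \<open>x0\<close>, the product of the two reflections is a rotation about
  \<open>x0\<close> by twice the angle between the lines, a multiple of \<open>4 * pi / J\<close>.
\<close>
lemma alternating_period:
  assumes np: "\<not> int J dvd 2 * (a - b)"
  shows "taus (alternating a b (M_const J + 2)) = id"
proof -
  define \<alpha> \<beta> where "\<alpha> = 2 * pi / J * a - pi / 2" and "\<beta> = 2 * pi / J * b - pi / 2"
  have nrm: "nrm a = dir \<alpha>" "nrm b = dir \<beta>" by (simp_all add: nrm_def \<alpha>_def \<beta>_def)
  have "sin (\<alpha> - \<beta>) \<noteq> 0"
  proof
    assume "sin (\<alpha> - \<beta>) = 0"
    then obtain i :: int where "\<alpha> - \<beta> = i * pi" unfolding sin_zero_iff_int2 by blast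
    then have "pi * (2 * (real_of_int a - b)) = pi * (real J * i)"
      unfolding \<alpha>_def \<beta>_def by (simp add: field_simps)
    then have "2 * (real_of_int a - b) = real J * i" by simp
    then have "2 * (a - b) = int J * i"
      by (metis of_int_diff of_int_eq_iff of_int_mult of_int_numeral of_int_of_nat_eq)
    then show False using np by simp
  qed
  have "cos (\<alpha> - \<beta>) \<noteq> - 1"
  proof
    assume "cos (\<alpha> - \<beta>) = - 1"
    then have "(sin (\<alpha> - \<beta>))\<^sup>2 = 0" using sin_cos_squared_add[of "\<alpha> - \<beta>"] by simp
    then show False using \<open>sin (\<alpha> - \<beta>) \<noteq> 0\<close> by simp
  qed
  define k where "k = cos (\<alpha> - \<beta>)"
  have k: "1 + k \<noteq> 0" "nrm a \<bullet> nrm b = k" "nrm b \<bullet> nrm a = k"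
  proof -
    show "1 + k \<noteq> 0" using \<open>cos _ \<noteq> - 1\<close> unfolding k_def by linarith
    show "nrm a \<bullet> nrm b = k" by (simp add: nrm dir_inner k_def)
    then show "nrm b \<bullet> nrm a = k" by (simp add: inner_commute)
  qed
  \<comment> \<open>the intersection of the two lines lies on the bisector of the normals\<close>
  define x0 where "x0 = (1 / (1 + k)) *\<^sub>R (nrm a + nrm b)"
  have x0: "x0 \<bullet> nrm a = 1" "x0 \<bullet> nrm b = 1"
    using k by (simp_all add: x0_def inner_add_left add.commute)
  have refl: "tau e (x0 + s *\<^sub>R dir t) = x0 - s *\<^sub>R dir (2 * \<gamma> - t)"
    if "nrm e = dir \<gamma>" "x0 \<bullet> nrm e = 1" for e s t \<gamma>
  proof -
    have "dir t = (2 * cos (t - \<gamma>)) *\<^sub>R dir \<gamma> - dir (2 * \<gamma> - t)"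
      using dir_sum[of \<gamma> "t - \<gamma>"] by (simp add: algebra_simps)
    then have "s *\<^sub>R dir t = (2 * s * cos (t - \<gamma>)) *\<^sub>R dir \<gamma> - s *\<^sub>R dir (2 * \<gamma> - t)"
      by (metis mult.assoc mult.left_commute scaleR_diff_right scaleR_scaleR)
    moreover have "tau e (x0 + s *\<^sub>R dir t) = x0 + s *\<^sub>R dir t - (2 * s * cos (t - \<gamma>)) *\<^sub>R dir \<gamma>"
      using that(2) by (simp add: tau_def inner_add_left that(1) dir_inner)
    ultimately show ?thesis by simp
  qed
  have rot: "(tau a \<circ> tau b) (x0 + s *\<^sub>R dir t) = x0 + s *\<^sub>R dir (t + 2 * (\<alpha> - \<beta>))" for s t
  proof -
    have "tau b (x0 + s *\<^sub>R dir t) = x0 + (- s) *\<^sub>R dir (2 * \<beta> - t)"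
      using refl[OF nrm(2) x0(2)] by simp
    then have "(tau a \<circ> tau b) (x0 + s *\<^sub>R dir t) = x0 - (- s) *\<^sub>R dir (2 * \<alpha> - (2 * \<beta> - t))"
      using refl[OF nrm(1) x0(1)] by (simp only: comp_apply)
    then show ?thesis by (simp add: algebra_simps)
  qed
  have rot_p: "((tau a \<circ> tau b) ^^ p) (x0 + s *\<^sub>R dir t) = x0 + s *\<^sub>R dir (t + 2 * real p * (\<alpha> - \<beta>))" for p s t
  proof (induction p)
    case (Suc p)
    have "((tau a \<circ> tau b) ^^ Suc p) (x0 + s *\<^sub>R dir t) = (tau a \<circ> tau b) (((tau a \<circ> tau b) ^^ p) (x0 + s *\<^sub>R dir t))"
      by simp
    also have "\<dots> = x0 + s *\<^sub>R dir (t + 2 * real p * (\<alpha> - \<beta>) + 2 * (\<alpha> - \<beta>))"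
      unfolding Suc.IH by (rule rot)
    also have "t + 2 * real p * (\<alpha> - \<beta>) + 2 * (\<alpha> - \<beta>) = t + 2 * real (Suc p) * (\<alpha> - \<beta>)"
      by (simp add: algebra_simps)
    finally show ?case .
  qed simp
  obtain p :: nat and q :: int where p: "M_const J + 2 = 2 * p" "2 * p = J * q"
  proof (cases "even J")
    case True
    then show ?thesis using J_ge_3 by (intro that[of "J div 2" 1]) (auto simp: M_const_def)
  next
    case False
    then show ?thesis using J_ge_3 by (intro that[of J 2]) (auto simp: M_const_def)
  qed
  have "2 * real p = real J * q" using arg_cong[OF p(2), of real_of_int] by simp
  then have angle: "2 * real p * (\<alpha> - \<beta>) = of_int (q * (a - b)) * (2 * pi)"
    by (simp add: \<alpha>_def \<beta>_def field_simps)
  have "((tau a \<circ> tau b) ^^ p) x = x" for x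
  proof -
    obtain t where t: "x - x0 = norm (x - x0) *\<^sub>R dir t" by (rule vector_is_scaled_dir)
    have x: "x = x0 + norm (x - x0) *\<^sub>R dir t" using t by simp
    have "((tau a \<circ> tau b) ^^ p) (x0 + norm (x - x0) *\<^sub>R dir t) = x0 + norm (x - x0) *\<^sub>R dir t"
      unfolding rot_p angle dir_periodic ..
    then show ?thesis unfolding x[symmetric] .
  qed
  then show ?thesis unfolding p(1) alternating_double by auto
qed

text \<open>
  A repeated letter cancels, and an alternating stretch of all but one letter of the period equals the
  missing letter, because its product with that letter is trivial.  Neither step creates a prefix with a
  new value, so the shortened word stays in the set \<open>C\<close>.
\<close>
lemma shorten_reflection_word:
  assumes "\<not> int J dvd 2 * (a - b)" "set es \<subseteq> {a, b}" "\<And>k. k \<le> length es \<Longrightarrow> taus (take k es) \<in> C"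
  shows "\<exists>es'. length es' \<le> M_const J \<and> taus es' = taus es \<and> (\<forall>k\<le>length es'. taus (take k es') \<in> C)"
  using assms(2,3)
proof (induction es rule: length_induct)
  case (1 es)
  have IH: "\<exists>es'. length es' \<le> M_const J \<and> taus es' = taus es \<and> (\<forall>k\<le>length es'. taus (take k es') \<in> C)"
    if "length es1 < length es" "set es1 \<subseteq> {a, b}" "taus es1 = taus es"
      "\<And>k. k \<le> length es1 \<Longrightarrow> \<exists>l\<le>length es. taus (take k es1) = taus (take l es)" for es1
  proof -
    have "taus (take k es1) \<in> C" if "k \<le> length es1" for k
      using \<open>\<And>k. k \<le> length es1 \<Longrightarrow> _\<close>[OF that] "1.prems"(2) by metis
    then show ?thesis using "1.IH" that(1-3) by metis
  qed
  show ?case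
  proof (cases "length es \<le> M_const J")
    case True then show ?thesis using "1.prems"(2) by blast
  next
    case long: False
    show ?thesis
    proof (cases "distinct_adj es")
      case False
      then obtain us e vs where es: "es = us @ e # e # vs" by (rule not_distinct_adj_split)
      have drop2: "taus (us @ e # e # ws) = taus (us @ ws)" for ws
        by (simp add: taus_append taus_Cons fun_eq_iff)
      show ?thesis
      proof (rule IH)
        show "length (us @ vs) < length es" "set (us @ vs) \<subseteq> {a, b}" "taus (us @ vs) = taus es"
          using "1.prems"(1) by (auto simp: es drop2)
        show "\<exists>l\<le>length es. taus (take k (us @ vs)) = taus (take l es)" if "k \<le> length (us @ vs)" for k
        proof (cases "k \<le> length us")
          case True then show ?thesis by (intro exI[of _ k]) (simp add: es)
        next
          case False
          then have "take (k + 2) es = us @ e # e # take (k - length us) vs"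
            "take k (us @ vs) = us @ take (k - length us) vs"
            by (simp_all add: es Suc_diff_le)
          then show ?thesis using that by (intro exI[of _ "k + 2"]) (simp add: drop2 es)
        qed
      qed
    next
      case True
      define N where "N = M_const J + 1"
      have N: "N \<ge> 2" "N \<le> length es" using J_ge_3 long by (auto simp: N_def M_const_def)
      obtain x y where xy: "{x, y} = {a, b}" "es = alternating x y (length es)"
      proof (cases "hd es = b")
        case True
        then show ?thesis using "1.prems"(1) \<open>distinct_adj es\<close> by (intro that[of b a] distinct_adj_imp_alternating) auto
      next
        case False
        moreover have "es \<noteq> []" using N by auto
        ultimately have "hd es = a" using "1.prems"(1) hd_in_set[of es] by blast
        then show ?thesis using "1.prems"(1) \<open>distinct_adj es\<close> by (intro that[of a b] distinct_adj_imp_alternating) auto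
      qed
      have "\<not> int J dvd 2 * (x - y)"
      proof -
        have "x = a \<and> y = b \<or> x = b \<and> y = a" using xy(1) by (auto simp: doubleton_eq_iff)
        moreover have "int J dvd 2 * (b - a) \<longleftrightarrow> int J dvd 2 * (a - b)"
          by (metis dvd_minus_iff minus_diff_eq mult_minus_right)
        ultimately show ?thesis using assms(1) by auto
      qed
      then have "taus (alternating x y (Suc N)) = id"
        using alternating_period by (simp add: N_def)
      moreover have "alternating x y (Suc N) = alternating x y N @ [alternating x y (Suc N) ! N]"
        using take_alternating[of N "Suc N" x y] take_Suc_conv_app_nth[of N "alternating x y (Suc N)"]
          take_alternating[of "Suc N" "Suc N" x y]
        by simp
      moreover define z where "z = alternating x y (Suc N) ! N"
      ultimately have "taus (alternating x y N) \<circ> tau z = id"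
        by (metis taus_append taus_Cons taus_Nil comp_id)
      then have "taus (alternating x y N) \<circ> tau z \<circ> tau z = tau z" by simp
      then have z_eq: "taus (alternating x y N) = tau z" by (simp only: comp_assoc tau_comp_tau comp_id)
      have "z \<in> set (alternating x y (Suc N))" unfolding z_def by (rule nth_mem) simp
      then have z: "z \<in> {a, b}" using set_alternating[of x y "Suc N"] xy(1) by blast
      have take_N: "take N es = alternating x y N" using take_alternating[OF N(2), of x y] xy(2) by simp
      have replace: "taus (z # take j (drop N es)) = taus (take (N + j) es)" for j
        by (simp only: taus_Cons take_add taus_append take_N z_eq)
      show ?thesis
      proof (rule IH)
        show "length (z # drop N es) < length es" using N by simp
        show "set (z # drop N es) \<subseteq> {a, b}" using z "1.prems"(1) set_drop_subset[of N es] by auto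
        show "taus (z # drop N es) = taus es" using replace[of "length es - N"] N by simp
        show "\<exists>l\<le>length es. taus (take k (z # drop N es)) = taus (take l es)"
          if "k \<le> length (z # drop N es)" for k
        proof (cases k)
          case 0 then show ?thesis by (intro exI[of _ 0]) simp
        next
          case (Suc j)
          then show ?thesis using replace[of j] that N by (intro exI[of _ "N + j"]) auto
        qed
      qed
    qed
  qed
qed

end

context polygon_system
begin

text \<open>
  The intersection is the image of a whole side, so the vertex alternative in \<open>cells_meet\<close> is excluded.
\<close>
lemma unfolded_cells_adjacent:
  assumes "u \<in> words S n" "u' \<in> words S n" "similarity \<sigma> F"
    "Qcell J f u = F ` Qpoly J" "Qcell J f u' = F ` tau e ` Qpoly J"
  shows "(u, u') \<in> E_line J S f n"
proof -
  have injF: "inj F" using assms(3) by (rule similarity_inj)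
  have cap: "fword f u ` Qpoly J \<inter> fword f u' ` Qpoly J = F ` edge J e"
    using assms(4,5) injF Q_inter_tau_Q[of e] by (simp add: Qcell_def image_Int[symmetric])
  have not_single: "F ` edge J e \<noteq> {x}" for x
  proof
    assume "F ` edge J e = {x}"
    then have "F (vert J (e - 1)) = F (vert J e)" using vert_in_edge[of e] by (metis imageI singletonD)
    then show False using injF edge_endpoints_distinct[of e] by (meson injD)
  qed
  have "u \<noteq> u'"
  proof
    assume "u = u'"
    then have "F ` Qpoly J = F ` edge J e" using cap assms(4) by (simp add: Qcell_def)
    then have "Qpoly J = edge J e" using injF by (simp add: inj_image_eq_iff)
    then show False using Q_not_in_line[of e] edge_inner_nrm by force
  qed
  moreover have "fword f u ` Qpoly J \<inter> fword f u' ` Qpoly J \<noteq> {}"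
    unfolding cap using edge_nonempty by simp
  ultimately obtain i where "i \<in> ZJ J" "fword f u ` Qpoly J \<inter> fword f u' ` Qpoly J = fword f u ` edge J i"
    using cells_meet[OF assms(1,2)] not_single unfolding cap by metis
  then show ?thesis
    using assms(1,2) \<open>u \<noteq> u'\<close> unfolding E_line_iff Qcell_def edge_cell_def by blast
qed

text \<open>
  The shortened word visits only cells that the original word visits, hence words of length \<open>n\<close>,
  and consecutive ones share a side.
\<close>
lemma cells_along_two_reflections_close:
  assumes "\<not> int J dvd 2 * (a - b)" "set es \<subseteq> {a, b}" "similarity \<sigma> H"
    and cells: "\<And>k. k \<le> length es \<Longrightarrow> \<exists>u\<in>words S n. H ` taus (take k es) ` Qpoly J = Qcell J f u"
    and w: "w \<in> words S n" "H ` Qpoly J = Qcell J f w"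
    and v: "v \<in> words S n" "H ` taus es ` Qpoly J = Qcell J f v"
  shows "v \<in> Gam S f n (M_const J) w"
proof -
  define C where "C = {T. \<exists>u\<in>words S n. H ` T ` Qpoly J = Qcell J f u}"
  have "taus (take k es) \<in> C" if "k \<le> length es" for k
    unfolding C_def using cells[OF that] by blast
  then obtain es' where es': "length es' \<le> M_const J" "taus es' = taus es" "\<forall>k\<le>length es'. taus (take k es') \<in> C"
    using shorten_reflection_word[OF assms(1,2)] by blast
  then have "\<forall>k. \<exists>u. k \<le> length es' \<longrightarrow> u \<in> words S n \<and> H ` taus (take k es') ` Qpoly J = Qcell J f u"
    unfolding C_def by blast
  then obtain U where U: "\<And>k. k \<le> length es' \<Longrightarrow> U k \<in> words S n"
     "\<And>k. k \<le> length es' \<Longrightarrow> H ` taus (take k es') ` Qpoly J = Qcell J f (U k)" by metis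
  have U0: "U 0 = w"
    using Qcell_inj[of "U 0" n w] U[of 0] w by simp
  have Uend: "U (length es') = v"
    using Qcell_inj[of "U (length es')" n v] U[of "length es'"] v es'(2) by simp
  have step: "(U k, U (Suc k)) \<in> E_star S f n" if k: "Suc k \<le> length es'" for k
  proof -
    have "similarity \<sigma> (H \<circ> taus (take k es'))"
      using similarity_comp[OF assms(3) similarity_taus] by simp
    moreover have "Qcell J f (U k) = (H \<circ> taus (take k es')) ` Qpoly J"
      using U(2)[of k] k by (simp only: image_comp Suc_leD)
    moreover have "taus (take (Suc k) es') = taus (take k es') \<circ> tau (es' ! k)"
      using k by (simp add: take_Suc_conv_app_nth taus_append taus_Cons)
    then have "Qcell J f (U (Suc k)) = (H \<circ> taus (take k es')) ` tau (es' ! k) ` Qpoly J"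
      using U(2)[OF k] by (simp only: image_comp comp_assoc)
    ultimately have "(U k, U (Suc k)) \<in> E_line J S f n"
      using unfolded_cells_adjacent[OF U(1) U(1)[OF k]] k by (meson Suc_leD)
    then show ?thesis using E_line_subset_E_star by blast
  qed
  let ?p = "map U [0..<Suc (length es')]"
  have "is_path (words S n) (E_star S f n) ?p"
    unfolding is_path_def successively_conv_nth using U(1) step
    by (auto simp del: upt_Suc)
  moreover have "hd ?p = w" "last ?p = v" using U0 Uend by (simp_all add: hd_map del: upt_Suc) (simp add: last_map)
  ultimately show ?thesis
    unfolding Gam_def graph_ball_def using es'(1) by (intro CollectI exI[of _ ?p]) simp
qed

section \<open>Folding a chain of cells that share sides\<close>

text \<open>
  The tail, already folded into its first cell, is reflected as a whole into the cell before it.  This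
  nests the reflections exactly as in the products defining \<open>g_fold\<close>, see \<open>fold_blocks_eq_Union\<close>.
\<close>
fun fold_blocks :: "('s list \<times> 's list set) list \<Rightarrow> 's list set" where
  "fold_blocks [] = {}"
| "fold_blocks [(w, X)] = X"
| "fold_blocks ((w, X) # (v, Y) # L) = X \<union> act (g_cross J f w v) ` fold_blocks ((v, Y) # L)"

definition side_linked :: "nat \<Rightarrow> nat \<Rightarrow> 's list \<times> 's list set \<Rightarrow> 's list \<times> 's list set \<Rightarrow> bool" where
  "side_linked n m p q \<longleftrightarrow> linked n m p q \<and> (fst p, fst q) \<in> E_line J S f n"

lemma side_linked_sym: "side_linked n m p q \<Longrightarrow> side_linked n m q p"
  unfolding side_linked_def using linked_sym sym_E_line by (metis symD)

lemma side_linked_obtain: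
  assumes "side_linked n m (w, X) (v, Y)"
  obtains i where "i \<in> ZJ J" "w \<in> words S n" "v \<in> words S n" "w \<noteq> v"
    "Qcell J f w \<inter> Qcell J f v = edge_cell J f i w"
    "g_cross J f w v \<in> G" "fword f v = fword f w \<circ> tau i \<circ> g_cross J f w v"
    "i \<in> bdry J S f X" "i \<in> ZJe J G S f" "Qcell J f v = fword f w ` tau i ` Qpoly J"
proof -
  obtain i where i: "i \<in> ZJ J" "w \<in> words S n" "v \<in> words S n" "w \<noteq> v"
    "Qcell J f w \<inter> Qcell J f v = edge_cell J f i w"
    using assms unfolding side_linked_def fst_conv E_line_iff by blast
  note g = g_cross_fold[OF i(2-4) i(1) i(5)]
  have "Qcell J f v = fword f w ` tau i ` g_cross J f w v ` Qpoly J"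
    unfolding Qcell_def by (subst g(2)) (simp only: image_comp comp_assoc)
  then have "Qcell J f v = fword f w ` tau i ` Qpoly J" using G_Q[OF g(1)] by simp
  moreover have "i \<in> bdry J S f X"
    using assms i(1,5) linked_edge(1) unfolding side_linked_def by blast
  ultimately show ?thesis using that i g ZJe_crossing[OF i(2-4) i(1) i(5)] by blast
qed

lemma head_subset_fold: "snd p \<subseteq> fold_blocks (p # L)"
  by (cases p; cases L) auto

lemma fold_subset_words:
  assumes "successively (side_linked n m) L" "\<And>p. p \<in> set L \<Longrightarrow> snd p \<subseteq> words S m"
  shows "fold_blocks L \<subseteq> words S m"
  using assms
proof (induction L rule: fold_blocks.induct)
  case (3 w X v Y L)
  have "g_cross J f w v \<in> G" using "3.prems"(1) side_linked_obtain[of n m w X v Y] by auto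
  moreover have "fold_blocks ((v, Y) # L) \<subseteq> words S m" using 3 by auto
  ultimately have "act (g_cross J f w v) ` fold_blocks ((v, Y) # L) \<subseteq> words S m"
    using act_fword(1) by blast
  then show ?case using "3.prems"(2)[of "(w, X)"] by simp
qed auto

lemma fold_subset_invariant:
  assumes "successively (side_linked n m) L" "\<And>p. p \<in> set L \<Longrightarrow> snd p \<subseteq> \<Omega>" "\<And>g. g \<in> G \<Longrightarrow> act g ` \<Omega> \<subseteq> \<Omega>"
  shows "fold_blocks L \<subseteq> \<Omega>"
  using assms
proof (induction L rule: fold_blocks.induct)
  case (3 w X v Y L)
  have "g_cross J f w v \<in> G" using "3.prems"(1) side_linked_obtain[of n m w X v Y] by auto
  moreover have "fold_blocks ((v, Y) # L) \<subseteq> \<Omega>" using 3 by auto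
  ultimately have "act (g_cross J f w v) ` fold_blocks ((v, Y) # L) \<subseteq> \<Omega>"
    using "3.prems"(3) by blast
  then show ?case using "3.prems"(2)[of "(w, X)"] by simp
qed auto

text \<open>
  By \<open>linked_edge\<close>, a small cell of the first block meets the reflected image of a small cell of the second.
\<close>
lemma fold_connected:
  assumes "successively (side_linked n m) L"
    "\<And>p. p \<in> set L \<Longrightarrow> graph_connected (words S m) (E_star S f m) (snd p)"
  shows "graph_connected (words S m) (E_star S f m) (fold_blocks L)"
  using assms
proof (induction L rule: fold_blocks.induct)
  case 1 then show ?case by (simp add: graph_connected_def)
next
  case (2 w X) then show ?case by auto
next
  case (3 w X v Y L)
  have sl: "side_linked n m (w, X) (v, Y)" using "3.prems"(1) by simp
  then obtain i where i: "i \<in> ZJ J" "Qcell J f w \<inter> Qcell J f v = edge_cell J f i w" "g_cross J f w v \<in> G"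
    by (rule side_linked_obtain)
  let ?g = "g_cross J f w v"
  obtain x y where xy: "x \<in> X" "y \<in> Y" "Kcell S f x \<inter> Kcell S f (act ?g y) \<noteq> {}"
    using linked_edge(2)[OF _ i(1,2)] sl unfolding side_linked_def by blast
  have X: "graph_connected (words S m) (E_star S f m) X" using "3.prems"(2)[of "(w, X)"] by simp
  have Y: "Y \<subseteq> words S m" using "3.prems"(2)[of "(v, Y)"] by (simp add: graph_connected_def)
  have "graph_connected (words S m) (E_star S f m) (fold_blocks ((v, Y) # L))"
    using "3.prems" by (intro "3.IH") auto
  then have F: "graph_connected (words S m) (E_star S f m) (act ?g ` fold_blocks ((v, Y) # L))"
    by (rule connected_act[OF i(3)])
  have "x \<in> words S m" using xy(1) X by (auto simp: graph_connected_def)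
  moreover have "act ?g y \<in> words S m" using act_fword(1)[OF i(3)] xy(2) Y by blast
  ultimately have "x = act ?g y \<or> (x, act ?g y) \<in> E_star S f m" using xy(3) by (auto simp: E_star_def)
  moreover have "act ?g y \<in> act ?g ` fold_blocks ((v, Y) # L)"
    using xy(2) head_subset_fold[of "(v, Y)" L] by auto
  ultimately show ?case
    using graph_connected_Un[OF X F sym_E_star xy(1)] by simp
qed

text \<open>
  A symmetry of the polygon conjugates the reflection in a side to the reflection in its image.
\<close>
lemma G_taus:
  assumes "g \<in> G" "set es \<subseteq> ZJ J" shows "g \<circ> taus es = taus (map (act_index J g) es) \<circ> g"
  using assms(2)
proof (induction es)
  case (Cons e es)
  have gD: "g \<in> D_grp J" using assms(1) G_subset_D by blast
  obtain k where k: "k \<in> ZJ J" "g ` edge J e = edge J k" using D_edge[OF gD] by blast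
  then have "act_index J g e = k" by (rule act_index_eqI)
  have "g (tau e x) = tau k (g x)" for x using D_tau[OF gD k(2)] .
  then have "g (taus (e # es) x) = tau k ((g \<circ> taus es) x)" for x by (simp add: taus_Cons)
  then show ?case
    unfolding Cons.IH[OF order_trans[OF set_subset_Cons Cons.prems]]
    by (auto simp: taus_Cons \<open>act_index J g e = k\<close>)
qed simp

text \<open>
  By induction along the chain, with the equation \<open>f\<^sub>v = f\<^sub>w \<circ> \<tau>\<^sub>a \<circ> g\<close> for the first crossing.
  Moving \<open>g\<close> past the reflections of the tail replaces each label \<open>e\<close> by \<open>g(e)\<close>, and folding does
  the same to the boundary of the tail; so the labels stay in the boundary of the folded set.
\<close>
lemma chain_is_reflection_word:
  assumes "L \<noteq> []" "successively (side_linked n m) (L @ [q])" "\<And>p. p \<in> set L \<Longrightarrow> snd p \<subseteq> words S m"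
  shows "\<exists>es. set es \<subseteq> bdry J S f (fold_blocks L) \<inter> ZJe J G S f \<and>
    (\<forall>k\<le>length es. \<exists>u\<in>words S n. fword f (fst (hd L)) ` taus (take k es) ` Qpoly J = Qcell J f u) \<and>
    fword f (fst (hd L)) ` taus es ` Qpoly J = Qcell J f (fst q)"
  using assms
proof (induction L rule: fold_blocks.induct)
  case (2 w X)
  obtain v Y where q: "q = (v, Y)" by (cases q)
  have "side_linked n m (w, X) (v, Y)" using "2.prems"(2) by (simp add: q)
  then obtain a where a: "w \<in> words S n" "v \<in> words S n" "a \<in> bdry J S f X" "a \<in> ZJe J G S f"
    "Qcell J f v = fword f w ` tau a ` Qpoly J"
    by (rule side_linked_obtain)
  have "\<exists>u\<in>words S n. fword f w ` taus (take k [a]) ` Qpoly J = Qcell J f u" if "k \<le> length [a]" for k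
  proof (cases k)
    case 0 then show ?thesis using a(1) by (intro bexI[of _ w]) (simp_all add: Qcell_def)
  next
    case (Suc j)
    then show ?thesis using a(2,5) that by (intro bexI[of _ v]) (simp_all add: taus_Cons)
  qed
  then show ?case
    using a by (intro exI[of _ "[a]"]) (auto simp: taus_Cons q)
next
  case (3 w X v Y L)
  let ?g = "g_cross J f w v" and ?F = "fold_blocks ((v, Y) # L)"
  have sl: "side_linked n m (w, X) (v, Y)" using "3.prems"(2) by simp
  then obtain a where a: "w \<in> words S n" "?g \<in> G" "fword f v = fword f w \<circ> tau a \<circ> ?g"
    "a \<in> bdry J S f X" "a \<in> ZJe J G S f"
    by (rule side_linked_obtain)
  obtain es where es: "set es \<subseteq> bdry J S f ?F \<inter> ZJe J G S f"
    "\<And>k. k \<le> length es \<Longrightarrow> \<exists>u\<in>words S n. fword f v ` taus (take k es) ` Qpoly J = Qcell J f u"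
    "fword f v ` taus es ` Qpoly J = Qcell J f (fst q)"
    using "3.IH" "3.prems" by auto
  let ?es = "a # map (act_index J ?g) es"
  have esZ: "set es \<subseteq> ZJ J" using es(1) by (auto simp: bdry_def)
  have "successively (side_linked n m) (((v, Y) # L) @ [q])" using "3.prems"(2) by simp
  then have "successively (side_linked n m) ((v, Y) # L)" unfolding successively_append_iff by blast
  then have F: "?F \<subseteq> words S m"
    using "3.prems"(3) by (intro fold_subset_words[of n]) auto
  have move: "fword f v ` taus (take k es) ` Qpoly J = fword f w ` taus (take (Suc k) ?es) ` Qpoly J" for k
  proof -
    have "set (take k es) \<subseteq> ZJ J" using esZ set_take_subset[of k es] by blast
    then have "fword f v \<circ> taus (take k es) = fword f w \<circ> taus (take (Suc k) ?es) \<circ> ?g"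
      using G_taus[OF a(2)] by (simp add: a(3) comp_assoc taus_Cons take_map)
    then have "fword f v ` taus (take k es) ` Qpoly J = fword f w ` taus (take (Suc k) ?es) ` ?g ` Qpoly J"
      by (simp only: image_comp comp_assoc)
    then show ?thesis by (simp add: G_Q[OF a(2)])
  qed
  have "set ?es \<subseteq> bdry J S f (fold_blocks ((w, X) # (v, Y) # L)) \<inter> ZJe J G S f"
  proof
    fix e assume "e \<in> set ?es"
    then consider "e = a" | e' where "e' \<in> set es" "e = act_index J ?g e'" by auto
    then show "e \<in> bdry J S f (fold_blocks ((w, X) # (v, Y) # L)) \<inter> ZJe J G S f"
    proof cases
      case 1 then show ?thesis using a(4,5) bdry_mono[of X "fold_blocks ((w, X) # (v, Y) # L)"] by auto
    next
      case 2
      obtain k where k: "k \<in> ZJ J" "?g ` edge J e' = edge J k" using D_edge a(2) G_subset_D by blast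
      then have "e = k" using act_index_eqI 2(2) by blast
      have e': "e' \<in> bdry J S f ?F" "e' \<in> ZJe J G S f" using 2(1) es(1) by auto
      have "e \<in> bdry J S f (act ?g ` ?F)"
        unfolding \<open>e = k\<close> using bdry_act[OF a(2) F e'(1) k] .
      then have "e \<in> bdry J S f (fold_blocks ((w, X) # (v, Y) # L))"
        using bdry_mono[of "act ?g ` ?F" "fold_blocks ((w, X) # (v, Y) # L)"] by auto
      moreover have "e \<in> ZJe J G S f" unfolding \<open>e = k\<close> using ZJe_act[OF e'(2) a(2) k] .
      ultimately show ?thesis by blast
    qed
  qed
  moreover have "\<exists>u\<in>words S n. fword f w ` taus (take k ?es) ` Qpoly J = Qcell J f u" if "k \<le> length ?es" for k
  proof (cases k)
    case 0 then show ?thesis using a(1) by (intro bexI[of _ w]) (simp_all add: Qcell_def)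
  next
    case (Suc j)
    then show ?thesis using es(2)[of j] that move[of j] by simp
  qed
  moreover have "fword f w ` taus ?es ` Qpoly J = Qcell J f (fst q)"
    using es(3) move[of "length es"] by simp
  ultimately show ?case unfolding list.sel fst_conv by blast
qed simp

text \<open>
  The doubled difference is a nonzero multiple of \<open>J\<close> of absolute value below \<open>2 * J\<close>, hence \<open>J\<close> or \<open>- J\<close>.
\<close>
lemma parallel_sides_opposite:
  assumes "a \<in> ZJ J" "b \<in> ZJ J" "a \<noteq> b" "int J dvd 2 * (a - b)"
  shows "even J" "b = opposite J a"
proof -
  obtain k where k: "2 * (a - b) = int J * k" using assms(4) by blast
  have "\<bar>a - b\<bar> < int J" "a - b \<noteq> 0" using assms by (auto simp: ZJ_iff)
  then have "\<bar>int J * k\<bar> < int J * 2" "k \<noteq> 0" using k by auto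
  then have "\<bar>k\<bar> < 2" by (simp add: abs_mult)
  then have k1: "k = 1 \<or> k = -1" using \<open>k \<noteq> 0\<close> by linarith
  have J: "int J = 2 * (a - b) \<or> int J = 2 * (b - a)" using k k1 by auto
  then show "even J" by presburger
  show "b = opposite J a"
    using J
  proof
    assume J: "int J = 2 * (a - b)"
    then have "a + int J div 2 = b + int J" by presburger
    then show ?thesis using assms(2) by (simp add: opposite_def ZJ_iff)
  next
    assume "int J = 2 * (b - a)"
    then have "a + int J div 2 = b" by presburger
    then show ?thesis using assms(2) by (simp add: opposite_def ZJ_iff)
  qed
qed

text \<open>
  If the boundary were small, all labels would lie in a set \<open>{a, b}\<close> of two non-parallel sides, where \<open>a\<close> is the label of the
  crossing from \<open>p\<close> into the first cell; so \<open>cells_along_two_reflections_close\<close> would apply.  A single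
  label \<open>a\<close> is paired with the neighbouring side.
\<close>
lemma far_chain_folds_wide:
  assumes "L \<noteq> []" "successively (side_linked n m) (p # L @ [q])" "\<And>p. p \<in> set L \<Longrightarrow> snd p \<subseteq> words S m"
    "fst q \<notin> Gam S f n (M_const J) (fst p)"
    and B: "B = bdry J S f (fold_blocks L) \<inter> ZJe J G S f"
  shows "card B \<ge> 3 \<or> (even J \<and> (\<exists>i\<in>ZJ J. B = {i, opposite J i} \<and> {i, opposite J i} \<subseteq> ZJe J G S f))"
proof (rule ccontr)
  assume contra: "\<not> ?thesis"
  have finB: "finite B" and BZ: "B \<subseteq> ZJ J" by (auto simp: B bdry_def)
  obtain w X L' where L: "L = (w, X) # L'" using assms(1) by (cases L) auto
  obtain v Y where p: "p = (v, Y)" by (cases p)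
  have "side_linked n m p (w, X)" using assms(2) by (simp add: L)
  then have "side_linked n m (w, X) (v, Y)" using side_linked_sym p by blast
  then obtain a where a: "w \<in> words S n" "v \<in> words S n" "a \<in> bdry J S f X" "a \<in> ZJe J G S f"
    "Qcell J f v = fword f w ` tau a ` Qpoly J"
    by (rule side_linked_obtain)
  have aB: "a \<in> B" using a(3,4) bdry_mono[OF head_subset_fold[of "(w, X)" L']] by (auto simp: B L)
  obtain es where es: "set es \<subseteq> B"
    "\<And>k. k \<le> length es \<Longrightarrow> \<exists>u\<in>words S n. fword f w ` taus (take k es) ` Qpoly J = Qcell J f u"
    "fword f w ` taus es ` Qpoly J = Qcell J f (fst q)"
  proof -
    have "successively (side_linked n m) (L @ [q])"
      using assms(2) by (simp add: L)
    from chain_is_reflection_word[OF assms(1) this assms(3)] show ?thesis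
      using that unfolding B L by auto
  qed
  obtain b where b: "B \<subseteq> {a, b}" "\<not> int J dvd 2 * (a - b)"
  proof (cases "B = {a}")
    case True
    have "\<not> int J dvd 2 * (a - (a + 1))"
    proof
      assume "int J dvd 2 * (a - (a + 1))"
      then have "int J dvd 2" by simp
      then show False using J_ge_3 zdvd_imp_le by fastforce
    qed
    then show ?thesis using that[of "a + 1"] True by simp
  next
    case False
    then obtain b where b: "b \<in> B" "b \<noteq> a" using aB by blast
    have "B = {a, b}"
    proof -
      have "card {a, b} = 2" using b by simp
      moreover have "card B \<le> 2" using contra by linarith
      ultimately show ?thesis using card_seteq[OF finB, of "{a, b}"] aB b(1) by auto
    qed
    moreover have "\<not> int J dvd 2 * (a - b)"
    proof
      assume "int J dvd 2 * (a - b)"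
      then have "even J" "b = opposite J a"
        using parallel_sides_opposite[of a b] aB b BZ by blast+
      then show False using contra \<open>B = {a, b}\<close> aB BZ B by blast
    qed
    ultimately show ?thesis using that by blast
  qed
  \<comment> \<open>coordinates on the cell of \<open>p\<close>: the word starts there, and its first letter \<open>a\<close> leads into the cell of \<open>w\<close>\<close>
  let ?H = "fword f w \<circ> tau a"
  have tt: "?H ` taus (a # xs) ` Qpoly J = fword f w ` taus xs ` Qpoly J" for xs
  proof -
    have "?H \<circ> taus (a # xs) = fword f w \<circ> taus xs" by (simp add: taus_Cons fun_eq_iff)
    then show ?thesis by (metis image_comp)
  qed
  have H0: "?H ` Qpoly J = Qcell J f v" using a(5) by (simp only: image_comp)
  have "fst q \<in> Gam S f n (M_const J) v"
  proof (rule cells_along_two_reflections_close[OF b(2)])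
    show "set (a # es) \<subseteq> {a, b}" using es(1) b(1) by auto
    show "similarity (r ^ n * 1) ?H" using similarity_comp[OF similarity_fword[OF a(1)] similarity_tau] .
    show "\<exists>u\<in>words S n. ?H ` taus (take k (a # es)) ` Qpoly J = Qcell J f u" if "k \<le> length (a # es)" for k
    proof (cases k)
      case 0 then show ?thesis using a(2) H0 by (intro bexI[of _ v]) (simp_all only: take_0 taus_Nil image_id id_apply)
    next
      case (Suc j)
      then show ?thesis using es(2)[of j] that tt by simp
    qed
    show "?H ` taus (a # es) ` Qpoly J = Qcell J f (fst q)" using es(3) tt by simp
    show "fst q \<in> words S n"
    proof -
      have "side_linked n m (last L) q" using assms(1,2) by (simp add: successively_append_iff successively_Cons)
      then show ?thesis by (simp add: side_linked_def linked_def)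
    qed
  qed (use a(2) H0 in auto)
  then show False using assms(4) p by simp
qed

section \<open>Chains that pass through a vertex\<close>

text \<open>
  A pinned block extends, by connected images of other blocks, to a connected set that touches
  both sides at a vertex of its cell, the vertex lying at the point \<open>x\<close> of the plane.
\<close>
definition pinned :: "nat \<Rightarrow> 's list set \<Rightarrow> real ^ 2 \<Rightarrow> 's list \<times> 's list set \<Rightarrow> bool" where
  "pinned m \<Omega> x p \<longleftrightarrow> (\<exists>k A. fword f (fst p) (vert J k) = x \<and> vert J k \<in> Kset S f \<and> snd p \<subseteq> A \<and> A \<subseteq> \<Omega> \<and>
     graph_connected (words S m) (E_star S f m) A \<and> {e \<in> ZJ J. vert J k \<in> edge J e} \<subseteq> bdry J S f A)"

text \<open>
  A vertex lies on two sides, and two sides have at most one common point.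
\<close>
lemma same_sides_same_vertex:
  assumes "{e \<in> ZJ J. vert J k \<in> edge J e} \<subseteq> {e \<in> ZJ J. vert J l \<in> edge J e}"
  shows "vert J k = vert J l"
proof -
  obtain e e' where "e \<noteq> e'" "{e, e'} \<subseteq> {e \<in> ZJ J. vert J k \<in> edge J e}"
    using vertex_on_two_edges[of k] by (auto simp: card_le_Suc_iff numeral_2_eq_2)
  then show ?thesis using assms edges_meet_once[of e e'] by blast
qed

text \<open>
  The extending set \<open>A\<close> touches exactly the sides at the pinned vertex.  A crossing at a vertex touches all sides
  at that vertex, so it is the pinned one, and the next block can serve as its own extension.  A
  crossing through a side uses one of the two sides at the vertex, so it fixes the point \<open>x\<close>, and the
  reflected set \<open>A\<close> together with the next block is the new extension.
\<close>
lemma pinned_step: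
  assumes narrow: "\<And>A. A \<subseteq> \<Omega> \<Longrightarrow> graph_connected (words S m) (E_star S f m) A \<Longrightarrow> card (bdry J S f A) \<le> 2"
    and inv: "\<And>g. g \<in> G \<Longrightarrow> act g ` \<Omega> \<subseteq> \<Omega>"
    and pin: "pinned m \<Omega> x p" and link: "linked n m p q"
  shows "x \<in> Kcell S f (fst q)"
    "snd q \<subseteq> \<Omega> \<Longrightarrow> graph_connected (words S m) (E_star S f m) (snd q) \<Longrightarrow> pinned m \<Omega> x q"
proof -
  obtain w X v Y where pq: "p = (w, X)" "q = (v, Y)" by (cases p; cases q)
  note link = link[unfolded pq]
  obtain k A where A: "fword f w (vert J k) = x" "vert J k \<in> Kset S f" "X \<subseteq> A" "A \<subseteq> \<Omega>"
     "graph_connected (words S m) (E_star S f m) A" "{e \<in> ZJ J. vert J k \<in> edge J e} \<subseteq> bdry J S f A"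
    using pin unfolding pinned_def pq by auto
  have sides: "bdry J S f A = {e \<in> ZJ J. vert J k \<in> edge J e}"
    using card_seteq[OF _ A(6)] narrow[OF A(4,5)] vertex_on_two_edges[of k] by auto
  have w: "w \<in> words S n" "v \<in> words S n" "w \<noteq> v" "X \<subseteq> words S m" "Y \<subseteq> words S m"
    using link by (auto simp: linked_def)
  have "\<exists>l. fword f v (vert J l) = x \<and> vert J l \<in> Kset S f \<and>
     (Y \<subseteq> \<Omega> \<longrightarrow> graph_connected (words S m) (E_star S f m) Y \<longrightarrow> pinned m \<Omega> x q)"
  proof (cases "(w, v) \<in> E_line J S f n")
    case False
    obtain i j where ij: "fword f w (vert J i) = fword f v (vert J j)" "vert J j \<in> Kset S f"
       "{e \<in> ZJ J. vert J i \<in> edge J e} \<subseteq> bdry J S f X" "{e \<in> ZJ J. vert J j \<in> edge J e} \<subseteq> bdry J S f Y"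
      using link False by (rule linked_vertex)
    have "vert J i = vert J k"
      using ij(3) bdry_mono[OF A(3)] sides by (intro same_sides_same_vertex) auto
    then have "fword f v (vert J j) = x" using A(1) ij(1) by simp
    then show ?thesis using ij(2,4) unfolding pinned_def pq by (intro exI[of _ j]) auto
  next
    case True
    then obtain i where i: "i \<in> ZJ J" "Qcell J f w \<inter> Qcell J f v = edge_cell J f i w"
      unfolding E_line_iff by blast
    let ?g = "g_cross J f w v"
    note g = g_cross_fold[OF w(1-3) i]
    have "i \<in> bdry J S f A" using linked_edge(1)[OF link i] bdry_mono[OF A(3)] by blast
    then have "vert J k \<in> edge J i" using sides by blast
    obtain l where l: "finv ?g (vert J k) = vert J l"
      using D_vert G_inv[OF g(1)] G_subset_D by blast
    have gl: "?g (vert J l) = vert J k" unfolding l[symmetric] using g(1) by simp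
    have "fword f v (vert J l) = x"
      using fun_cong[OF g(2), of "vert J l"] A(1) gl edge_inner_nrm[OF \<open>vert J k \<in> edge J i\<close>] tau_fixes
      by simp
    moreover have "vert J l \<in> Kset S f"
      unfolding l[symmetric] using G_K[OF G_inv[OF g(1)]] A(2) by blast
    moreover have "pinned m \<Omega> x q" if Y: "Y \<subseteq> \<Omega>" "graph_connected (words S m) (E_star S f m) Y"
    proof -
      let ?A = "act (finv ?g) ` A \<union> Y"
      obtain x' y where xy: "x' \<in> X" "y \<in> Y" "Kcell S f x' \<inter> Kcell S f (act ?g y) \<noteq> {}"
        using linked_edge(2)[OF link i] by blast
      have xyw: "x' \<in> words S m" "y \<in> words S m" using xy w by auto
      have gy: "act ?g y \<in> words S m" using act_fword(1)[OF g(1) xyw(2)] .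
      have "x' = act ?g y \<or> (x', act ?g y) \<in> E_star S f m"
        using xy(3) xyw(1) gy by (auto simp: E_star_def)
      then have adj: "act (finv ?g) x' = y \<or> (act (finv ?g) x', y) \<in> E_star S f m"
        using E_star_act[OF G_inv[OF g(1)]] act_inv(1)[OF g(1) xyw(2)] by metis
      have "graph_connected (words S m) (E_star S f m) ?A"
        using xy(1) A(3)
        by (intro graph_connected_Un[OF connected_act[OF G_inv[OF g(1)] A(5)] Y(2) sym_E_star _ xy(2) adj]) auto
      moreover have "{e \<in> ZJ J. vert J l \<in> edge J e} \<subseteq> bdry J S f ?A"
      proof
        fix e assume e: "e \<in> {e \<in> ZJ J. vert J l \<in> edge J e}"
        obtain e2 where e2: "e2 \<in> ZJ J" "?g ` edge J e = edge J e2" using D_edge g(1) G_subset_D by blast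
        then have "vert J k \<in> edge J e2" using e gl by (metis (no_types, lifting) imageI mem_Collect_eq)
        then have "e2 \<in> bdry J S f A" using sides e2(1) by blast
        moreover have "finv ?g ` edge J e2 = edge J e"
          unfolding e2(2)[symmetric] using g(1) by (simp add: image_image)
        moreover have "A \<subseteq> words S m" using A(5) by (simp add: graph_connected_def)
        ultimately have "e \<in> bdry J S f (act (finv ?g) ` A)"
          using bdry_act[OF G_inv[OF g(1)]] e by blast
        then show "e \<in> bdry J S f ?A" using bdry_mono[of "act (finv ?g) ` A" ?A] by blast
      qed
      moreover have "?A \<subseteq> \<Omega>" using inv[OF G_inv[OF g(1)]] A(4) Y(1) by blast
      ultimately show ?thesis
        unfolding pinned_def pq using \<open>fword f v (vert J l) = x\<close> \<open>vert J l \<in> Kset S f\<close>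
        by (intro exI[of _ l] exI[of _ ?A]) auto
    qed
    ultimately show ?thesis by blast
  qed
  then obtain l where l: "fword f v (vert J l) = x" "vert J l \<in> Kset S f"
    "Y \<subseteq> \<Omega> \<longrightarrow> graph_connected (words S m) (E_star S f m) Y \<longrightarrow> pinned m \<Omega> x q" by blast
  show "x \<in> Kcell S f (fst q)" using l(1,2) unfolding pq by (auto simp: Kcell_def)
  show "pinned m \<Omega> x q" if "snd q \<subseteq> \<Omega>" "graph_connected (words S m) (E_star S f m) (snd q)"
    using l(3) that by (simp add: pq)
qed

lemma pinned_spreads:
  assumes narrow: "\<And>A. A \<subseteq> \<Omega> \<Longrightarrow> graph_connected (words S m) (E_star S f m) A \<Longrightarrow> card (bdry J S f A) \<le> 2"
    and inv: "\<And>g. g \<in> G \<Longrightarrow> act g ` \<Omega> \<subseteq> \<Omega>"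
    and "pinned m \<Omega> x p" "successively (linked n m) (p # L)"
    and "\<And>q. q \<in> set (butlast L) \<Longrightarrow> snd q \<subseteq> \<Omega> \<and> graph_connected (words S m) (E_star S f m) (snd q)"
  shows "x \<in> Kcell S f (fst (last (p # L)))"
  using assms(3-)
proof (induction L arbitrary: p)
  case Nil then show ?case by (auto simp: pinned_def Kcell_def)
next
  case (Cons q L)
  have link: "linked n m p q" using Cons.prems(2) by simp
  show ?case
  proof (cases "L = []")
    case True
    then show ?thesis using pinned_step(1)[OF narrow inv Cons.prems(1) link] by simp
  next
    case False
    then have "pinned m \<Omega> x q"
      using Cons.prems(3)[of q] by (intro pinned_step(2)[OF narrow inv Cons.prems(1) link]) auto
    then have "x \<in> Kcell S f (fst (last (q # L)))"
      using Cons.prems False by (intro Cons.IH) auto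
    then show ?thesis by simp
  qed
qed

text \<open>
  The two blocks at a crossing through a vertex are pinned there, and the pin spreads from them to
  both ends of the chain.
\<close>
lemma vertex_chain_ends_meet:
  assumes narrow: "\<And>A. A \<subseteq> \<Omega> \<Longrightarrow> graph_connected (words S m) (E_star S f m) A \<Longrightarrow> card (bdry J S f A) \<le> 2"
    and inv: "\<And>g. g \<in> G \<Longrightarrow> act g ` \<Omega> \<subseteq> \<Omega>"
    and chain: "successively (linked n m) L" "\<not> successively (side_linked n m) L"
    and inner: "\<And>q. q \<in> set (butlast (tl L)) \<Longrightarrow> snd q \<subseteq> \<Omega> \<and> graph_connected (words S m) (E_star S f m) (snd q)"
  shows "Kcell S f (fst (hd L)) \<inter> Kcell S f (fst (last L)) \<noteq> {}"
proof -
  obtain k where k: "Suc k < length L" "\<not> side_linked n m (L ! k) (L ! Suc k)"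
    using chain(2) unfolding successively_conv_nth by blast
  define xs p q ys where "xs = take k L" and "p = L ! k" and "q = L ! Suc k" and "ys = drop (Suc (Suc k)) L"
  have L: "L = xs @ p # q # ys"
    unfolding xs_def p_def q_def ys_def using k(1) by (metis Cons_nth_drop_Suc Suc_lessD append_take_drop_id)
  have link: "linked n m p q" using chain(1) unfolding L by (simp add: successively_append_iff)
  have not_line: "(fst p, fst q) \<notin> E_line J S f n"
    using k(2) link unfolding side_linked_def p_def q_def by blast
  obtain w X v Y where pq: "p = (w, X)" "q = (v, Y)" by (cases p; cases q)
  obtain i j where "i \<in> ZJ J" "j \<in> ZJ J" and ij: "fword f w (vert J i) = fword f v (vert J j)"
     "vert J i \<in> Kset S f" "vert J j \<in> Kset S f"
     "{e \<in> ZJ J. vert J i \<in> edge J e} \<subseteq> bdry J S f X" "{e \<in> ZJ J. vert J j \<in> edge J e} \<subseteq> bdry J S f Y"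
    by (rule linked_vertex[OF link[unfolded pq] not_line[unfolded pq fst_conv]])
  define x where "x = fword f w (vert J i)"
  have "x \<in> Kcell S f (fst (last L))"
  proof (cases "ys = []")
    case True then show ?thesis using ij by (auto simp: L pq x_def Kcell_def)
  next
    case False
    then have "tl L = tl (xs @ [p]) @ q # ys" by (cases xs) (auto simp: L)
    then have "butlast (tl L) = tl (xs @ [p]) @ q # butlast ys" using False by (simp add: butlast_append)
    then have in1: "snd q' \<subseteq> \<Omega> \<and> graph_connected (words S m) (E_star S f m) (snd q')" if "q' \<in> set (q # butlast ys)" for q'
      using inner[of q'] that by auto
    have "pinned m \<Omega> x q"
      unfolding pinned_def using ij in1[of q] by (intro exI[of _ j] exI[of _ Y]) (auto simp: x_def pq)
    moreover have "successively (linked n m) (q # ys)" using chain(1) unfolding L by (simp add: successively_append_iff)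
    ultimately have "x \<in> Kcell S f (fst (last (q # ys)))"
      using pinned_spreads[OF narrow inv, where x = x and p = q and n = n and L = ys] in1 by auto
    then show ?thesis by (simp add: L)
  qed
  moreover have "x \<in> Kcell S f (fst (hd L))"
  proof (cases "xs = []")
    case True
    have "x \<in> Kcell S f w" unfolding x_def Kcell_def using ij(2) by (rule imageI)
    then show ?thesis using True by (simp add: L pq)
  next
    case False
    then have "tl L = tl xs @ p # q # ys" by (simp add: L)
    then have bt: "butlast (tl L) = tl xs @ p # butlast (q # ys)" by (simp add: butlast_append)
    have tl: "set (butlast (rev xs)) = set (tl xs)" by (metis butlast_rev set_rev)
    have in1: "snd q' \<subseteq> \<Omega> \<and> graph_connected (words S m) (E_star S f m) (snd q')" if "q' \<in> set (p # butlast (rev xs))" for q'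
      using inner[of q'] that unfolding bt tl[symmetric] by auto
    have "pinned m \<Omega> x p"
      unfolding pinned_def using ij in1[of p] by (intro exI[of _ i] exI[of _ X]) (auto simp: x_def pq)
    moreover have "successively (linked n m) (p # rev xs)"
    proof -
      have "successively (linked n m) (xs @ [p])" using chain(1) unfolding L
        by (simp add: successively_append_iff)
      then have "successively (\<lambda>a b. linked n m b a) (rev (xs @ [p]))"
        unfolding successively_rev .
      then have "successively (linked n m) (rev (xs @ [p]))"
        by (rule successively_mono) (rule linked_sym)
      then show ?thesis by simp
    qed
    ultimately have "x \<in> Kcell S f (fst (last (p # rev xs)))"
      using pinned_spreads[OF narrow inv, where x = x and p = p and n = n and L = "rev xs"] in1 by auto
    then show ?thesis using False by (simp add: L last_rev)
  qed
  ultimately show ?thesis by blast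
qed

end

section \<open>Cutting a path into blocks\<close>

lemma runs_eq_Nil [simp]: "runs h xs = [] \<longleftrightarrow> xs = []"
  by (cases xs) auto

lemma concat_runs: "concat (runs h xs) = xs"
  by (induction h xs rule: runs.induct) auto

lemma runs_nonempty: "b \<in> set (runs h xs) \<Longrightarrow> b \<noteq> []"
  by (induction h xs rule: runs.induct) auto

lemma runs_constant: "b \<in> set (runs h xs) \<Longrightarrow> y \<in> set b \<Longrightarrow> h y = h (hd b)"
  by (induction h xs rule: runs.induct) (auto dest: set_takeWhileD)

lemma hd_hd_runs: "xs \<noteq> [] \<Longrightarrow> hd (hd (runs h xs)) = hd xs"
  by (cases xs) auto

lemma runs_change: "successively (\<lambda>b b'. h (hd b) \<noteq> h (hd b')) (runs h xs)"
proof (induction h xs rule: runs.induct)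
  case (2 h x xs)
  let ?d = "dropWhile (\<lambda>y. h y = h x) xs"
  have "runs h ?d = [] \<or> h x \<noteq> h (hd (hd (runs h ?d)))"
    using hd_dropWhile[of "\<lambda>y. h y = h x" xs] hd_hd_runs[of ?d h] by (cases "?d = []") auto
  then show ?case using 2 by (auto simp: successively_Cons)
qed simp

lemma takeWhile_dropWhile_stop:
  "ys = [] \<or> \<not> P (hd ys) \<Longrightarrow> takeWhile P ys = [] \<and> dropWhile P ys = ys"
  by (cases ys) auto

text \<open>
  Used to see that cutting the joined inner part of a path recovers its inner blocks.
\<close>
lemma runs_concat:
  assumes "\<And>b. b \<in> set bs \<Longrightarrow> b \<noteq> []" "\<And>b y. b \<in> set bs \<Longrightarrow> y \<in> set b \<Longrightarrow> h y = h (hd b)"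
    "successively (\<lambda>b b'. h (hd b) \<noteq> h (hd b')) bs"
  shows "runs h (concat bs) = bs"
  using assms
proof (induction bs)
  case (Cons b bs)
  obtain x xs where b: "b = x # xs" using Cons.prems(1)[of b] by (cases b) auto
  have const: "\<forall>y\<in>set xs. h y = h x"
  proof
    fix y assume "y \<in> set xs"
    then have "h y = h (hd b)" by (intro Cons.prems(2)) (simp_all add: b)
    then show "h y = h x" by (simp add: b)
  qed
  have rest: "concat bs = [] \<or> h (hd (concat bs)) \<noteq> h x"
  proof (cases bs)
    case (Cons b' bs')
    then have "b' \<noteq> []" using Cons.prems(1) by simp
    then have "hd (concat bs) = hd b'" by (simp add: Cons)
    moreover have "h (hd b) \<noteq> h (hd b')" using Cons.prems(3) by (simp add: Cons)
    ultimately show ?thesis by (simp add: b)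
  qed simp
  have "takeWhile (\<lambda>y. h y = h x) (concat bs) = []" "dropWhile (\<lambda>y. h y = h x) (concat bs) = concat bs"
    using takeWhile_dropWhile_stop[of "concat bs" "\<lambda>y. h y = h x"] rest by auto
  then have "takeWhile (\<lambda>y. h y = h x) (xs @ concat bs) = xs" "dropWhile (\<lambda>y. h y = h x) (xs @ concat bs) = concat bs"
    using const by (simp_all add: takeWhile_append2 dropWhile_append2)
  moreover have "runs h (concat bs) = bs"
    using Cons.prems by (intro Cons.IH) (auto simp: successively_Cons)
  ultimately show ?case by (simp add: b)
qed simp

lemma successively_concatD:
  assumes "successively P (concat bs)" "\<And>b. b \<in> set bs \<Longrightarrow> b \<noteq> []"
  shows "\<And>b. b \<in> set bs \<Longrightarrow> successively P b" "successively (\<lambda>b b'. P (last b) (hd b')) bs"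
proof -
  have "(\<forall>b\<in>set bs. successively P b) \<and> successively (\<lambda>b b'. P (last b) (hd b')) bs"
    using assms
  proof (induction bs)
    case (Cons b bs)
    show ?case
    proof (cases bs)
      case Nil then show ?thesis using Cons.prems(1) by simp
    next
      case (Cons b' bs')
      have "b' \<noteq> []" "b \<noteq> []" using Cons.prems(2) Cons by simp_all
      then have "concat bs \<noteq> []" "hd (concat bs) = hd b'" by (simp_all add: Cons)
      moreover have "successively P (b @ concat bs)" using Cons.prems(1) by simp
      ultimately have "successively P b" "successively P (concat bs)" "P (last b) (hd b')"
        using \<open>b \<noteq> []\<close> unfolding successively_append_iff by metis+
      moreover have "(\<forall>b\<in>set bs. successively P b) \<and> successively (\<lambda>b b'. P (last b) (hd b')) bs"
        using Cons.prems(2) \<open>successively P (concat bs)\<close> by (intro Cons.IH) simp_all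
      ultimately show ?thesis by (simp add: Cons)
    qed
  qed simp
  then show "\<And>b. b \<in> set bs \<Longrightarrow> successively P b" "successively (\<lambda>b b'. P (last b) (hd b')) bs" by auto
qed

lemma path_set_connected:
  assumes "sym E" "set xs \<subseteq> V" "successively (\<lambda>x y. (x, y) \<in> E) xs"
  shows "graph_connected V E (set xs)"
  using assms(2,3)
proof (induction xs)
  case (Cons x xs)
  have x: "graph_connected V E {x}" using Cons.prems by (auto simp: graph_connected_iff)
  show ?case
  proof (cases "xs = []")
    case False
    then have "graph_connected V E ({x} \<union> set xs)"
      using Cons by (intro graph_connected_Un[OF x _ assms(1), of _ x "hd xs"]) (auto simp: successively_Cons)
    then show ?thesis by simp
  qed (use x in simp)
qed (simp add: graph_connected_def)

lemma set_path_join: "set (path_join xs ys) = set xs \<union> set ys"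
proof (cases "xs \<noteq> [] \<and> ys \<noteq> [] \<and> last xs = hd ys")
  case True
  then have "set ys = insert (last xs) (set (tl ys))" by (cases ys) auto
  then show ?thesis using True last_in_set[of xs] by (auto simp: path_join_def)
qed (auto simp: path_join_def)

lemma set_path_join_list: "set (path_join_list xss) = (\<Union>xs\<in>set xss. set xs)"
  unfolding path_join_list_def by (induction xss) (auto simp: set_path_join)

lemma path_join_list_eq_concat:
  assumes "successively (\<lambda>b b'. last b \<noteq> hd b') bs" "\<And>b. b \<in> set bs \<Longrightarrow> b \<noteq> []"
  shows "path_join_list bs = concat bs"
  using assms
proof (induction bs)
  case Nil then show ?case by (simp add: path_join_list_def)
next
  case (Cons b bs)
  then have IH: "path_join_list bs = concat bs" by (auto simp: successively_Cons)
  have "path_join_list (b # bs) = path_join b (concat bs)"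
    using IH by (simp add: path_join_list_def)
  moreover have "concat bs = [] \<or> last b \<noteq> hd (concat bs)"
    using Cons.prems by (cases bs) auto
  ultimately show ?case by (auto simp: path_join_def)
qed

lemma list_middle:
  assumes "length xs \<ge> 2" shows "xs = hd xs # butlast (tl xs) @ [last xs]"
  using assms by (cases xs rule: rev_cases; cases "butlast xs") (auto simp: butlast_append)

lemma set_middle: "set (butlast (tl xs)) \<subseteq> set xs"
  by (cases xs) (auto dest: in_set_butlastD)

lemma middle_nth:
  assumes "Suc i < length xs - 1"
  shows "butlast (tl xs) ! i = xs ! Suc i"
  using assms by (simp add: nth_butlast nth_tl)

section \<open>The boundary of a folded path\<close>

context polygon_system
begin

definition block :: "nat \<Rightarrow> 's list list \<Rightarrow> 's list \<times> 's list set" where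
  "block n b = (take n (hd b), set (map (drop n) b))"

lemma act_id_image: assumes "A \<subseteq> words S n" shows "act id ` A = A"
proof -
  have "act id ` A = (\<lambda>u. u) ` A" using assms by (intro image_cong refl act_id) blast
  then show ?thesis by simp
qed

text \<open>
  The nested reflections of \<open>fold_blocks\<close> multiply out to the products of crossings.
\<close>
lemma fold_blocks_eq_Union:
  assumes "L \<noteq> []" "successively (side_linked n m) L" "\<And>p. p \<in> set L \<Longrightarrow> snd p \<subseteq> words S m"
  shows "fold_blocks L = (\<Union>j<length L. act (foldr (\<circ>) (map (\<lambda>i. g_cross J f (fst (L ! i)) (fst (L ! Suc i))) [0..<j]) id) ` snd (L ! j))"
  using assms
proof (induction L rule: fold_blocks.induct)
  case (2 w X)
  have "act id ` X = X" using "2.prems"(3)[of "(w, X)"] by (intro act_id_image) simp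
  then show ?case by (simp add: lessThan_Suc id_def)
next
  case (3 w X v Y L)
  let ?M = "(v, Y) # L" and ?L = "(w, X) # (v, Y) # L" and ?g = "g_cross J f w v"
  let ?c = "\<lambda>L j. foldr (\<circ>) (map (\<lambda>i. g_cross J f (fst (L ! i)) (fst (L ! Suc i))) [0..<j]) id"
  have sl: "side_linked n m (w, X) (v, Y)" and sM: "successively (side_linked n m) ?M" using "3.prems"(2) by simp_all
  have g: "?g \<in> G" using sl by (rule side_linked_obtain)
  have cG: "?c ?M j \<in> G" if "j < length ?M" for j
    using that
  proof (induction j)
    case 0 then show ?case using G_id by (simp add: id_def)
  next
    case (Suc j)
    obtain w1 X1 where p1: "?M ! j = (w1, X1)" by (cases "?M ! j")
    obtain w2 X2 where p2: "?M ! Suc j = (w2, X2)" by (cases "?M ! Suc j")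
    have "side_linked n m (w1, X1) (w2, X2)"
      using successively_nth[OF sM Suc.prems] unfolding p1 p2 .
    then have h: "g_cross J f w1 w2 \<in> G" by (rule side_linked_obtain)
    have "foldr (\<circ>) xs h = foldr (\<circ>) xs id \<circ> h" for xs :: "(real ^ 2 \<Rightarrow> real ^ 2) list" and h
      by (induction xs) (auto simp: comp_assoc)
    then have eq: "?c ?M (Suc j) = ?c ?M j \<circ> g_cross J f w1 w2"
      using p1 p2 by simp
    have "?c ?M j \<in> G" by (rule Suc.IH) (use Suc.prems in simp)
    then have "?c ?M j \<circ> g_cross J f w1 w2 \<in> G" using h by (rule G_comp)
    then show ?case by (rule back_subst[of "\<lambda>h. h \<in> G"]) (rule eq[symmetric])
  qed
  have shift: "?c ?L (Suc j) = ?g \<circ> ?c ?M j" for j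
    by (simp add: upt_conv_Cons map_Suc_upt[symmetric] comp_def del: upt_Suc map_Suc_upt)
  have step: "act (?c ?L (Suc j)) ` snd (?L ! Suc j) = act ?g ` act (?c ?M j) ` snd (?M ! j)" if j: "j < length ?M" for j
  proof -
    have "snd (?M ! j) \<subseteq> words S m" using "3.prems"(3)[of "?M ! j"] nth_mem[OF j] by auto
    then have "act (?g \<circ> ?c ?M j) ` snd (?M ! j) = (\<lambda>u. act ?g (act (?c ?M j) u)) ` snd (?M ! j)"
      using act_comp[OF g cG[OF j]] by (intro image_cong) auto
    then show ?thesis unfolding shift by (simp add: image_image)
  qed
  have "act id ` X = X" using "3.prems"(3)[of "(w, X)"] by (intro act_id_image) simp
  then have zero: "act (?c ?L 0) ` snd (?L ! 0) = X" by (simp add: id_def)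
  have split: "(\<Union>j<length ?L. act (?c ?L j) ` snd (?L ! j)) =
      act (?c ?L 0) ` snd (?L ! 0) \<union> (\<Union>j<length ?M. act (?c ?L (Suc j)) ` snd (?L ! Suc j))"
    by (simp add: lessThan_Suc_eq_insert_0 image_Union del: upt_Suc)
  have rest: "(\<Union>j<length ?M. act (?c ?L (Suc j)) ` snd (?L ! Suc j)) = act ?g ` fold_blocks ?M"
  proof -
    have "fold_blocks ?M = (\<Union>j<length ?M. act (?c ?M j) ` snd (?M ! j))"
      using "3.prems"(3) by (intro "3.IH" sM) auto
    then show ?thesis using step by (simp only: image_UN) (intro SUP_cong, auto)
  qed
  show ?case unfolding split zero rest by (rule fold_blocks.simps(3))
qed simp

text \<open>
  The chain of blocks of the path is either linked through sides all along, and then its inner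
  blocks are folded, or it passes through a vertex somewhere, and then a narrow boundary would make its
  ends neighbours.  For the folding of the interior path it remains to recognise the inner blocks in it.
\<close>
lemma far_path_folds_wide:
  assumes path: "is_path (words S (n + m)) (E_star S f (n + m)) \<gamma>"
    and far: "trunc_at n \<gamma> (num_runs n \<gamma>) \<notin> Gam S f n (M_const J) (trunc_at n \<gamma> 1)"
  shows "(\<exists>A. A \<subseteq> (\<Union>g\<in>G. \<Union>j\<in>{2..num_runs n \<gamma> - 1}. act_word J S f g ` set (sigma_path n \<gamma> j)) \<and>
            graph_connected (words S m) (E_star S f m) A \<and>
            (card (bdry J S f A) \<ge> 3 \<or>
             (even J \<and> (\<exists>i\<in>ZJ J. bdry J S f A = {i, opposite J i} \<and>
                                   {i, opposite J i} \<subseteq> ZJe J G S f))))"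
    and "is_path (words S n) (E_line J S f n) (trunc_path n \<gamma>) \<Longrightarrow>
            (let B = bdry J S f (set (path_folding J S f n (interior_path n \<gamma>))) \<inter> ZJe J G S f
             in card B \<ge> 3 \<or>
                (even J \<and> (\<exists>i\<in>ZJ J. B = {i, opposite J i} \<and>
                                      {i, opposite J i} \<subseteq> ZJe J G S f)))"
proof -
  define rs where "rs = runs (take n) \<gamma>"
  define L where "L = map (block n) rs"
  have \<gamma>: "\<gamma> \<noteq> []" "set \<gamma> \<subseteq> words S (n + m)" "successively (\<lambda>x y. (x, y) \<in> E_star S f (n + m)) \<gamma>"
    using path by (auto simp: is_path_def)
  have rs_ne: "rs \<noteq> []" using \<gamma>(1) by (simp add: rs_def)
  have len: "num_runs n \<gamma> = length rs" "length L = length rs" by (simp_all add: num_runs_def rs_def L_def)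
  have b_ne: "b \<noteq> []" if "b \<in> set rs" for b using that runs_nonempty unfolding rs_def by blast
  have b_const: "take n y = take n (hd b)" if "b \<in> set rs" "y \<in> set b" for b y
    using that unfolding rs_def by (rule runs_constant)
  have b_last: "take n (last b) = take n (hd b)" if "b \<in> set rs" for b
    by (rule b_const[OF that]) (simp add: b_ne[OF that])
  have b_words: "set b \<subseteq> words S (n + m)" if "b \<in> set rs" for b
  proof -
    have "set b \<subseteq> set (concat rs)" using that by auto
    then show ?thesis using \<gamma>(2) by (simp add: rs_def concat_runs)
  qed
  have "successively (\<lambda>x y. (x, y) \<in> E_star S f (n + m)) (concat rs)"
    using \<gamma>(3) by (simp add: rs_def concat_runs)
  then have steps: "\<And>b. b \<in> set rs \<Longrightarrow> successively (\<lambda>x y. (x, y) \<in> E_star S f (n + m)) b"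
    "successively (\<lambda>b b'. (last b, hd b') \<in> E_star S f (n + m)) rs"
    using successively_concatD[of "\<lambda>x y. (x, y) \<in> E_star S f (n + m)" rs] b_ne by blast+
  have split: "take n y \<in> words S n" "drop n y \<in> words S m" "take n y @ drop n y = y"
    if "y \<in> words S (n + m)" for y
    using that set_take_subset[of n y] set_drop_subset[of n y] by (auto simp: words_def)
  have block_words: "snd p \<subseteq> words S m" if "p \<in> set L" for p
    using that b_words split(2) by (fastforce simp: L_def block_def)
  have block_connected: "graph_connected (words S m) (E_star S f m) (snd p)" if p: "p \<in> set L" for p
  proof -
    obtain b where b: "b \<in> set rs" "p = block n b" using p by (auto simp: L_def)
    have "(drop n x, drop n y) \<in> E_star S f m"
      if xy: "x \<in> set b" "y \<in> set b" "(x, y) \<in> E_star S f (n + m)" for x y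
    proof -
      have w: "x \<in> words S (n + m)" "y \<in> words S (n + m)" using xy b_words[OF b(1)] by auto
      let ?w = "take n x"
      have wy: "take n y = ?w" using b_const[OF b(1)] xy(1,2) by metis
      have eq: "x = ?w @ drop n x" "y = ?w @ drop n y" using wy by (metis append_take_drop_id)+
      have "Kcell S f x \<inter> Kcell S f y \<noteq> {}" "x \<noteq> y" using xy(3) by (auto simp: E_star_def)
      then have "fword f ?w ` Kcell S f (drop n x) \<inter> fword f ?w ` Kcell S f (drop n y) \<noteq> {}"
        using Kcell_append[of ?w "drop n x"] Kcell_append[of ?w "drop n y"] eq by metis
      then have "Kcell S f (drop n x) \<inter> Kcell S f (drop n y) \<noteq> {}"
        using inj_fword[OF split(1)[OF w(1)]] by (simp add: image_Int[symmetric])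
      moreover have "drop n x \<noteq> drop n y" using eq \<open>x \<noteq> y\<close> by metis
      ultimately show ?thesis using split(2)[OF w(1)] split(2)[OF w(2)] by (simp add: E_star_def)
    qed
    then have "successively (\<lambda>x y. (x, y) \<in> E_star S f m) (map (drop n) b)"
      unfolding successively_map using steps(1)[OF b(1)] by (auto elim: successively_mono)
    then show ?thesis
      using block_words[OF p] path_set_connected[OF sym_E_star] unfolding b(2) block_def snd_conv by blast
  qed
  have rs_link: "successively (\<lambda>b b'. linked n m (block n b) (block n b')) rs"
    unfolding successively_conv_nth
  proof (intro allI impI)
    fix i assume i: "Suc i < length rs"
    let ?b = "rs ! i" and ?b' = "rs ! Suc i"
    have bs: "?b \<in> set rs" "?b' \<in> set rs" using i by auto
    have mem: "last ?b \<in> set ?b" "hd ?b' \<in> set ?b'" using b_ne bs by simp_all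
    have w: "last ?b \<in> words S (n + m)" "hd ?b' \<in> words S (n + m)" using mem b_words bs by blast+
    have "(last ?b, hd ?b') \<in> E_star S f (n + m)" using steps(2) i by (simp add: successively_conv_nth)
    then have "Kcell S f (take n (last ?b) @ drop n (last ?b)) \<inter> Kcell S f (take n (hd ?b') @ drop n (hd ?b')) \<noteq> {}"
      by (simp add: E_star_def)
    then have K: "Kcell S f (take n (hd ?b) @ drop n (last ?b)) \<inter> Kcell S f (take n (hd ?b') @ drop n (hd ?b')) \<noteq> {}"
      using b_last[OF bs(1)] by simp
    have "take n (hd ?b) \<noteq> take n (hd ?b')"
      using runs_change[of "take n" \<gamma>] i unfolding successively_conv_nth rs_def by blast
    moreover have "take n (hd ?b) \<in> words S n" "take n (hd ?b') \<in> words S n"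
      using split(1)[OF w(1)] split(1)[OF w(2)] b_last[OF bs(1)] by simp_all
    moreover have "snd (block n ?b) \<subseteq> words S m" "snd (block n ?b') \<subseteq> words S m"
      using block_words bs by (auto simp: L_def)
    moreover have "\<exists>x\<in>snd (block n ?b). \<exists>y\<in>snd (block n ?b').
       Kcell S f (fst (block n ?b) @ x) \<inter> Kcell S f (fst (block n ?b') @ y) \<noteq> {}"
      using K mem unfolding block_def fst_conv snd_conv set_map by blast
    ultimately show "linked n m (block n ?b) (block n ?b')" by (simp add: linked_def block_def)
  qed
  then have chain: "successively (linked n m) L" by (simp add: L_def successively_map)
  have first: "trunc_at n \<gamma> 1 = fst (hd L)" and last: "trunc_at n \<gamma> (num_runs n \<gamma>) = fst (last L)"
  proof -
    show "trunc_at n \<gamma> 1 = fst (hd L)"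
      using rs_ne b_last[of "hd rs"] by (cases rs) (auto simp: trunc_at_def trunc_path_def rs_def[symmetric] L_def block_def)
    show "trunc_at n \<gamma> (num_runs n \<gamma>) = fst (last L)"
      using rs_ne b_last[of "last rs"]
      by (simp add: trunc_at_def trunc_path_def rs_def[symmetric] len L_def block_def last_map last_conv_nth)
  qed
  have fst_words: "fst p \<in> words S n" if p: "p \<in> set L" for p
  proof -
    obtain b where b: "b \<in> set rs" "p = block n b" using p by (auto simp: L_def)
    then have "hd b \<in> words S (n + m)" using b_words[OF b(1)] b_ne[OF b(1)] by auto
    then show ?thesis using split(1) by (simp add: b(2) block_def)
  qed
  have L_ne: "L \<noteq> []" using rs_ne by (simp add: L_def)
  have M_pos: "M_const J \<ge> 1" using J_ge_3 by (auto simp: M_const_def)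
  \<comment> \<open>the ends differ and are not neighbours, so the chain has an inner block\<close>
  have not_close: "fst (hd L) \<noteq> fst (last L)" "(fst (hd L), fst (last L)) \<notin> E_star S f n"
  proof -
    have in_ball: "v \<in> Gam S f n (M_const J) u"
      if "is_path (words S n) (E_star S f n) xs" "length xs \<le> 2" "hd xs = u" "last xs = v" for u v xs
      using that M_pos unfolding Gam_def graph_ball_def by (intro CollectI exI[of _ xs]) auto
    show "fst (hd L) \<noteq> fst (last L)"
      using far fst_words[of "hd L"] L_ne in_ball[of "[fst (hd L)]"] unfolding first last
      by (auto simp: is_path_def)
    show "(fst (hd L), fst (last L)) \<notin> E_star S f n"
      using far fst_words[of "hd L"] fst_words[of "last L"] L_ne in_ball[of "[fst (hd L), fst (last L)]"] unfolding first last
      by (auto simp: is_path_def)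
  qed
  define I where "I = butlast (tl L)"
  have "length L \<ge> 2"
    using not_close(1) L_ne by (cases L rule: rev_cases; cases "butlast L") auto
  then have L_split: "L = hd L # I @ [last L]" unfolding I_def by (rule list_middle)
  have I_sub: "set I \<subseteq> set L"
    unfolding I_def by (rule set_middle)
  define \<Omega> where "\<Omega> = (\<Union>g\<in>G. \<Union>j\<in>{2..num_runs n \<gamma> - 1}. act g ` set (sigma_path n \<gamma> j))"
  have sigma: "set (sigma_path n \<gamma> (Suc j)) = snd (L ! j)" if "j < length L" for j
    using that by (simp add: sigma_path_def rs_def[symmetric] L_def block_def)
  have in_\<Omega>: "act h u \<in> \<Omega>" if "h \<in> G" "j \<in> {2..num_runs n \<gamma> - 1}" "u \<in> set (sigma_path n \<gamma> j)" for h j u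
    unfolding \<Omega>_def using that by (intro UN_I[of h] UN_I[of j] image_eqI[of _ _ u] refl)
  have I_\<Omega>: "snd p \<subseteq> \<Omega>" if p_in: "p \<in> set I" for p
  proof -
    obtain i where i: "i < length I" "p = I ! i" using p_in unfolding in_set_conv_nth by blast
    then have "Suc i < length L - 1" by (simp add: I_def)
    then have "p = L ! Suc i" "Suc i < length L - 1" using i(2) middle_nth[of i L] by (simp_all add: I_def)
    then have p: "snd p = set (sigma_path n \<gamma> (Suc (Suc i)))" "Suc (Suc i) \<in> {2..num_runs n \<gamma> - 1}"
      using sigma[of "Suc i"] by (auto simp: len)
    have "snd p \<subseteq> words S m" using block_words p_in I_sub by blast
    show ?thesis
    proof
      fix u assume u: "u \<in> snd p"
      then have "act id u = u" using act_id \<open>snd p \<subseteq> words S m\<close> by blast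
      then show "u \<in> \<Omega>" using in_\<Omega>[OF G_id p(2)] u p(1) by metis
    qed
  qed
  have \<Omega>_inv: "act g ` \<Omega> \<subseteq> \<Omega>" if g: "g \<in> G" for g
  proof -
    have "act g (act h u) \<in> \<Omega>" if h: "h \<in> G" "j \<in> {2..num_runs n \<gamma> - 1}" "u \<in> set (sigma_path n \<gamma> j)" for h j u
    proof -
      have "u \<in> words S m"
        using h(2,3) sigma[of "j - 1"] block_words[of "L ! (j - 1)"] by (auto simp: len)
      then have "act g (act h u) = act (g \<circ> h) u" using act_comp[OF g h(1)] by simp
      then show ?thesis using in_\<Omega>[OF G_comp[OF g h(1)] h(2,3)] by simp
    qed
    then show ?thesis by (auto simp: \<Omega>_def)
  qed
  define wide where "wide = (\<lambda>B. card B \<ge> 3 \<or> (even J \<and> (\<exists>i\<in>ZJ J. B = {i, opposite J i} \<and> {i, opposite J i} \<subseteq> ZJe J G S f)))"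
  have side_I: "wide (bdry J S f (fold_blocks I) \<inter> ZJe J G S f)" "successively (side_linked n m) I" "I \<noteq> []"
    if side: "successively (side_linked n m) L"
  proof -
    have s: "successively (side_linked n m) (hd L # I @ [last L])" using side by (subst (asm) L_split)
    show "I \<noteq> []"
    proof
      assume "I = []"
      then have "(fst (hd L), fst (last L)) \<in> E_line J S f n" using s by (simp add: side_linked_def)
      then show False using not_close(2) E_line_subset_E_star by blast
    qed
    then show "wide (bdry J S f (fold_blocks I) \<inter> ZJe J G S f)"
      using far_chain_folds_wide[OF _ s] far block_words I_sub unfolding first last wide_def by blast
    show "successively (side_linked n m) I"
      using s \<open>I \<noteq> []\<close> by (simp add: successively_Cons successively_append_iff)
  qed
  have "\<exists>A\<subseteq>\<Omega>. graph_connected (words S m) (E_star S f m) A \<and> wide (bdry J S f A)"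
  proof (cases "successively (side_linked n m) L")
    case True
    let ?A = "fold_blocks I"
    have "?A \<subseteq> \<Omega>" using side_I(2)[OF True] I_\<Omega> \<Omega>_inv by (rule fold_subset_invariant)
    moreover have "graph_connected (words S m) (E_star S f m) ?A"
      using side_I(2)[OF True] block_connected I_sub by (intro fold_connected) auto
    moreover have "wide (bdry J S f ?A)"
    proof -
      let ?B = "bdry J S f ?A \<inter> ZJe J G S f"
      have card: "card ?B \<le> card (bdry J S f ?A)" by (intro card_mono) auto
      from side_I(1)[OF True] consider "card ?B \<ge> 3" |
        i where "even J" "i \<in> ZJ J" "?B = {i, opposite J i}" "{i, opposite J i} \<subseteq> ZJe J G S f"
        unfolding wide_def by blast
      then show ?thesis
      proof cases
        case 1 then show ?thesis using card by (simp add: wide_def)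
      next
        case 2
        show ?thesis
        proof (cases "bdry J S f ?A = ?B")
          case True then show ?thesis using 2 unfolding wide_def by metis
        next
          case False
          \<comment> \<open>an index outside \<open>ZJe\<close> is then a third one\<close>
          then have "?B \<subset> bdry J S f ?A" by blast
          then have "card ?B < card (bdry J S f ?A)" by (intro psubset_card_mono) auto
          moreover have "card ?B = 2"
          proof -
            have "opposite J i \<noteq> i"
            proof
              assume eq: "opposite J i = i"
              have "(i + int J div 2) mod int J = i mod int J" using eq 2(2) by (simp add: opposite_def ZJ_iff)
              then have "int J dvd int J div 2" by (metis add_diff_cancel_left' mod_eq_dvd_iff)
              moreover have "0 < int J div 2" "int J div 2 < int J" using J_ge_3 by linarith+
              ultimately show False using zdvd_not_zless by blast
            qed
            then show ?thesis unfolding 2(3) by simp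
          qed
          ultimately show ?thesis by (simp add: wide_def)
        qed
      qed
    qed
    ultimately show ?thesis by blast
  next
    case False
    show ?thesis
    proof (rule ccontr)
      assume contra: "\<not> ?thesis"
      have "Kcell S f (fst (hd L)) \<inter> Kcell S f (fst (last L)) \<noteq> {}"
      proof (rule vertex_chain_ends_meet[OF _ \<Omega>_inv chain False])
        show "card (bdry J S f A) \<le> 2" if "A \<subseteq> \<Omega>" "graph_connected (words S m) (E_star S f m) A" for A
          using contra that unfolding wide_def by (metis not_less_eq_eq numeral_2_eq_2 numeral_3_eq_3)
        show "snd q \<subseteq> \<Omega> \<and> graph_connected (words S m) (E_star S f m) (snd q)" if "q \<in> set (butlast (tl L))" for q
          using that I_\<Omega> block_connected I_sub unfolding I_def by blast
      qed
      then have "(fst (hd L), fst (last L)) \<in> E_star S f n"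
        using not_close(1) fst_words L_ne by (simp add: E_star_def)
      then show False using not_close(2) by blast
    qed
  qed
  then show "\<exists>A. A \<subseteq> (\<Union>g\<in>G. \<Union>j\<in>{2..num_runs n \<gamma> - 1}. act_word J S f g ` set (sigma_path n \<gamma> j)) \<and>
            graph_connected (words S m) (E_star S f m) A \<and>
            (card (bdry J S f A) \<ge> 3 \<or>
             (even J \<and> (\<exists>i\<in>ZJ J. bdry J S f A = {i, opposite J i} \<and>
                                   {i, opposite J i} \<subseteq> ZJe J G S f)))"
    unfolding \<Omega>_def wide_def by blast
  assume line: "is_path (words S n) (E_line J S f n) (trunc_path n \<gamma>)"
  have "map fst L = trunc_path n \<gamma>"
    using b_last by (simp add: trunc_path_def rs_def[symmetric] L_def block_def)
  then have "successively (\<lambda>w v. (w, v) \<in> E_line J S f n) (map fst L)"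
    using line by (simp add: is_path_def)
  then have "successively (\<lambda>p q. (fst p, fst q) \<in> E_line J S f n) L"
    unfolding successively_map .
  then have side: "successively (side_linked n m) L"
    using chain unfolding successively_conv_nth side_linked_def by blast
  \<comment> \<open>consecutive blocks lie in different cells, so joining them merges no entries\<close>
  define ri where "ri = butlast (tl rs)"
  have len_ri: "length ri = length rs - 2" by (simp add: ri_def)
  have ri_sub: "set ri \<subseteq> set rs" unfolding ri_def by (rule set_middle)
  have I_ri: "I = map (block n) ri" by (simp add: I_def L_def ri_def map_butlast map_tl)
  have ri_change: "successively (\<lambda>b b'. take n (hd b) \<noteq> take n (hd b')) ri"
  proof -
    have "successively (\<lambda>p q. fst p \<noteq> fst q) I"
      using side_I(2)[OF side] by (auto elim!: successively_mono simp: side_linked_def linked_def)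
    then show ?thesis by (simp add: I_ri successively_map block_def)
  qed
  have interior: "interior_path n \<gamma> = concat ri"
  proof -
    have "map ((@) (trunc_at n \<gamma> j)) (sigma_path n \<gamma> j) = rs ! (j - 1)" if j: "1 \<le> j" "j \<le> length rs" for j
    proof -
      let ?b = "rs ! (j - 1)"
      have b: "?b \<in> set rs" using j by auto
      have t: "trunc_at n \<gamma> j = take n (hd ?b)"
        using j b_last[OF b] by (simp add: trunc_at_def trunc_path_def rs_def[symmetric])
      have "map (\<lambda>y. take n (hd ?b) @ drop n y) ?b = map (\<lambda>y. y) ?b"
        using b_const[OF b] by (intro map_cong refl) (metis append_take_drop_id)
      then show ?thesis by (simp add: t sigma_path_def rs_def[symmetric] comp_def)
    qed
    then have "map (\<lambda>j. map ((@) (trunc_at n \<gamma> j)) (sigma_path n \<gamma> j)) [2..<num_runs n \<gamma>] = map (\<lambda>j. rs ! (j - 1)) [2..<length rs]"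
      by (intro map_cong) (auto simp: len)
    also have "\<dots> = ri"
      by (rule nth_equalityI) (auto simp: ri_def nth_butlast nth_tl)
    finally have "interior_path n \<gamma> = path_join_list ri" by (simp add: interior_path_def)
    also have "\<dots> = concat ri"
    proof (rule path_join_list_eq_concat)
      show "successively (\<lambda>b b'. last b \<noteq> hd b') ri"
        using ri_change
      proof (rule successively_mono)
        show "last b \<noteq> hd b'" if "b \<in> set ri" "take n (hd b) \<noteq> take n (hd b')" for b b'
          using that b_last ri_sub by (metis subsetD)
      qed
    qed (use b_ne ri_sub in blast)
    finally show ?thesis .
  qed
  have runs_int: "runs (take n) (interior_path n \<gamma>) = ri"
    unfolding interior using ri_sub b_ne b_const ri_change by (intro runs_concat) blast+
  let ?ip = "interior_path n \<gamma>"
  have tr: "trunc_at n ?ip (Suc i) = fst (I ! i)" if "i < length I" for i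
    using that b_last[of "ri ! i"] ri_sub
    by (auto simp: trunc_at_def trunc_path_def runs_int I_ri block_def subset_iff)
  have sg: "set (sigma_path n ?ip (Suc i)) = snd (I ! i)" if "i < length I" for i
    using that by (simp add: sigma_path_def runs_int I_ri block_def)
  have gf: "g_fold J f n ?ip (Suc j) = foldr (\<circ>) (map (\<lambda>i. g_cross J f (fst (I ! i)) (fst (I ! Suc i))) [0..<j]) id"
    if "j < length I" for j
  proof -
    have "map (\<lambda>i. g_cross J f (trunc_at n ?ip i) (trunc_at n ?ip (i + 1))) [1..<Suc j] =
      map (\<lambda>i. g_cross J f (fst (I ! i)) (fst (I ! Suc i))) [0..<j]"
      using that tr by (intro nth_equalityI) (auto simp del: upt_Suc)
    then show ?thesis by (simp only: g_fold_def)
  qed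
  have nI: "num_runs n ?ip = length I" by (simp add: num_runs_def runs_int I_ri)
  have I_pos: "0 < length I" using side_I(3)[OF side] by simp
  let ?T = "\<lambda>j. act (foldr (\<circ>) (map (\<lambda>i. g_cross J f (fst (I ! i)) (fst (I ! Suc i))) [0..<j]) id) ` snd (I ! j)"
  have "set (path_folding J S f n ?ip) = set (sigma_path n ?ip 1) \<union>
      (\<Union>j\<in>{2..<length I + 1}. act (g_fold J f n ?ip j) ` set (sigma_path n ?ip j))"
    by (simp add: path_folding_def set_path_join set_path_join_list nI del: upt_Suc)
  also have "set (sigma_path n ?ip 1) = ?T 0"
  proof -
    have "snd (I ! 0) \<subseteq> words S m" using block_words I_sub nth_mem[OF I_pos] by blast
    then have "act id ` snd (I ! 0) = snd (I ! 0)" by (rule act_id_image)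
    then show ?thesis using sg[OF I_pos] by simp
  qed
  also have "(\<Union>j\<in>{2..<length I + 1}. act (g_fold J f n ?ip j) ` set (sigma_path n ?ip j)) = (\<Union>j\<in>{1..<length I}. ?T j)"
  proof -
    have shift: "{2..<length I + 1} = Suc ` {1..<length I}" by (simp add: image_Suc_atLeastLessThan numeral_2_eq_2)
    have "act (g_fold J f n ?ip (Suc j)) ` set (sigma_path n ?ip (Suc j)) = ?T j" if "j \<in> {1..<length I}" for j
      using that gf[of j] sg[of j] by simp
    then show ?thesis unfolding shift image_image by (intro SUP_cong refl)
  qed
  also have "?T 0 \<union> (\<Union>j\<in>{1..<length I}. ?T j) = (\<Union>j<length I. ?T j)"
  proof -
    have "{..<length I} = insert 0 {1..<length I}" using I_pos by auto
    then show ?thesis by simp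
  qed
  also have "\<dots> = fold_blocks I"
    using fold_blocks_eq_Union[OF side_I(3,2)[OF side]] block_words I_sub by (metis subsetD)
  finally have "set (path_folding J S f n ?ip) = fold_blocks I" .
  then show "let B = bdry J S f (set (path_folding J S f n (interior_path n \<gamma>))) \<inter> ZJe J G S f
             in card B \<ge> 3 \<or>
                (even J \<and> (\<exists>i\<in>ZJ J. B = {i, opposite J i} \<and>
                                      {i, opposite J i} \<subseteq> ZJe J G S f))"
    using side_I(1)[OF side] unfolding wide_def Let_def by simp
qed

end

theorem theorem8p8:
  fixes J n m :: nat
    and G :: "(real ^ 2 \<Rightarrow> real ^ 2) set"
    and S :: "'s set"
    and f :: "'s \<Rightarrow> real ^ 2 \<Rightarrow> real ^ 2"
    and \<gamma> :: "'s list list"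
  assumes "J \<ge> 3"
    and "subgroup G O2" and "G \<subseteq> D_grp J"
    and "JG_ss_system J G S f"
    and "is_path (words S (n + m)) (E_star S f (n + m)) \<gamma>"
    and "trunc_at n \<gamma> (num_runs n \<gamma>) \<notin> Gam S f n (M_const J) (trunc_at n \<gamma> 1)"
  shows "(\<exists>A. A \<subseteq> (\<Union>g\<in>G. \<Union>j\<in>{2..num_runs n \<gamma> - 1}. act_word J S f g ` set (sigma_path n \<gamma> j)) \<and>
            graph_connected (words S m) (E_star S f m) A \<and>
            (card (bdry J S f A) \<ge> 3 \<or>
             (even J \<and> (\<exists>i\<in>ZJ J. bdry J S f A = {i, opposite J i} \<and>
                                   {i, opposite J i} \<subseteq> ZJe J G S f))))
       \<and> (is_path (words S n) (E_line J S f n) (trunc_path n \<gamma>) \<longrightarrow>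
            (let B = bdry J S f (set (path_folding J S f n (interior_path n \<gamma>))) \<inter> ZJe J G S f
             in card B \<ge> 3 \<or>
                (even J \<and> (\<exists>i\<in>ZJ J. B = {i, opposite J i} \<and>
                                      {i, opposite J i} \<subseteq> ZJe J G S f))))"
proof -
  interpret regular_polygon J by unfold_locales (rule assms(1))
  obtain r \<phi> c where sys: "finite S" "0 < r" "r < 1"
    "\<forall>s\<in>S. \<phi> s \<in> D_star J \<and> (\<forall>x. f s x = r *\<^sub>R \<phi> s x + c s) \<and> f s ` Qpoly J \<subseteq> Qpoly J"
    "\<forall>i\<in>ZJ J. \<exists>s\<in>S. \<exists>j\<in>ZJ J. f s ` edge J j \<subseteq> edge J i"
    "\<forall>g\<in>G. \<exists>h. \<forall>s\<in>S. h s \<in> S \<and> inv_into UNIV (f (h s)) \<circ> g \<circ> f s \<in> G"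
    "\<forall>s\<in>S. \<forall>s'\<in>S. s \<noteq> s' \<and> f s ` Qpoly J \<inter> f s' ` Qpoly J \<noteq> {} \<longrightarrow>
       share_edge J G f \<phi> s s' \<or> share_vertex J f s s'"
    using assms(4) unfolding JG_ss_system_def by (elim conjE exE) (rule that, assumption+)
  interpret polygon_system J G S f r \<phi> c
  proof (intro polygon_system.intro polygon_system_axioms.intro)
    show "regular_polygon J" by unfold_locales
    show "subgroup G O2" "G \<subseteq> D_grp J" by (rule assms)+
    show "finite S" "0 < r" "r < 1" by (rule sys)+
    show "orthogonal_transformation (\<phi> s)" "f s ` Qpoly J \<subseteq> Qpoly J" if "s \<in> S" for s
      using bspec[OF sys(4) that] D_star_orthogonal by blast+
    show "f s x = r *\<^sub>R \<phi> s x + c s" if "s \<in> S" for s x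
      using bspec[OF sys(4) that] by simp
    show "\<exists>s\<in>S. \<exists>j\<in>ZJ J. f s ` edge J j \<subseteq> edge J i" if "i \<in> ZJ J" for i
      using sys(5) that by (rule bspec)
    show "\<exists>h. \<forall>s\<in>S. h s \<in> S \<and> finv (f (h s)) \<circ> g \<circ> f s \<in> G" if "g \<in> G" for g
      using sys(6) that by (rule bspec)
    show "share_edge J G f \<phi> s s' \<or> share_vertex J f s s'"
      if "s \<in> S" "s' \<in> S" "s \<noteq> s'" "f s ` Qpoly J \<inter> f s' ` Qpoly J \<noteq> {}" for s s'
      using bspec[OF bspec[OF sys(7) that(1)] that(2)] that(3,4) by simp
  qed
  show ?thesis using far_path_folds_wide[OF assms(5,6)] by blast
qed

end
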